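(* Let $n\ge1$ and let $\alpha,\beta\in\mathbb C^n$ satisfy $\Re\alpha_j+\Re\beta_j>-1$ and $\alpha_j,\beta_j\notin\{-1,-2,\ldots\}$ for all $1\le j\le n$. If $\psi\in L^p(\mathbb T^n)$ for some $1\le p\le\infty$, then $P_{\alpha,\beta}[\psi]$ is in the space $sh^p_{\alpha,\beta}(\mathbb D^n)$ and $$\|P_{\alpha,\beta}[\psi]\|_{\alpha,\beta;p}\le K(\alpha,\beta)\,\|\psi\|_p .$$ For $1\le p<\infty$ we have $$\lim_{\mathbf r\to\mathbf 1}\|(P_{\alpha,\beta}[\psi])_{\mathbf r}-\psi\|_{L^p(\mathbb T^n)}=0,\qquad \psi\in L^p(\mathbb T^n),$$ where $\mathbf r\to\mathbf 1=(1,\ldots,1)$ within $[0,1)^n$.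
   Context: $\mathbb D$ is the open unit disc and $\mathbb T$ the unit circle; $m_n$ is the normalized Haar measure on $\mathbb T^n$, and $L^p(\mathbb T^n)$ is taken with respect to $m_n$. For $1\le j\le n$, $$L_{\alpha_j,\beta_j}=(1-|z_j|^2)\frac{\partial^2}{\partial z_j\partial\overline{z_j}}+\alpha_jz_j\frac{\partial}{\partial z_j}+\beta_j\overline{z_j}\frac{\partial}{\partial\overline{z_j}}-\alpha_j\beta_j .$$ $sh_{\alpha,\beta}(\mathbb D^n)$ is the space of complex-valued $u\in C^2(\mathbb D^n)$ with $L_{\alpha_j,\beta_j}u=0$ on $\mathbb D^n$ for all $1\le j\le n$. For $u:\mathbb D^n\to\mathbb C$ and $\mathbf r\in[0,1)^n$, $u_{\mathbf r}(\zeta)=u(r_1\zeta_1,\ldots,r_n\zeta_n)$, $\zeta\in\mathbb T^n$. For $1\le p<\infty$, $sh^p_{\alpha,\beta}(\mathbb D^n)$ is the set of $u\in sh_{\alpha,\beta}(\mathbb D^n)$ with $$\|u\|_{\alpha,\beta;p}=\sup_{\mathbf r\in[0,1)^n}\Big(\int_{\mathbb T^n}|u_{\mathbf r}|^p\,dm_n\Big)^{1/p}<\infty;$$ for $p=\infty$, $sh^\infty_{\alpha,\beta}(\mathbb D^n)=sh_{\alpha,\beta}(\mathbb D^n)\cap L^\infty(\mathbb D^n)$ with the supremum norm. The $(\alpha,\beta)$-Poisson kernel is, for $z\in\mathbb D^n$, $\zeta\in\mathbb T^n$ (principal branches of powers), $$P_{\alpha,\beta}(z,\zeta)=\prod_{j=1}^n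 c_{\alpha_j,\beta_j}\frac{(1-|z_j|^2)^{\alpha_j+\beta_j+1}}{(1-z_j\overline{\zeta_j})^{\alpha_j+1}(1-\overline{z_j}\zeta_j)^{\beta_j+1}},\qquad c_{a,b}=\frac{\Gamma(a+1)\Gamma(b+1)}{\Gamma(a+b+1)},$$ and $P_{\alpha,\beta}[f](z)=\int_{\mathbb T^n}P_{\alpha,\beta}(z,\zeta)f(\zeta)\,dm_n(\zeta)$. The constant is $$K(\alpha,\beta)=e^{\frac\pi2\sum_{j=1}^n|\Im\alpha_j-\Im\beta_j|}\prod_{j=1}^n\left|\frac{\Gamma(\alpha_j+1)\Gamma(\beta_j+1)}{\Gamma(\alpha_j+\beta_j+1)}\right|\frac{\Gamma(\Re\alpha_j+\Re\beta_j+1)}{\Gamma^2\left(\frac{\Re\alpha_j+\Re\beta_j}2+1\right)} .$$ *)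

theory Defs
  imports "HOL-Probability.Probability"
begin

definition polydisc :: "(complex ^ 'n) set" where
  "polydisc = {z. \<forall>j. norm (z $ j) < 1}"

definition torus :: "(complex ^ 'n) set" where
  "torus = {\<zeta>. \<forall>j. norm (\<zeta> $ j) = 1}"

definition radii :: "(real ^ 'n) set" where
  "radii = {r. \<forall>j. 0 \<le> r $ j \<and> r $ j < 1}"

text \<open>
  Normalized Haar measure on the circle is normalized arc length, and on the torus it is the
  \<open>n\<close>-fold product of that measure, transported from functions to vectors. The lemmas
  \<open>prob_space_haar_torus\<close> and \<open>haar_torus_rotation\<close> below show that the result is
  the rotation-invariant Borel probability measure on the torus.
\<close>

definition haar_circle :: "complex measure" where
  "haar_circle = distr (uniform_measure lborel {0..<2 * pi})
     (restrict_space borel (sphere 0 1)) cis"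

definition haar_torus :: "(complex ^ 'n) measure" where
  "haar_torus = distr (PiM UNIV (\<lambda>_::'n. haar_circle)) (restrict_space borel torus) vec_lambda"

lemma space_haar_circle [simp]: "space haar_circle = sphere 0 1"
  by (simp add: haar_circle_def space_restrict_space)

lemma sets_haar_circle [simp]: "sets haar_circle = sets (restrict_space borel (sphere 0 1))"
  by (simp add: haar_circle_def)

lemma space_haar_torus [simp]: "space haar_torus = torus"
  by (simp add: haar_torus_def space_restrict_space)

lemma sets_haar_torus [simp]: "sets haar_torus = sets (restrict_space borel torus)"
  by (simp add: haar_torus_def)

lemma prob_space_uniform_angle: "prob_space (uniform_measure lborel {0..<2 * pi})"
  by (rule prob_space_uniform_measure) auto

lemma measurable_cis_circle:
  "(\<lambda>\<theta>. cis (\<theta> + t)) \<in> uniform_measure lborel {0..<2 * pi} \<rightarrow>\<^sub>M restrict_space borel (sphere 0 1)"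
proof -
  have "(\<lambda>\<theta>. cis (\<theta> + t)) \<in> borel_measurable borel"
    by (intro borel_measurable_continuous_onI continuous_intros)
  then show ?thesis
    by (intro measurable_restrict_space2) auto
qed

lemma prob_space_haar_circle: "prob_space haar_circle"
  unfolding haar_circle_def
  using prob_space.prob_space_distr[OF prob_space_uniform_angle measurable_cis_circle[of 0]] by simp

lemma emeasure_lborel_periodic_shift:
  fixes E :: "real set"
  assumes E: "E \<in> sets borel" and per: "\<And>x. x + p \<in> E \<longleftrightarrow> x \<in> E" and t: "0 \<le> t" "t \<le> p"
  shows "emeasure lborel ({0..<p} \<inter> {x. x + t \<in> E}) = emeasure lborel ({0..<p} \<inter> E)"
proof -
  have tr: "emeasure lborel S = emeasure lborel {x. x + c \<in> S}" if "S \<in> sets borel" for S c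
  proof -
    have "emeasure lborel S = emeasure (distr lborel borel ((+) c)) S"
      by (simp add: lborel_distr_plus)
    also have "\<dots> = emeasure lborel {x. x + c \<in> S}"
      using that by (subst emeasure_distr) (auto intro!: arg_cong[where f="emeasure lborel"] simp: add.commute)
    finally show ?thesis .
  qed
  have "emeasure lborel ({0..<p} \<inter> {x. x + t \<in> E}) = emeasure lborel {x. x + t \<in> {t..<p+t} \<inter> E}"
    by (intro arg_cong[where f="emeasure lborel"]) auto
  also have "\<dots> = emeasure lborel ({t..<p+t} \<inter> E)"
    using E by (intro tr[symmetric]) auto
  also have "\<dots> = emeasure lborel (({t..<p} \<inter> E) \<union> ({p..<p+t} \<inter> E))"
    using t by (intro arg_cong[where f="emeasure lborel"]) auto
  also have "\<dots> = emeasure lborel ({t..<p} \<inter> E) + emeasure lborel ({p..<p+t} \<inter> E)"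
    using E by (intro plus_emeasure[symmetric]) auto
  also have "emeasure lborel ({p..<p+t} \<inter> E) = emeasure lborel {x. x + p \<in> {p..<p+t} \<inter> E}"
    using E by (intro tr) auto
  also have "{x. x + p \<in> {p..<p+t} \<inter> E} = {0..<t} \<inter> E"
    using per by auto
  also have "emeasure lborel ({t..<p} \<inter> E) + emeasure lborel ({0..<t} \<inter> E)
      = emeasure lborel (({t..<p} \<inter> E) \<union> ({0..<t} \<inter> E))"
    using E by (intro plus_emeasure) auto
  also have "({t..<p} \<inter> E) \<union> ({0..<t} \<inter> E) = {0..<p} \<inter> E"
    using t by auto
  finally show ?thesis .
qed

lemma haar_circle_rotation:
  assumes c: "norm c = 1"
  shows "distr haar_circle haar_circle ((*) c) = haar_circle"
proof -
  define t where "t = Arg2pi c"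
  have t: "0 \<le> t" "t < 2 * pi" "c = cis t"
    using c Arg2pi[of c] by (simp_all add: cis_conv_exp t_def is_Arg_def)
  let ?U = "uniform_measure lborel {0..<2 * pi}" and ?S = "restrict_space borel (sphere 0 (1::real)) :: complex measure"
  have m0: "cis \<in> ?U \<rightarrow>\<^sub>M ?S" using measurable_cis_circle[of 0] by simp
  have "(*) c \<in> borel_measurable borel"
    by (intro borel_measurable_continuous_onI continuous_intros)
  then have mc: "(*) c \<in> ?S \<rightarrow>\<^sub>M ?S"
    using c by (intro measurable_restrict_space3) (auto simp: norm_mult)
  have "distr haar_circle haar_circle ((*) c) = distr (distr ?U ?S cis) ?S ((*) c)"
    by (auto simp: haar_circle_def intro: distr_cong)
  also have "\<dots> = distr ?U ?S (\<lambda>\<theta>. cis (\<theta> + t))"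
    by (subst distr_distr[OF mc m0]) (auto simp: t cis_mult o_def add.commute)
  also have "\<dots> = distr ?U ?S cis"
  proof (rule measure_eqI)
    fix A assume "A \<in> sets (distr ?U ?S (\<lambda>\<theta>. cis (\<theta> + t)))"
    then have A: "A \<in> sets ?S" by simp
    have mm: "{x. cis (x + s) \<in> A} \<in> sets borel" for s
      using measurable_sets[OF measurable_cis_circle[of s] A] by (simp add: vimage_def)
    have "emeasure lborel ({0..<2 * pi} \<inter> {x. x + t \<in> {x. cis x \<in> A}})
        = emeasure lborel ({0..<2 * pi} \<inter> {x. cis x \<in> A})"
      using mm[of 0] t(1,2) by (intro emeasure_lborel_periodic_shift) (simp_all flip: cis_mult)
    then show "emeasure (distr ?U ?S (\<lambda>\<theta>. cis (\<theta> + t))) A = emeasure (distr ?U ?S cis) A"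
      using mm[of t] mm[of 0]
      by (simp add: emeasure_distr[OF measurable_cis_circle A] emeasure_distr[OF m0 A] vimage_def)
  qed auto
  finally show ?thesis by (simp add: haar_circle_def)
qed

lemma measurable_vec_lambda_torus:
  "vec_lambda \<in> PiM UNIV (\<lambda>_::'n::finite. haar_circle) \<rightarrow>\<^sub>M restrict_space borel torus"
proof (rule measurable_restrict_space2)
  show "vec_lambda \<in> space (PiM UNIV (\<lambda>_::'n. haar_circle)) \<rightarrow> torus"
    by (auto simp: space_PiM torus_def PiE_def Pi_def)
  have id: "(\<lambda>z::complex. z) \<in> borel_measurable haar_circle"
    unfolding haar_circle_def measurable_distr_eq1 by (rule measurable_restrict_space1) simp
  have c: "(\<lambda>f. f j) \<in> borel_measurable (PiM UNIV (\<lambda>_::'n. haar_circle))" for j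
    using measurable_compose[OF measurable_component_singleton[of j UNIV "\<lambda>_. haar_circle"] id] by simp
  show "vec_lambda \<in> borel_measurable (PiM UNIV (\<lambda>_::'n. haar_circle))"
  proof (subst borel_measurable_euclidean_space, rule ballI)
    fix b :: "complex ^ 'n" assume "b \<in> Basis"
    then obtain j u where b: "b = axis j u" by (auto simp: Basis_vec_def)
    show "(\<lambda>f. vec_lambda f \<bullet> b) \<in> borel_measurable (PiM UNIV (\<lambda>_::'n. haar_circle))"
      unfolding b inner_axis using c[of j] by simp
  qed
qed

lemma prob_space_haar_torus: "prob_space (haar_torus :: (complex ^ 'n::finite) measure)"
proof -
  show ?thesis
    unfolding haar_torus_def
    by (intro prob_space.prob_space_distr prob_space_PiM prob_space_haar_circle measurable_vec_lambda_torus)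
qed

lemma haar_torus_rotation:
  fixes c :: "complex ^ 'n::finite"
  assumes c: "c \<in> torus"
  shows "distr haar_torus haar_torus (\<lambda>\<zeta>. \<chi> j. c $ j * \<zeta> $ j) = haar_torus"
proof -
  let ?P = "PiM UNIV (\<lambda>_::'n. haar_circle)" and ?T = "restrict_space borel torus :: (complex ^ 'n) measure"
  let ?R = "\<lambda>\<zeta>. \<chi> j. c $ j * \<zeta> $ j" and ?r = "\<lambda>f j. c $ j * f j"
  have cj: "norm (c $ j) = 1" for j using c by (simp add: torus_def)
  have "(*) (c $ j) \<in> borel_measurable borel" for j
    by (intro borel_measurable_continuous_onI continuous_intros)
  then have mc: "(*) (c $ j) \<in> haar_circle \<rightarrow>\<^sub>M haar_circle" for j
    using cj unfolding haar_circle_def measurable_distr_eq1 measurable_distr_eq2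
    by (intro measurable_restrict_space3) (auto simp: norm_mult)
  have mr: "?r \<in> ?P \<rightarrow>\<^sub>M ?P"
  proof (rule measurable_PiM_single')
    show "(\<lambda>f. c $ j * f j) \<in> ?P \<rightarrow>\<^sub>M haar_circle" for j
      using measurable_compose[OF measurable_component_singleton[of j UNIV "\<lambda>_. haar_circle"] mc[of j]]
      by simp
    show "?r \<in> space ?P \<rightarrow> (\<Pi>\<^sub>E j\<in>UNIV. space haar_circle)"
      by (auto simp: space_PiM norm_mult cj PiE_iff)
  qed
  have mR: "?R \<in> ?T \<rightarrow>\<^sub>M ?T"
  proof (rule measurable_restrict_space3)
    show "?R \<in> borel_measurable borel"
      by (intro borel_measurable_continuous_onI continuous_intros)
    show "?R \<in> torus \<rightarrow> torus" using cj by (auto simp: torus_def norm_mult)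
  qed
  have "distr haar_torus haar_torus ?R = distr (distr ?P ?T vec_lambda) ?T ?R"
    by (auto simp: haar_torus_def intro: distr_cong)
  also have "\<dots> = distr ?P ?T (\<lambda>f. vec_lambda (?r f))"
    by (subst distr_distr[OF mR measurable_vec_lambda_torus]) (auto simp: o_def)
  also have "\<dots> = distr (distr ?P ?P ?r) ?T vec_lambda"
    by (subst distr_distr[OF measurable_vec_lambda_torus mr]) (auto simp: o_def)
  also have "distr ?P ?P ?r = ?P"
  proof -
    interpret product_sigma_finite "\<lambda>_::'n. haar_circle"
      using prob_space_haar_circle by (simp add: product_sigma_finite_def prob_space_imp_sigma_finite)
    show ?thesis
    proof (rule PiM_eqI)
      fix A :: "'n \<Rightarrow> complex set"
      assume A: "\<And>j. j \<in> UNIV \<Longrightarrow> A j \<in> sets haar_circle"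
      have B: "(*) (c $ j) -` A j \<inter> space haar_circle \<in> sets haar_circle" for j
        using measurable_sets[OF mc A] by simp
      have "emeasure (distr ?P ?P ?r) (Pi\<^sub>E UNIV A) = emeasure ?P (?r -` Pi\<^sub>E UNIV A \<inter> space ?P)"
        using A by (intro emeasure_distr mr sets_PiM_I_finite) auto
      also have "?r -` Pi\<^sub>E UNIV A \<inter> space ?P = Pi\<^sub>E UNIV (\<lambda>j. (*) (c $ j) -` A j \<inter> space haar_circle)"
        by (auto simp: space_PiM PiE_iff)
      also have "emeasure ?P \<dots> = (\<Prod>j\<in>UNIV. emeasure haar_circle ((*) (c $ j) -` A j \<inter> space haar_circle))"
        by (rule emeasure_PiM) (use B in auto)
      also have "\<dots> = (\<Prod>j\<in>UNIV. emeasure (distr haar_circle haar_circle ((*) (c $ j))) (A j))"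
        by (intro prod.cong refl emeasure_distr[symmetric] mc A)
      finally show "emeasure (distr ?P ?P ?r) (Pi\<^sub>E UNIV A) = (\<Prod>j\<in>UNIV. emeasure haar_circle (A j))"
        by (simp add: haar_circle_rotation[OF cj])
    qed auto
  qed
  finally show ?thesis by (simp add: haar_torus_def)
qed

text \<open>
  \<open>L\<^sup>p\<close> spaces for an exponent in \<open>{1..\<infinity>}\<close>. Functions are not identified when
  they agree almost everywhere.
\<close>

definition Lp_norm :: "'a measure \<Rightarrow> ennreal \<Rightarrow> ('a \<Rightarrow> complex) \<Rightarrow> ennreal" where
  "Lp_norm M p f =
    (if p = \<infinity> then esssup M (\<lambda>x. ennreal (norm (f x)))
     else let I = (\<integral>\<^sup>+ x. ennreal (norm (f x) powr enn2real p) \<partial>M)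
          in if I = \<infinity> then \<infinity> else ennreal (enn2real I powr (1 / enn2real p)))"

definition Lp_space :: "'a measure \<Rightarrow> ennreal \<Rightarrow> ('a \<Rightarrow> complex) set" where
  "Lp_space M p = {f \<in> borel_measurable M. Lp_norm M p f < \<infinity>}"

text \<open>
  \<open>C\<^sup>2\<close> is meant in the real sense. On an open subset of a finite-dimensional space it is
  enough to ask that all directional derivatives are continuous.
\<close>

definition C1_on :: "'a set \<Rightarrow> ('a::real_normed_vector \<Rightarrow> 'b::real_normed_vector) \<Rightarrow> bool" where
  "C1_on S u \<longleftrightarrow> (\<forall>z\<in>S. u differentiable (at z)) \<and>
     (\<forall>v. continuous_on S (\<lambda>z. frechet_derivative u (at z) v))"

definition C2_on :: "'a set \<Rightarrow> ('a::real_normed_vector \<Rightarrow> 'b::real_normed_vector) \<Rightarrow> bool" where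
  "C2_on S u \<longleftrightarrow> C1_on S u \<and> (\<forall>v. C1_on S (\<lambda>z. frechet_derivative u (at z) v))"

text \<open>
  The Wirtinger derivatives \<open>\<partial>/\<partial>z\<^sub>j = (\<partial>/\<partial>x\<^sub>j - \<i> \<partial>/\<partial>y\<^sub>j) / 2\<close>
  and \<open>\<partial>/\<partial>cnj z\<^sub>j = (\<partial>/\<partial>x\<^sub>j + \<i> \<partial>/\<partial>y\<^sub>j) / 2\<close>.
\<close>

definition d_z :: "'n::finite \<Rightarrow> (complex ^ 'n \<Rightarrow> complex) \<Rightarrow> complex ^ 'n \<Rightarrow> complex" where
  "d_z j u z = (frechet_derivative u (at z) (axis j 1)
                - \<i> * frechet_derivative u (at z) (axis j \<i>)) / 2"

definition d_zbar :: "'n::finite \<Rightarrow> (complex ^ 'n \<Rightarrow> complex) \<Rightarrow> complex ^ 'n \<Rightarrow> complex" where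
  "d_zbar j u z = (frechet_derivative u (at z) (axis j 1)
                   + \<i> * frechet_derivative u (at z) (axis j \<i>)) / 2"

definition L_op :: "complex ^ 'n::finite \<Rightarrow> complex ^ 'n \<Rightarrow> 'n \<Rightarrow>
    (complex ^ 'n \<Rightarrow> complex) \<Rightarrow> complex ^ 'n \<Rightarrow> complex" where
  "L_op \<alpha> \<beta> j u z =
     of_real (1 - (norm (z $ j))\<^sup>2) * d_z j (d_zbar j u) z
     + \<alpha> $ j * z $ j * d_z j u z
     + \<beta> $ j * cnj (z $ j) * d_zbar j u z
     - \<alpha> $ j * \<beta> $ j * u z"

text \<open>
  Functions on the polydisc are total functions on \<open>complex ^ 'n\<close>; their values
  outside the (open) polydisc play no role in the definitions below.
\<close>

definition sh :: "complex ^ 'n::finite \<Rightarrow> complex ^ 'n \<Rightarrow> (complex ^ 'n \<Rightarrow> complex) set" where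
  "sh \<alpha> \<beta> = {u. C2_on polydisc u \<and> (\<forall>j. \<forall>z\<in>polydisc. L_op \<alpha> \<beta> j u z = 0)}"

definition dilate :: "(complex ^ 'n \<Rightarrow> complex) \<Rightarrow> real ^ 'n \<Rightarrow> complex ^ 'n \<Rightarrow> complex" where
  "dilate u r \<zeta> = u (\<chi> j. of_real (r $ j) * \<zeta> $ j)"

definition sh_norm :: "ennreal \<Rightarrow> (complex ^ 'n::finite \<Rightarrow> complex) \<Rightarrow> ennreal" where
  "sh_norm p u =
    (if p = \<infinity> then (SUP z\<in>polydisc. ennreal (norm (u z)))
     else (SUP r\<in>radii. Lp_norm haar_torus p (dilate u r)))"

definition sh_p :: "complex ^ 'n::finite \<Rightarrow> complex ^ 'n \<Rightarrow> ennreal \<Rightarrow>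
    (complex ^ 'n \<Rightarrow> complex) set" where
  "sh_p \<alpha> \<beta> p = {u \<in> sh \<alpha> \<beta>. sh_norm p u < \<infinity>}"

definition c_const :: "complex \<Rightarrow> complex \<Rightarrow> complex" where
  "c_const a b = Gamma (a + 1) * Gamma (b + 1) / Gamma (a + b + 1)"

definition poisson_kernel :: "complex ^ 'n::finite \<Rightarrow> complex ^ 'n \<Rightarrow> complex ^ 'n \<Rightarrow>
    complex ^ 'n \<Rightarrow> complex" where
  "poisson_kernel \<alpha> \<beta> z \<zeta> =
    (\<Prod>j\<in>UNIV. c_const (\<alpha> $ j) (\<beta> $ j) *
       (of_real (1 - (norm (z $ j))\<^sup>2) powr (\<alpha> $ j + \<beta> $ j + 1)) /
       ((1 - z $ j * cnj (\<zeta> $ j)) powr (\<alpha> $ j + 1) *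
        (1 - cnj (z $ j) * \<zeta> $ j) powr (\<beta> $ j + 1)))"

definition poisson_integral :: "complex ^ 'n::finite \<Rightarrow> complex ^ 'n \<Rightarrow>
    (complex ^ 'n \<Rightarrow> complex) \<Rightarrow> complex ^ 'n \<Rightarrow> complex" where
  "poisson_integral \<alpha> \<beta> f z = (LINT \<zeta>|haar_torus. poisson_kernel \<alpha> \<beta> z \<zeta> * f \<zeta>)"

definition K_const :: "complex ^ 'n::finite \<Rightarrow> complex ^ 'n \<Rightarrow> real" where
  "K_const \<alpha> \<beta> =
    exp (pi / 2 * (\<Sum>j\<in>UNIV. \<bar>Im (\<alpha> $ j) - Im (\<beta> $ j)\<bar>)) *
    (\<Prod>j\<in>UNIV.
       norm (Gamma (\<alpha> $ j + 1) * Gamma (\<beta> $ j + 1) / Gamma (\<alpha> $ j + \<beta> $ j + 1)) *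
       (Gamma (Re (\<alpha> $ j) + Re (\<beta> $ j) + 1) /
        (Gamma ((Re (\<alpha> $ j) + Re (\<beta> $ j)) / 2 + 1))\<^sup>2))"

end

theory Submission
  imports Defs
begin

text \<open>
  The Poisson integral \<open>T f\<close> integrates \<open>f\<close> against a product of kernels of the disc, and
  Haar measure on the torus is a product measure, so that the analysis takes place on the circle.
  
  \<^emph>\<open>Means of the kernel.\<close> By the binomial series and orthogonality, the mean over \<open>\<eta>\<close> of
  \<open>(1 - w * cnj \<eta>) powr (-A) * (1 - cnj w * \<eta>) powr (-B)\<close> is the power series in
  \<open>x = |w|\<^sup>2\<close> with coefficients \<open>pochhammer A k * pochhammer B k / (fact k)\<^sup>2\<close>
  (\<open>circle_mean_hypergeometric\<close>). The other factor of the kernel has the exponent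
  \<open>A + B - 1\<close>, so these coefficients are to be compared with the binomial coefficients
  \<open>pochhammer (A + B - 1) k / fact k\<close> of \<open>(1 - x) powr (- (A + B - 1))\<close>. The quotient of the two tends
  to \<open>Gamma (A + B - 1) / (Gamma A * Gamma B)\<close> (\<open>pochhammer_ratio_tendsto\<close>), and this has two
  consequences. For \<open>A = B\<close> real, which is the case of the modulus of the kernel, the quotient increases;
  hence the mean of the modulus is at most the limit value. This and the estimate
  \<open>|Arg (1 - w * cnj \<eta>)| < pi / 2\<close> yield exactly the constant \<open>K_const\<close>
  (\<open>integral_majorant_kernel_le\<close>, \<open>norm_circle_kernel_le\<close>, \<open>integral_Q_le\<close>). For general
  \<open>A = a + 1\<close> and \<open>B = b + 1\<close>, an Abelian argument shows that the mean of the kernel itself tends to 1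
  at the boundary (\<open>kernel_mean_tendsto_1\<close>).
  
  \<^emph>\<open>The differential equations.\<close> The function \<open>f\<close> is integrable, because the torus has finite measure.
  The kernel is smooth in \<open>z\<close>, with derivatives that are continuous on the product of the polydisc and the compact
  torus, so one may differentiate under the integral sign (\<open>has_derivative_kernel_op\<close>). For fixed
  \<open>\<zeta>\<close> the kernel solves the equations by an identity of rational functions
  (\<open>kernel_harmonicity_identity\<close>).
  
  \<^emph>\<open>The norm bound.\<close> The majorant of the kernel on the torus is symmetric and its integral in either
  variable is at most \<open>K_const\<close>. For finite exponents the Schur test gives the bound
  (\<open>power_integral_poisson_le\<close>); for the exponent \<open>\<infinity>\<close> it is immediate
  (\<open>poisson_integral_bounded\<close>).
  
  \<^emph>\<open>Convergence.\<close> The kernels have bounded \<open>L\<^sup>1\<close> norms, concentrate at the boundary point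
  (\<open>Q_concentrates\<close>) and have means tending to 1. So \<open>T f\<close> converges radially and uniformly to a
  Lipschitz function \<open>f\<close>. The uniform norm bound makes the set of functions for which convergence holds closed, and
  it grows from Lipschitz functions to indicators of closed sets, of Borel sets, to simple functions and finally
  to all of \<open>L\<^sup>p\<close> (\<open>converges_in_power_Lp\<close>).
\<close>

section \<open>Integration over the circle\<close>

lemma measurable_haar_circle_eq: "haar_circle \<rightarrow>\<^sub>M N = restrict_space borel (sphere 0 1) \<rightarrow>\<^sub>M N"
  by (rule measurable_cong_sets) simp_all

lemma continuous_on_measurable_circle:
  fixes f :: "complex \<Rightarrow> 'a::topological_space"
  assumes "continuous_on (sphere 0 1) f"
  shows "f \<in> borel_measurable haar_circle"
  unfolding measurable_haar_circle_eq
  using assms by (rule borel_measurable_continuous_on_restrict)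

lemma continuous_on_integrable_circle:
  fixes f :: "complex \<Rightarrow> 'a::{banach,second_countable_topology}"
  assumes "continuous_on (sphere 0 1) f"
  shows "integrable haar_circle f"
proof -
  interpret prob_space haar_circle by (rule prob_space_haar_circle)
  have "bounded (f ` sphere 0 1)"
    using assms by (intro compact_imp_bounded compact_continuous_image) auto
  then obtain B where "\<And>x. x \<in> sphere 0 1 \<Longrightarrow> norm (f x) \<le> B"
    unfolding bounded_iff by blast
  then show ?thesis
    using assms by (intro integrable_const_bound[of _ B] AE_I2 continuous_on_measurable_circle) auto
qed

lemma haar_circle_integral_rotate:
  fixes f :: "complex \<Rightarrow> complex"
  assumes "norm c = 1" "continuous_on (sphere 0 1) f"
  shows "(LINT \<eta>|haar_circle. f (c * \<eta>)) = (LINT \<eta>|haar_circle. f \<eta>)"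
proof -
  have m: "(*) c \<in> haar_circle \<rightarrow>\<^sub>M haar_circle"
    unfolding haar_circle_def measurable_distr_eq1 measurable_distr_eq2
    using assms(1) by (intro measurable_restrict_space3)
     (auto simp: norm_mult intro!: borel_measurable_continuous_onI continuous_intros)
  show ?thesis
    by (subst (2) haar_circle_rotation[OF assms(1), symmetric])
       (rule integral_distr[symmetric, OF m continuous_on_measurable_circle[OF assms(2)]])
qed

text \<open>
  Rotating by a suitable \<open>c\<close> multiplies the integrand by \<open>-1\<close> without
  changing the integral, which forces the integral to vanish.
\<close>

lemma haar_circle_orthogonal:
  "(LINT \<eta>|haar_circle. cnj \<eta> ^ k * \<eta> ^ l) = (if k = l then 1 else 0)"
proof (cases "k = l")
  case True
  interpret prob_space haar_circle by (rule prob_space_haar_circle)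
  have "(LINT \<eta>|haar_circle. cnj \<eta> ^ k * \<eta> ^ l) = (LINT \<eta>|haar_circle. 1)"
    using True by (intro Bochner_Integration.integral_cong) 
      (auto simp flip: power_mult_distrib simp: mult.commute complex_norm_square[symmetric])
  then show ?thesis using True prob_space by simp
next
  case False
  define m where "m = real l - real k"
  have m: "m \<noteq> 0" using False by (simp add: m_def)
  \<comment> \<open>the angle is chosen so that \<open>cnj c ^ k * c ^ l = cis pi = -1\<close>\<close>
  define c where "c = cis (pi / m)"
  have c: "norm c = 1" by (simp add: c_def)
  have "cnj c ^ k * c ^ l = cis (real k * - (pi / m) + real l * (pi / m))"
    by (simp only: c_def cis_cnj Complex.DeMoivre cis_mult)
  also have "real k * - (pi / m) + real l * (pi / m) = m * (pi / m)"
    unfolding m_def by (simp only: left_diff_distrib)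
  finally have "cnj c ^ k * c ^ l = cis (m * (pi / m))" .
  then have cc: "cnj c ^ k * c ^ l = -1" using m by simp
  let ?f = "\<lambda>\<eta>. cnj \<eta> ^ k * \<eta> ^ l"
  have "(LINT \<eta>|haar_circle. ?f \<eta>) = (LINT \<eta>|haar_circle. ?f (c * \<eta>))"
    by (intro haar_circle_integral_rotate[symmetric] c continuous_intros)
  also have "\<dots> = (LINT \<eta>|haar_circle. (cnj c ^ k * c ^ l) * ?f \<eta>)"
    by (simp add: power_mult_distrib mult_ac)
  also have "\<dots> = - (LINT \<eta>|haar_circle. ?f \<eta>)" by (simp add: cc)
  finally show ?thesis using False by simp
qed

text \<open>
  Termwise integration of a power series in the unimodular function \<open>e\<close>, which is the
  coordinate or its conjugate below: the norms of the terms are bounded uniformly on the circle by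
  a convergent series, so summation and integration may be exchanged.
\<close>

lemma integral_power_series_circle:
  fixes h :: "complex \<Rightarrow> complex"
  assumes a: "summable (\<lambda>k. norm (a k))" and h: "continuous_on (sphere 0 1) h"
    and e: "continuous_on (sphere 0 1) e" "\<And>\<eta>. norm \<eta> = 1 \<Longrightarrow> norm (e \<eta>) = 1"
    and f: "\<And>\<eta>. norm \<eta> = 1 \<Longrightarrow> (\<lambda>k. a k * e \<eta> ^ k) sums f \<eta>"
  shows "(\<lambda>k. a k * (LINT \<eta>|haar_circle. e \<eta> ^ k * h \<eta>)) sums (LINT \<eta>|haar_circle. f \<eta> * h \<eta>)"
proof -
  interpret prob_space haar_circle by (rule prob_space_haar_circle)
  let ?F = "\<lambda>k \<eta>. a k * (e \<eta> ^ k * h \<eta>)"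
  have "bounded (h ` sphere 0 1)"
    using h by (intro compact_imp_bounded compact_continuous_image) auto
  then obtain B where B: "\<And>x. x \<in> sphere 0 1 \<Longrightarrow> norm (h x) \<le> B"
    unfolding bounded_iff by blast
  have nF: "norm (?F k \<eta>) \<le> norm (a k) * B" if "norm \<eta> = 1" for k \<eta>
    using B[of \<eta>] e(2)[OF that] that by (simp add: norm_mult norm_power mult_left_mono)
  have int: "integrable haar_circle (?F k)" for k
    by (intro continuous_on_integrable_circle continuous_intros h e)
  have sm: "summable (\<lambda>k. norm (?F k \<eta>))" if "norm \<eta> = 1" for \<eta>
    by (rule summable_comparison_test[OF _ summable_mult2[OF a, of B]]) (use nF[OF that] in auto)
  have si: "summable (\<lambda>k. LINT \<eta>|haar_circle. norm (?F k \<eta>))"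
  proof (rule summable_comparison_test[OF _ summable_mult2[OF a, of B]], intro exI allI impI)
    fix k
    have "(LINT \<eta>|haar_circle. norm (?F k \<eta>)) \<le> (LINT \<eta>|haar_circle. norm (a k) * B)"
      using nF by (intro integral_mono integrable_norm int) auto
    then show "norm (LINT \<eta>|haar_circle. norm (?F k \<eta>)) \<le> norm (a k) * B"
      using prob_space by simp
  qed
  have "(\<lambda>k. integral\<^sup>L haar_circle (?F k)) sums (LINT \<eta>|haar_circle. (\<Sum>k. ?F k \<eta>))"
    using sm si by (intro sums_integral int AE_I2) auto
  also have "(LINT \<eta>|haar_circle. (\<Sum>k. ?F k \<eta>)) = (LINT \<eta>|haar_circle. f \<eta> * h \<eta>)"
  proof (intro Bochner_Integration.integral_cong refl)
    fix \<eta> assume "\<eta> \<in> space haar_circle"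
    then have "norm \<eta> = 1" by simp
    from sums_mult2[OF f[OF this], of "h \<eta>"] show "(\<Sum>k. ?F k \<eta>) = f \<eta> * h \<eta>"
      by (simp add: sums_iff mult.assoc)
  qed
  finally show ?thesis by simp
qed

section \<open>Circular means as power series\<close>

lemma one_minus_not_nonpos:
  assumes "norm (z::complex) < 1"
  shows "1 - z \<notin> \<real>\<^sub>\<le>\<^sub>0" "1 - z \<noteq> 0" "Re (1 - z) > 0"
proof -
  show "Re (1 - z) > 0" using complex_Re_le_cmod[of z] assms by simp
  then show "1 - z \<notin> \<real>\<^sub>\<le>\<^sub>0" "1 - z \<noteq> 0" 
    by (auto simp: complex_nonpos_Reals_iff)
qed

lemma gbinomial_neg_pochhammer:
  fixes z :: "'a::field_char_0"
  shows "((-A) gchoose k) * (-z) ^ k = pochhammer A k / fact k * z ^ k"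
proof -
  have "(-1) ^ k * (-z) ^ k = z ^ k" by (simp flip: power_mult_distrib)
  then show ?thesis by (simp add: gbinomial_pochhammer)
qed

text \<open>
  The binomial series, with its coefficients written as Pochhammer symbols so that quotients of
  consecutive coefficients and their limits are easy to read off.
\<close>

lemma powr_binomial_series:
  assumes "norm (z::complex) < 1"
  shows "(\<lambda>k. pochhammer A k / fact k * z ^ k) sums ((1 - z) powr (-A))"
  using gen_binomial_complex[of "-z" "-A"] assms by (simp add: gbinomial_neg_pochhammer)

lemma summable_norm_binomial_series:
  assumes "norm (z::complex) < 1"
  shows "summable (\<lambda>k. norm (pochhammer A k / fact k * z ^ k))"
proof -
  have "summable (\<lambda>n. norm (((-A) gchoose n) * (-z) ^ n))"
    using assms by (intro abs_summable_in_conv_radius) (simp_all add: conv_radius_gchoose)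
  then show ?thesis by (simp only: gbinomial_neg_pochhammer)
qed

text \<open>
  A Parseval identity for the two binomial series: by orthogonality only the diagonal terms of
  their product survive. The sum is the hypergeometric value \<open>F(A, B; 1; |w|\<^sup>2)\<close>, and
  every fact about means of the kernel below is read off from these coefficients.
\<close>

lemma circle_mean_hypergeometric:
  assumes w: "norm (w::complex) < 1"
  shows "(\<lambda>k. (pochhammer A k / fact k) * (pochhammer B k / fact k) * of_real (((norm w)\<^sup>2) ^ k)) sums
    (LINT \<eta>|haar_circle. (1 - w * cnj \<eta>) powr (-A) * (1 - cnj w * \<eta>) powr (-B))"
proof -
  let ?a = "\<lambda>k. pochhammer A k / fact k * w ^ k" and ?b = "\<lambda>k. pochhammer B k / fact k * cnj w ^ k"
  have nw: "norm (cnj w) < 1" using w by simp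
  have wn: "norm (w * cnj \<eta>) < 1" "norm (cnj w * \<eta>) < 1" if "norm \<eta> = 1" for \<eta>
    using w that by (simp_all add: norm_mult)
  have sa: "(\<lambda>k. ?a k * cnj \<eta> ^ k) sums (1 - w * cnj \<eta>) powr (-A)" if "norm \<eta> = 1" for \<eta>
    using powr_binomial_series[OF wn(1)[OF that], of A] by (simp add: power_mult_distrib mult_ac)
  have sb: "(\<lambda>k. ?b k * \<eta> ^ k) sums (1 - cnj w * \<eta>) powr (-B)" if "norm \<eta> = 1" for \<eta>
    using powr_binomial_series[OF wn(2)[OF that], of B] by (simp add: power_mult_distrib mult_ac)
  have cb: "continuous_on (sphere 0 1) (\<lambda>\<eta>. (1 - cnj w * \<eta>) powr (-B))"
    using one_minus_not_nonpos(2,3)[OF wn(2)]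
    by (intro continuous_on_powr_complex continuous_intros subsetI CollectI) (auto intro: less_imp_le simp del: minus_complex.sel)
  have "(LINT \<eta>|haar_circle. cnj \<eta> ^ k * (1 - cnj w * \<eta>) powr (-B)) = ?b k" for k
  proof -
    have "(\<lambda>l. ?b l * (LINT \<eta>|haar_circle. \<eta> ^ l * cnj \<eta> ^ k)) sums
       (LINT \<eta>|haar_circle. (1 - cnj w * \<eta>) powr (-B) * cnj \<eta> ^ k)"
      by (intro integral_power_series_circle summable_norm_binomial_series nw continuous_intros sb) auto
    moreover have "(\<lambda>l. ?b l * (LINT \<eta>|haar_circle. \<eta> ^ l * cnj \<eta> ^ k)) = (\<lambda>l. if l = k then ?b l else 0)"
      using haar_circle_orthogonal[of k] by (auto simp: mult.commute)
    ultimately show ?thesis using sums_single[of k ?b] by (simp add: sums_iff mult.commute)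
  qed
  moreover have "(\<lambda>k. ?a k * (LINT \<eta>|haar_circle. cnj \<eta> ^ k * (1 - cnj w * \<eta>) powr (-B))) sums
       (LINT \<eta>|haar_circle. (1 - w * cnj \<eta>) powr (-A) * (1 - cnj w * \<eta>) powr (-B))"
    by (intro integral_power_series_circle summable_norm_binomial_series w continuous_intros sa cb) auto
  moreover have "of_real ((norm w)\<^sup>2 ^ k) = w ^ k * cnj w ^ k" for k
    by (simp add: complex_norm_square[symmetric] flip: power_mult_distrib of_real_power)
  ultimately show ?thesis by (simp add: mult_ac)
qed

section \<open>Limits of Pochhammer quotients\<close>

lemma pochhammer_Suc_rGamma_series:
  fixes z :: "'a::{banach,real_normed_field}"
  shows "pochhammer z (Suc n) = rGamma_series z n * (fact n * exp (z * of_real (ln (of_nat n))))"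
  by (simp add: rGamma_series_def)

text \<open>
  Compares the hypergeometric coefficients with those of \<open>(1 - x) powr (- (A + B - 1))\<close>.
  Euler's product for \<open>1 / Gamma\<close> says that \<open>pochhammer z (n + 1)\<close> is asymptotic to
  \<open>rGamma z * fact n * n powr z\<close>; in the quotient the powers of \<open>n\<close> cancel up to a
  factor \<open>n / (n + 1)\<close> and only the values of \<open>rGamma\<close> remain.
\<close>

lemma pochhammer_ratio_tendsto:
  fixes A B :: "'a::Gamma"
  assumes "A + B - 1 \<notin> \<int>\<^sub>\<le>\<^sub>0"
  shows "(\<lambda>k. pochhammer A k * pochhammer B k / (fact k * pochhammer (A + B - 1) k))
     \<longlonglongrightarrow> Gamma (A + B - 1) * (rGamma A * rGamma B)"
proof -
  let ?S = "A + B - 1"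
  have r0: "rGamma ?S \<noteq> 0" using assms by (simp add: rGamma_eq_zero_iff)
  have "(\<lambda>n. rGamma_series A n * rGamma_series B n / rGamma_series ?S n * (of_nat n / of_nat (Suc n)))
     \<longlonglongrightarrow> rGamma A * rGamma B / rGamma ?S * 1"
    by (intro tendsto_intros r0 LIMSEQ_n_over_Suc_n)
  moreover have "eventually (\<lambda>n. rGamma_series A n * rGamma_series B n / rGamma_series ?S n * (of_nat n / of_nat (Suc n))
     = pochhammer A (Suc n) * pochhammer B (Suc n) / (fact (Suc n) * pochhammer ?S (Suc n))) sequentially"
    using eventually_gt_at_top[of 0]
  proof eventually_elim
    case (elim n)
    have "exp (A * of_real (ln (real n))) * exp (B * of_real (ln (real n)))
       = exp (?S * of_real (ln (real n))) * exp (of_real (ln (real n)))"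
      by (simp flip: exp_add add: algebra_simps)
    also have "exp (of_real (ln (real n)) :: 'a) = of_nat n" using elim by (simp add: exp_of_real)
    finally have e: "exp (A * of_real (ln (real n))) * exp (B * of_real (ln (real n)))
       = exp (?S * of_real (ln (real n))) * of_nat n" .
    have "rGamma_series A n * rGamma_series B n * (fact n * fact n) * (exp (A * of_real (ln (real n))) * exp (B * of_real (ln (real n))))
      / (of_nat (Suc n) * fact n * (rGamma_series ?S n * (fact n * exp (?S * of_real (ln (of_nat n))))))
      = rGamma_series A n * rGamma_series B n / rGamma_series ?S n * (of_nat n / of_nat (Suc n))"
      unfolding e by (simp add: divide_simps del: of_nat_Suc)
    then show ?case unfolding pochhammer_Suc_rGamma_series fact_Suc by (simp only: mult_ac of_nat_mult)
  qed
  ultimately have "(\<lambda>n. pochhammer A (Suc n) * pochhammer B (Suc n) / (fact (Suc n) * pochhammer ?S (Suc n)))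
     \<longlonglongrightarrow> rGamma A * rGamma B / rGamma ?S * 1"
    by (blast intro: Lim_transform_eventually)
  then show ?thesis
    by (subst filterlim_sequentially_Suc[symmetric]) (simp add: rGamma_inverse_Gamma field_simps)
qed


section \<open>The positive majorant of the kernel\<close>

text \<open>
  Up to a constant, the modulus of the \<open>(a, b)\<close>-Poisson kernel of the disc, for
  \<open>s = Re a + Re b\<close>.
\<close>

definition majorant_kernel :: "real \<Rightarrow> complex \<Rightarrow> complex \<Rightarrow> real" where
  "majorant_kernel s w \<eta> = (1 - (norm w)\<^sup>2) powr (s + 1) / norm (1 - w * cnj \<eta>) powr (s + 2)"

text \<open>
  The supremum over the disc of the integral of \<open>majorant_kernel s w\<close>, which is its limit
  as \<open>w\<close> approaches the circle.
\<close>

definition majorant_mass :: "real \<Rightarrow> real" where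
  "majorant_mass s = Gamma (s + 1) / (Gamma (s / 2 + 1))\<^sup>2"

text \<open>
  The case \<open>A = B\<close> real of the Parseval identity above: the two factors are then
  conjugate to each other.
\<close>

lemma circle_mean_norm_powr:
  assumes w: "norm (w::complex) < 1"
  shows "(\<lambda>k. (pochhammer l k / fact k)\<^sup>2 * ((norm w)\<^sup>2) ^ k) sums
    (LINT \<eta>|haar_circle. norm (1 - w * cnj \<eta>) powr (- 2 * l))"
proof -
  have "(1 - w * cnj \<eta>) powr (- of_real l) * (1 - cnj w * \<eta>) powr (- of_real l)
      = of_real (norm (1 - w * cnj \<eta>) powr (- 2 * l))" if "norm \<eta> = 1" for \<eta>
  proof -
    have n: "norm (w * cnj \<eta>) < 1" using w that by (simp add: norm_mult)
    let ?x = "1 - w * cnj \<eta>"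
    have "(1 - cnj w * \<eta>) powr (- of_real l) = cnj (?x powr (- of_real l))"
      using one_minus_not_nonpos(3)[OF n] by (subst cnj_powr) auto
    then have "?x powr (- of_real l) * (1 - cnj w * \<eta>) powr (- of_real l)
       = of_real ((norm (?x powr (- of_real l)))\<^sup>2)"
      by (simp only: complex_norm_square)
    also have "norm (?x powr (- of_real l)) = norm ?x powr (- l)"
      by (subst norm_powr_real_powr') auto
    also have "(norm ?x powr (- l))\<^sup>2 = norm ?x powr (- 2 * l)"
      by (simp add: power2_eq_square flip: powr_add)
    finally show ?thesis .
  qed
  then have "(LINT \<eta>|haar_circle. (1 - w * cnj \<eta>) powr (- of_real l) * (1 - cnj w * \<eta>) powr (- of_real l))
    = (LINT \<eta>|haar_circle. complex_of_real (norm (1 - w * cnj \<eta>) powr (- 2 * l)))"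
    by (intro Bochner_Integration.integral_cong) auto
  with circle_mean_hypergeometric[OF w, of "of_real l" "of_real l"]
  have "(\<lambda>k. complex_of_real ((pochhammer l k / fact k)\<^sup>2 * ((norm w)\<^sup>2) ^ k)) sums
    complex_of_real (LINT \<eta>|haar_circle. norm (1 - w * cnj \<eta>) powr (- 2 * l))"
    by (simp add: pochhammer_of_real power2_eq_square)
  then show ?thesis by (simp only: sums_of_real_iff)
qed

lemma powr_binomial_series_real:
  assumes "\<bar>x::real\<bar> < 1"
  shows "(\<lambda>k. pochhammer a k / fact k * x ^ k) sums ((1 - x) powr (-a))"
  using gen_binomial_real[of "-x" "-a"] assms by (simp add: gbinomial_neg_pochhammer)

text \<open>
  The quotient increases in \<open>k\<close>, because its successive ratio is
  \<open>(l + k)\<^sup>2 / ((1 + k) * (2 * l - 1 + k))\<close> and numerator and denominator differ by the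
  square \<open>(l - 1)\<^sup>2\<close>. Hence it stays below its limit. This is where the sharp constant of
  the norm estimate comes from.
\<close>

lemma pochhammer_ratio_le:
  fixes l :: real
  assumes l: "l > 1 / 2"
  shows "(pochhammer l k)\<^sup>2 / (fact k * pochhammer (2 * l - 1) k) \<le> Gamma (2 * l - 1) / (Gamma l)\<^sup>2"
proof -
  let ?r = "\<lambda>k. (pochhammer l k)\<^sup>2 / (fact k * pochhammer (2 * l - 1) k)"
  have "incseq ?r"
  proof (rule incseq_SucI)
    fix k
    have pos: "pochhammer (2 * l - 1) k > 0" "2 * l - 1 + real k > 0" using l by (auto intro!: pochhammer_pos)
    have f: "(1 + real k) * (2 * l - 1 + real k) > 0" using pos(2) by (intro mult_pos_pos) auto
    \<comment> \<open>the successive ratio of the quotient is at least 1\<close>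
    have "(1 + real k) * (2 * l - 1 + real k) \<le> (1 + real k) * (2 * l - 1 + real k) + (l - 1)\<^sup>2"
      by simp
    also have "\<dots> = (l + real k)\<^sup>2"
      by (simp add: power2_eq_square algebra_simps)
    finally have "1 \<le> (l + real k)\<^sup>2 / ((1 + real k) * (2 * l - 1 + real k))"
      using f by (simp only: le_divide_eq_1_pos)
    then have "?r k * 1 \<le> ?r k * ((l + real k)\<^sup>2 / ((1 + real k) * (2 * l - 1 + real k)))"
      using pos by (intro mult_left_mono) (auto intro!: divide_nonneg_nonneg)
    also have "\<dots> = ?r (Suc k)"
      by (simp add: pochhammer_Suc power_mult_distrib mult_ac)
    finally show "?r k \<le> ?r (Suc k)" by simp
  qed
  moreover have "?r \<longlonglongrightarrow> Gamma (2 * l - 1) / (Gamma l)\<^sup>2"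
  proof -
    have "l + l - 1 \<notin> \<int>\<^sub>\<le>\<^sub>0" using nonpos_Ints_nonpos[of "l + l - 1"] l by linarith
    from pochhammer_ratio_tendsto[OF this] show ?thesis
      by (simp add: power2_eq_square rGamma_inverse_Gamma divide_inverse)
  qed
  ultimately show ?thesis by (rule incseq_le)
qed

lemma continuous_on_majorant_kernel:
  assumes "norm w < 1"
  shows "continuous_on (sphere 0 1) (majorant_kernel s w)"
proof -
  have "1 - w * cnj \<eta> \<noteq> 0" if "norm \<eta> = 1" for \<eta>
    using one_minus_not_nonpos(2)[of "w * cnj \<eta>"] assms that by (auto simp: norm_mult)
  then show ?thesis
    unfolding majorant_kernel_def by (intro continuous_intros) auto
qed

lemma majorant_kernel_nonneg: "0 \<le> majorant_kernel s w \<eta>"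
  by (simp add: majorant_kernel_def)

lemma integrable_majorant_kernel:
  "norm w < 1 \<Longrightarrow> integrable haar_circle (majorant_kernel s w)"
  by (intro continuous_on_integrable_circle continuous_on_majorant_kernel)

text \<open>
  Coefficientwise comparison: by the monotonicity above, the power series of the mean of
  \<open>|1 - w * cnj \<eta>| powr (- (s + 2))\<close> is dominated by \<open>majorant_mass s\<close> times the
  binomial series of \<open>(1 - |w|\<^sup>2) powr (- (s + 1))\<close>.
\<close>

lemma integral_majorant_kernel_le:
  assumes w: "norm w < 1" and s: "s > -1"
  shows "(LINT \<eta>|haar_circle. majorant_kernel s w \<eta>) \<le> majorant_mass s"
proof -
  define l where "l = s / 2 + 1"
  have l: "l > 1/2" "2 * l - 1 = s + 1" "- 2 * l = - (s + 2)" using s by (auto simp: l_def)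
  define x where "x = (norm w)\<^sup>2"
  have x: "0 \<le> x" "x < 1" using w by (auto simp: x_def power_less_one_iff)
  define L where "L = Gamma (2 * l - 1) / (Gamma l)\<^sup>2"
  let ?I = "LINT \<eta>|haar_circle. norm (1 - w * cnj \<eta>) powr (- (s + 2))"
  have S1: "(\<lambda>k. (pochhammer l k / fact k)\<^sup>2 * x ^ k) sums ?I"
    using circle_mean_norm_powr[OF w, of l] unfolding x_def[symmetric] l by simp
  have S2: "(\<lambda>k. L * (pochhammer (s + 1) k / fact k * x ^ k)) sums (L * (1 - x) powr (-(s + 1)))"
    using x by (intro sums_mult powr_binomial_series_real) auto
  have le: "(pochhammer l k / fact k)\<^sup>2 * x ^ k \<le> L * (pochhammer (s + 1) k / fact k * x ^ k)" for k
  proof -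
    have pos: "pochhammer (s + 1) k > 0" using s by (intro pochhammer_pos) auto
    have "(pochhammer l k)\<^sup>2 \<le> L * (fact k * pochhammer (s + 1) k)"
      using pochhammer_ratio_le[OF l(1), of k] pos by (simp add: L_def l(2) divide_le_eq mult_less_0_iff)
    then have "(pochhammer l k)\<^sup>2 / (fact k)\<^sup>2 \<le> L * (fact k * pochhammer (s + 1) k) / (fact k)\<^sup>2"
      by (rule divide_right_mono) simp
    also have "\<dots> = L * (pochhammer (s + 1) k / fact k)" by (simp add: power2_eq_square)
    finally have "(pochhammer l k / fact k)\<^sup>2 * x ^ k \<le> L * (pochhammer (s + 1) k / fact k) * x ^ k"
      using x by (intro mult_right_mono) (auto simp: power_divide)
    then show ?thesis by (simp only: mult.assoc)
  qed
  have I: "?I \<le> L * (1 - x) powr (-(s + 1))" by (rule sums_le[OF le S1 S2])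
  have "(LINT \<eta>|haar_circle. majorant_kernel s w \<eta>) = (1 - x) powr (s + 1) * ?I"
    by (simp only: majorant_kernel_def x_def divide_inverse powr_minus[symmetric] integral_mult_right_zero)
  also have "\<dots> \<le> (1 - x) powr (s + 1) * (L * (1 - x) powr (-(s + 1)))"
    by (intro mult_left_mono I) auto
  also have "\<dots> = L * ((1 - x) powr (s + 1) * (1 - x) powr (-(s + 1)))" by (simp only: mult_ac)
  also have "\<dots> = L" using x by (simp flip: powr_add)
  finally show ?thesis by (simp add: L_def majorant_mass_def l(2)) (simp add: l_def)
qed

text \<open>
  The majorant concentrates at \<open>\<zeta>\<close>. Points closer than \<open>\<delta>\<close> contribute at most
  \<open>\<delta>\<close> times the total mass. At the other points \<open>|1 - w * cnj \<eta>|\<close> is at least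
  \<open>\<delta> / 2\<close>, so that there the kernel is uniformly small as \<open>r\<close> tends to 1.
\<close>

lemma integral_majorant_kernel_dist_le:
  assumes \<zeta>: "norm \<zeta> = 1" and r: "0 \<le> r" "r < 1" and s: "s > -1" and \<delta>: "\<delta> > 0"
  shows "(LINT \<eta>|haar_circle. majorant_kernel s (of_real r * \<zeta>) \<eta> * norm (\<eta> - \<zeta>))
     \<le> \<delta> * majorant_mass s + 2 * (1 - r\<^sup>2) powr (s + 1) / (\<delta> / 2) powr (s + 2)"
proof -
  interpret prob_space haar_circle by (rule prob_space_haar_circle)
  define w where "w = of_real r * \<zeta>"
  have w: "norm w < 1" "(norm w)\<^sup>2 = r\<^sup>2" using \<zeta> r by (simp_all add: w_def norm_mult)
  let ?E = "2 * (1 - r\<^sup>2) powr (s + 1) / (\<delta> / 2) powr (s + 2)"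
  have "majorant_kernel s w \<eta> * norm (\<eta> - \<zeta>) \<le> \<delta> * majorant_kernel s w \<eta> + ?E" 
    if \<eta>: "norm \<eta> = 1" for \<eta>
  proof (cases "norm (\<eta> - \<zeta>) \<le> \<delta>")
    case True
    then have "majorant_kernel s w \<eta> * norm (\<eta> - \<zeta>) \<le> \<delta> * majorant_kernel s w \<eta>"
      by (subst mult.commute[of \<delta>], intro mult_left_mono majorant_kernel_nonneg)
    moreover have "?E \<ge> 0" by simp
    ultimately show ?thesis by linarith
  next
    case False
    have e1: "\<eta> * cnj \<eta> = 1" using \<eta> by (simp add: complex_norm_square[symmetric])
    \<comment> \<open>so \<open>|1 - w * cnj \<eta>|\<close> is the distance of \<open>w\<close> and \<open>\<eta>\<close>, which is at least half that of \<open>\<zeta>\<close> and \<open>\<eta>\<close>\<close>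
    have "1 - w * cnj \<eta> = (\<eta> - w) * cnj \<eta>" using e1 by (simp add: algebra_simps)
    then have nm: "norm (1 - w * cnj \<eta>) = norm (\<eta> - w)" using \<eta> by (simp add: norm_mult)
    have "w - \<zeta> = of_real (r - 1) * \<zeta>" by (simp add: w_def algebra_simps)
    then have "norm (w - \<zeta>) = 1 - r" using r \<zeta> by (simp add: norm_mult del: of_real_diff)
    moreover have "1 - r \<le> norm (\<eta> - w)"
      using norm_triangle_ineq2[of \<eta> w] \<eta> \<zeta> r by (simp add: w_def norm_mult)
    moreover have "norm (\<eta> - \<zeta>) \<le> norm (\<eta> - w) + norm (w - \<zeta>)"
      using norm_triangle_ineq[of "\<eta> - w" "w - \<zeta>"] by simp
    ultimately have "\<delta> / 2 \<le> norm (1 - w * cnj \<eta>)" using False nm by linarith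
    then have "(\<delta> / 2) powr (s + 2) \<le> norm (1 - w * cnj \<eta>) powr (s + 2)"
      using \<delta> s by (intro powr_mono2) auto
    then have "majorant_kernel s w \<eta> \<le> (1 - r\<^sup>2) powr (s + 1) / (\<delta> / 2) powr (s + 2)"
      unfolding majorant_kernel_def w(2) using \<delta> \<open>\<delta> / 2 \<le> norm (1 - w * cnj \<eta>)\<close>
      by (intro divide_left_mono mult_pos_pos) (auto simp: powr_gt_zero)
    moreover have "norm (\<eta> - \<zeta>) \<le> 2" using norm_triangle_ineq4[of \<eta> \<zeta>] \<eta> \<zeta> by simp
    ultimately have "majorant_kernel s w \<eta> * norm (\<eta> - \<zeta>) \<le> (1 - r\<^sup>2) powr (s + 1) / (\<delta> / 2) powr (s + 2) * 2"
      by (intro mult_mono) (auto simp: majorant_kernel_nonneg)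
    also have "\<dots> = ?E" by simp
    also have "?E \<le> \<delta> * majorant_kernel s w \<eta> + ?E"
      using \<delta> by (simp add: majorant_kernel_nonneg)
    finally show ?thesis .
  qed
  then have "(LINT \<eta>|haar_circle. majorant_kernel s w \<eta> * norm (\<eta> - \<zeta>))
     \<le> (LINT \<eta>|haar_circle. \<delta> * majorant_kernel s w \<eta> + ?E)"
    using w by (intro integral_mono continuous_on_integrable_circle continuous_intros continuous_on_majorant_kernel) auto
  also have "\<dots> = \<delta> * (LINT \<eta>|haar_circle. majorant_kernel s w \<eta>) + ?E"
    using w prob_space by (simp add: integrable_majorant_kernel)
  also have "\<dots> \<le> \<delta> * majorant_mass s + ?E"
    using integral_majorant_kernel_le[OF w(1) s] \<delta> by simp
  finally show ?thesis by (simp add: w_def)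
qed


section \<open>The mean of the kernel\<close>

text \<open>
  An Abelian theorem: \<open>pochhammer \<sigma> k / fact k * x ^ k * (1 - x) powr \<sigma>\<close> are weights with sum 1
  on the natural numbers, and for \<open>\<sigma> > 0\<close> the weight of any finite set vanishes as \<open>x\<close> tends
  to 1. So weighted means of a null sequence tend to 0.
\<close>

lemma Abel_mean_tendsto_0:
  fixes e :: "nat \<Rightarrow> real"
  assumes \<sigma>: "\<sigma> > 0" and e0: "\<And>k. 0 \<le> e k" and e: "e \<longlonglongrightarrow> 0"
  shows "((\<lambda>x. (1 - x) powr \<sigma> * (\<Sum>k. e k * (pochhammer \<sigma> k / fact k * x ^ k))) \<longlongrightarrow> 0) (at_left 1)"
    and "\<And>x. 0 \<le> x \<Longrightarrow> x < 1 \<Longrightarrow> summable (\<lambda>k. e k * (pochhammer \<sigma> k / fact k * x ^ k))"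
proof -
  define d where "d = (\<lambda>k. pochhammer \<sigma> k / fact k :: real)"
  have d0: "d k \<ge> 0" for k using \<sigma> by (auto simp: d_def intro!: pochhammer_nonneg divide_nonneg_pos)
  have sd: "(\<lambda>k. d k * x ^ k) sums (1 - x) powr (-\<sigma>)" if "0 \<le> x" "x < 1" for x
    using powr_binomial_series_real[of x \<sigma>] that by (simp add: d_def)
  obtain C where C: "\<And>k. norm (e k) \<le> C" 
    using convergent_imp_Bseq[of e] e by (auto simp: convergent_def Bseq_def)
  have sm: "summable (\<lambda>k. e k * (d k * x ^ k))" if "0 \<le> x" "x < 1" for x
  proof (rule summable_comparison_test[OF _ summable_mult[OF sums_summable[OF sd[OF that]], of C]], intro exI allI impI)
    fix k
    show "norm (e k * (d k * x ^ k)) \<le> C * (d k * x ^ k)"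
      using C[of k] d0[of k] that e0[of k] by (auto simp: intro!: mult_right_mono)
  qed
  then show "\<And>x. 0 \<le> x \<Longrightarrow> x < 1 \<Longrightarrow> summable (\<lambda>k. e k * (pochhammer \<sigma> k / fact k * x ^ k))"
    by (simp add: d_def)
  have ev: "eventually (\<lambda>x::real. 0 < x \<and> x < 1) (at_left 1)"
    by (auto simp: eventually_at_left[of 0] intro!: exI[of _ 0])
  have "((\<lambda>x. (1 - x) powr \<sigma> * (\<Sum>k. e k * (d k * x ^ k))) \<longlongrightarrow> 0) (at_left 1)"
  proof (rule tendstoI)
    fix \<epsilon> :: real assume \<epsilon>: "\<epsilon> > 0"
    then obtain N where N: "\<And>k. k \<ge> N \<Longrightarrow> e k < \<epsilon> / 2"
      using order_tendstoD(2)[OF e, of "\<epsilon> / 2"] by (auto simp: eventually_sequentially)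
    define E where "E = (\<Sum>k<N. e k * d k)"
    have "((\<lambda>x. (1 - x) powr \<sigma>) \<longlongrightarrow> (1 - 1) powr \<sigma>) (at_left (1::real))"
      using \<sigma> by (intro tendsto_powr2 tendsto_intros) (auto simp: eventually_at_filter)
    then have "((\<lambda>x. (1 - x) powr \<sigma> * E) \<longlongrightarrow> 0) (at_left (1::real))"
      by (auto intro: tendsto_mult_left_zero)
    then have "eventually (\<lambda>x. (1 - x) powr \<sigma> * E < \<epsilon> / 2) (at_left (1::real))"
      using \<epsilon> by (intro order_tendstoD(2)[where y=0]) auto
    with ev show "eventually (\<lambda>x. dist ((1 - x) powr \<sigma> * (\<Sum>k. e k * (d k * x ^ k))) 0 < \<epsilon>) (at_left (1::real))"
    proof eventually_elim
      case (elim x)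
      then have x: "0 \<le> x" "x < 1" by auto
      have "(\<Sum>k. e k * (d k * x ^ k)) \<le> (\<Sum>k. (if k < N then e k * d k else 0) + \<epsilon> / 2 * (d k * x ^ k))"
      proof (rule suminf_le)
        fix k
        have "e k * d k * x ^ k \<le> e k * d k * 1"
          using x e0 d0 by (intro mult_left_mono power_le_one) auto
        moreover have "k \<ge> N \<Longrightarrow> e k * (d k * x ^ k) \<le> \<epsilon> / 2 * (d k * x ^ k)"
          using N[of k] x d0 by (intro mult_right_mono) auto
        moreover have "0 \<le> \<epsilon> / 2 * (d k * x ^ k)" using x d0 \<epsilon> by auto
        ultimately show "e k * (d k * x ^ k) \<le> (if k < N then e k * d k else 0) + \<epsilon> / 2 * (d k * x ^ k)"
          by (cases "k < N") (simp_all only: mult.assoc if_True if_False, linarith+)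
      next
        show "summable (\<lambda>k. (if k < N then e k * d k else 0) + \<epsilon> / 2 * (d k * x ^ k))"
          by (intro summable_add summable_mult sums_summable[OF sd] x) (rule summable_finite[of "{..<N}"], auto)
      qed (rule sm[OF x])
      also have "\<dots> = E + \<epsilon> / 2 * (1 - x) powr (-\<sigma>)"
        using sums_add[OF sums_If_finite_set[of "{..<N}" "\<lambda>k. e k * d k"] sums_mult[OF sd[OF x], of "\<epsilon> / 2"]]
        by (simp add: sums_iff E_def)
      finally have "(1 - x) powr \<sigma> * (\<Sum>k. e k * (d k * x ^ k)) \<le> (1 - x) powr \<sigma> * (E + \<epsilon> / 2 * (1 - x) powr (-\<sigma>))"
        by (intro mult_left_mono) auto
      also have "\<dots> = (1 - x) powr \<sigma> * E + \<epsilon> / 2"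
        using x by (simp add: powr_minus field_simps)
      also have "\<dots> < \<epsilon>" using elim by simp
      finally have "(1 - x) powr \<sigma> * (\<Sum>k. e k * (d k * x ^ k)) < \<epsilon>" .
      moreover have "0 \<le> (1 - x) powr \<sigma> * (\<Sum>k. e k * (d k * x ^ k))"
        using x d0 e0 by (intro mult_nonneg_nonneg suminf_nonneg sm) auto
      ultimately show ?case by simp
    qed
  qed
  then show "((\<lambda>x. (1 - x) powr \<sigma> * (\<Sum>k. e k * (pochhammer \<sigma> k / fact k * x ^ k))) \<longlongrightarrow> 0) (at_left 1)"
    by (simp add: d_def)
qed

text \<open>
  Complex powers \<open>n powr z\<close> have modulus \<open>n powr Re z\<close>, so a complex Pochhammer symbol
  is comparable to the one of its real part; this makes the Abelian theorem for positive weights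
  applicable to complex exponents.
\<close>

lemma norm_pochhammer_ratio_tendsto:
  fixes z :: complex
  assumes z: "Re z > 0"
  shows "(\<lambda>k. norm (pochhammer z k) / pochhammer (Re z) k) \<longlonglongrightarrow> norm (rGamma z) / rGamma (Re z)"
proof -
  have r0: "rGamma (Re z) \<noteq> 0" using z by (auto simp: rGamma_eq_zero_iff elim!: nonpos_Ints_cases')
  have "(\<lambda>n. norm (rGamma_series z n) / rGamma_series (Re z) n) \<longlonglongrightarrow> norm (rGamma z) / rGamma (Re z)"
    by (intro tendsto_intros r0)
  moreover have "norm (rGamma_series z n) / rGamma_series (Re z) n = norm (pochhammer z (Suc n)) / pochhammer (Re z) (Suc n)" for n
    by (simp add: rGamma_series_def norm_divide norm_mult)
  ultimately show ?thesis
    by (subst filterlim_sequentially_Suc[symmetric]) simp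
qed

definition circle_kernel :: "complex \<Rightarrow> complex \<Rightarrow> complex \<Rightarrow> complex \<Rightarrow> complex" where
  "circle_kernel a b w \<eta> = c_const a b * (of_real (1 - (norm w)\<^sup>2) powr (a + b + 1)) /
     ((1 - w * cnj \<eta>) powr (a + 1) * (1 - cnj w * \<eta>) powr (b + 1))"

text \<open>
  The mean over the circle of the kernel at a point with \<open>|w|\<^sup>2 = x\<close>, as a power series.
\<close>

definition kernel_mean :: "complex \<Rightarrow> complex \<Rightarrow> real \<Rightarrow> complex" where
  "kernel_mean a b x = c_const a b * (of_real (1 - x) powr (a + b + 1)) *
     (\<Sum>k. (pochhammer (a + 1) k / fact k) * (pochhammer (b + 1) k / fact k) * of_real (x ^ k))"

lemma integral_circle_kernel:
  assumes w: "norm w < 1"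
  shows "(LINT \<eta>|haar_circle. circle_kernel a b w \<eta>) = kernel_mean a b ((norm w)\<^sup>2)"
proof -
  have "(LINT \<eta>|haar_circle. circle_kernel a b w \<eta>) = 
     (LINT \<eta>|haar_circle. c_const a b * (of_real (1 - (norm w)\<^sup>2) powr (a + b + 1)) * 
       ((1 - w * cnj \<eta>) powr (-(a + 1)) * (1 - cnj w * \<eta>) powr (-(b + 1))))"
    by (simp only: circle_kernel_def divide_inverse inverse_mult_distrib powr_minus)
  also have "\<dots> = c_const a b * (of_real (1 - (norm w)\<^sup>2) powr (a + b + 1)) * 
       (LINT \<eta>|haar_circle. (1 - w * cnj \<eta>) powr (-(a + 1)) * (1 - cnj w * \<eta>) powr (-(b + 1)))"
    by (rule integral_mult_right_zero)
  also have "(LINT \<eta>|haar_circle. (1 - w * cnj \<eta>) powr (-(a + 1)) * (1 - cnj w * \<eta>) powr (-(b + 1)))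
     = (\<Sum>k. (pochhammer (a + 1) k / fact k) * (pochhammer (b + 1) k / fact k) * of_real (((norm w)\<^sup>2) ^ k))"
    by (rule sums_unique[OF circle_mean_hypergeometric[OF w]])
  finally show ?thesis by (simp only: kernel_mean_def)
qed

text \<open>
  Expand \<open>1 = (1 - x) powr S * (1 - x) powr (- S)\<close> with \<open>S = a + b + 1\<close> by the binomial
  series. The difference to \<open>kernel_mean a b x\<close> is an Abel mean of the numbers
  \<open>c_const a b * \<rho> k - 1\<close>, where \<open>\<rho> k\<close> is the quotient of coefficients. Its limit is
  \<open>1 / c_const a b\<close>: this is what the normalisation of the kernel is made for.
\<close>

lemma kernel_mean_tendsto_1:
  assumes ab: "Re a + Re b > -1" and a: "a + 1 \<notin> \<int>\<^sub>\<le>\<^sub>0" and b: "b + 1 \<notin> \<int>\<^sub>\<le>\<^sub>0"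
  shows "(kernel_mean a b \<longlongrightarrow> 1) (at_left 1)"
proof -
  define S where "S = a + b + 1"
  define \<sigma> where "\<sigma> = Re S"
  have \<sigma>: "\<sigma> > 0" using ab by (simp add: \<sigma>_def S_def)
  have S: "S \<notin> \<int>\<^sub>\<le>\<^sub>0" using \<sigma> by (auto simp: \<sigma>_def elim!: nonpos_Ints_cases')
  have S0: "pochhammer S k \<noteq> 0" for k
    using S by (auto simp: pochhammer_eq_0_iff)
  define \<rho> where "\<rho> = (\<lambda>k. pochhammer (a+1) k * pochhammer (b+1) k / (fact k * pochhammer S k))"
  define e where "e = (\<lambda>k. norm (c_const a b * \<rho> k - 1) * (norm (pochhammer S k) / pochhammer \<sigma> k))"
  have "\<rho> \<longlonglongrightarrow> Gamma S * (rGamma (a+1) * rGamma (b+1))"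
    using pochhammer_ratio_tendsto[of "a+1" "b+1"] S unfolding \<rho>_def S_def by (simp add: add_ac)
  then have "(\<lambda>k. c_const a b * \<rho> k - 1) \<longlonglongrightarrow> c_const a b * (Gamma S * (rGamma (a+1) * rGamma (b+1))) - 1"
    by (intro tendsto_intros)
  also have "c_const a b * (Gamma S * (rGamma (a+1) * rGamma (b+1))) = 1"
  proof -
    have "Gamma S \<noteq> 0" "Gamma (a + 1) \<noteq> 0" "Gamma (b + 1) \<noteq> 0" using S a b by (simp_all add: Gamma_eq_zero_iff)
    then show ?thesis
      unfolding c_const_def S_def[symmetric] rGamma_inverse_Gamma by (simp add: divide_simps)
  qed
  finally have "(\<lambda>k. norm (c_const a b * \<rho> k - 1)) \<longlonglongrightarrow> 0" by (simp add: tendsto_norm_zero)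
  then have "e \<longlonglongrightarrow> 0 * (norm (rGamma S) / rGamma \<sigma>)"
    using \<sigma> unfolding e_def \<sigma>_def by (intro tendsto_mult norm_pochhammer_ratio_tendsto)
  then have e: "e \<longlonglongrightarrow> 0" by simp
  have e0: "0 \<le> e k" for k using \<sigma> by (auto simp: e_def intro!: mult_nonneg_nonneg divide_nonneg_nonneg pochhammer_nonneg)
  note Abel = Abel_mean_tendsto_0[OF \<sigma> e0 e]
  have "((\<lambda>x. kernel_mean a b x - 1) \<longlongrightarrow> 0) (at_left 1)"
  proof (rule Lim_null_comparison[OF _ Abel(1)])
    have ev: "eventually (\<lambda>x::real. 0 < x \<and> x < 1) (at_left 1)"
      by (auto simp: eventually_at_left[of 0] intro!: exI[of _ 0])
    then show "eventually (\<lambda>x. norm (kernel_mean a b x - 1) \<le> (1 - x) powr \<sigma> * (\<Sum>k. e k * (pochhammer \<sigma> k / fact k * x ^ k))) (at_left 1)"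
    proof eventually_elim
      case (elim x)
      then have x: "0 \<le> x" "x < 1" by auto
      let ?t = "\<lambda>k. (c_const a b * \<rho> k - 1) * (pochhammer S k / fact k * of_real x ^ k)"
      let ?h = "\<lambda>k. (pochhammer (a + 1) k / fact k) * (pochhammer (b + 1) k / fact k) * of_real (x ^ k) :: complex"
      define P where "P = complex_of_real (1 - x) powr S"
      have h: "?h k = \<rho> k * (pochhammer S k / fact k * of_real x ^ k)" for k
        using S0[of k] by (simp add: \<rho>_def)
      have nt: "norm (?t k) = e k * (pochhammer \<sigma> k / fact k * x ^ k)" for k
        using x pochhammer_pos[OF \<sigma>, of k] by (simp add: e_def norm_mult norm_divide norm_power)
      have st: "summable (\<lambda>k. norm (?t k))" unfolding nt by (rule Abel(2)[OF x])
      have sS: "(\<lambda>k. pochhammer S k / fact k * of_real x ^ k) sums ((1 - of_real x) powr (-S))"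
        using x by (intro powr_binomial_series) simp
      have sh: "summable ?h"
      proof -
        have "summable (\<lambda>k. inverse (c_const a b) * (?t k + pochhammer S k / fact k * of_real x ^ k))"
          by (intro summable_mult summable_add summable_norm_cancel[OF st] sums_summable[OF sS])
        moreover have "c_const a b \<noteq> 0" using S a b by (simp add: c_const_def Gamma_eq_zero_iff S_def)
        moreover have "inverse C * ((C * r - 1) * D + D) = r * D" if "C \<noteq> 0" for C r D :: complex
          using that by (simp add: field_simps)
        ultimately show ?thesis unfolding h by (simp only: not_False_eq_True)
      qed
      have "?t k = c_const a b * ?h k - pochhammer S k / fact k * of_real x ^ k" for k
        unfolding h by (simp only: left_diff_distrib mult_1_left mult.assoc)
      then have "(\<Sum>k. ?t k) = c_const a b * (\<Sum>k. ?h k) - (1 - of_real x) powr (-S)"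
        using sums_diff[OF sums_mult[OF summable_sums[OF sh], of "c_const a b"] sS] by (simp only: sums_iff)
      moreover have "P * (1 - of_real x) powr (-S) = 1" using x by (simp add: P_def powr_minus)
      ultimately have "kernel_mean a b x - 1 = P * (\<Sum>k. ?t k)"
        by (simp only: kernel_mean_def S_def[symmetric] P_def[symmetric] right_diff_distrib mult_ac)
      also have "norm \<dots> = (1 - x) powr \<sigma> * norm (\<Sum>k. ?t k)"
        using x by (simp only: norm_mult P_def \<sigma>_def) (subst norm_powr_real_powr, auto)
      also have "\<dots> \<le> (1 - x) powr \<sigma> * (\<Sum>k. norm (?t k))"
        by (intro mult_left_mono summable_norm st) auto
      finally show ?case by (simp only: nt)
    qed
  qed
  then show ?thesis by (simp only: LIM_zero_iff)
qed

definition kernel_const :: "complex \<Rightarrow> complex \<Rightarrow> real" where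
  "kernel_const a b = norm (c_const a b) * exp (pi / 2 * \<bar>Im a - Im b\<bar>)"

text \<open>
  With \<open>x = 1 - w * cnj \<eta>\<close> the denominator is \<open>x powr (a + 1) * cnj x powr (b + 1)\<close>.
  The imaginary parts of the exponents contribute the factor \<open>exp ((Im a - Im b) * Arg x)\<close> to the
  modulus of the kernel, and \<open>|Arg x| < pi / 2\<close> because \<open>x\<close> lies in the right half-plane.
\<close>

lemma norm_circle_kernel_le:
  assumes w: "norm w < 1" and \<eta>: "norm \<eta> = 1"
  shows "norm (circle_kernel a b w \<eta>) \<le> kernel_const a b * majorant_kernel (Re a + Re b) w \<eta>"
proof -
  define x where "x = 1 - w * cnj \<eta>"
  have x: "Re x > 0" "x \<noteq> 0" using one_minus_not_nonpos(2,3)[of "w * cnj \<eta>"] w \<eta> by (simp_all add: x_def norm_mult)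
  have "norm ((1 - cnj w * \<eta>) powr (b + 1)) = norm (cnj (x powr cnj (b + 1)))"
    using x by (subst cnj_powr) (auto simp: x_def)
  also have "\<dots> = norm x powr (Re b + 1) * exp (Im b * Arg x)" by (simp add: norm_powr_complex)
  finally have "norm (x powr (a + 1)) * norm ((1 - cnj w * \<eta>) powr (b + 1))
     = norm x powr (Re a + 1) * norm x powr (Re b + 1) * (exp (- (Im a * Arg x)) * exp (Im b * Arg x))"
    by (simp add: norm_powr_complex)
  also have "norm x powr (Re a + 1) * norm x powr (Re b + 1) = norm x powr (Re a + Re b + 2)"
    by (simp flip: powr_add add: add_ac)
  also have "exp (- (Im a * Arg x)) * exp (Im b * Arg x) = exp (- ((Im a - Im b) * Arg x))"
    by (simp flip: exp_add add: algebra_simps)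
  finally have den: "norm (x powr (a + 1)) * norm ((1 - cnj w * \<eta>) powr (b + 1))
     = norm x powr (Re a + Re b + 2) * exp (- ((Im a - Im b) * Arg x))" .
  have "\<bar>Arg x\<bar> \<le> pi / 2" using Re_Ln_pos_lt[OF x(2)] x by (simp add: Arg_eq_Im_Ln)
  then have "\<bar>Im a - Im b\<bar> * \<bar>Arg x\<bar> \<le> \<bar>Im a - Im b\<bar> * (pi / 2)" by (intro mult_left_mono) auto
  then have "(Im a - Im b) * Arg x \<le> pi / 2 * \<bar>Im a - Im b\<bar>"
    using abs_ge_self[of "(Im a - Im b) * Arg x"] by (simp add: abs_mult mult.commute)
  then have ex: "exp ((Im a - Im b) * Arg x) \<le> exp (pi / 2 * \<bar>Im a - Im b\<bar>)" by simp
  have q: "1 - (norm w)\<^sup>2 > 0" using w by (simp add: power_less_one_iff)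
  have num: "norm (complex_of_real (1 - (norm w)\<^sup>2) powr (a + b + 1)) = (1 - (norm w)\<^sup>2) powr (Re a + Re b + 1)"
    using q by (subst norm_powr_real_powr) auto
  have "norm (circle_kernel a b w \<eta>) = norm (c_const a b) * (1 - (norm w)\<^sup>2) powr (Re a + Re b + 1)
      / (norm x powr (Re a + Re b + 2) * exp (- ((Im a - Im b) * Arg x)))"
    unfolding circle_kernel_def norm_divide norm_mult num den[unfolded x_def] x_def ..
  also have "\<dots> = norm (c_const a b) * majorant_kernel (Re a + Re b) w \<eta> * exp ((Im a - Im b) * Arg x)"
    by (simp add: majorant_kernel_def x_def exp_minus divide_inverse)
  also have "\<dots> \<le> norm (c_const a b) * majorant_kernel (Re a + Re b) w \<eta> * exp (pi / 2 * \<bar>Im a - Im b\<bar>)"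
    by (intro mult_left_mono ex mult_nonneg_nonneg majorant_kernel_nonneg norm_ge_zero)
  finally show ?thesis by (simp add: kernel_const_def mult_ac)
qed


section \<open>Integration over the torus\<close>

lemma compact_torus: "compact (torus :: (complex ^ 'n::finite) set)"
proof -
  have "torus = (\<Inter>j. {\<zeta> :: complex ^ 'n. norm (\<zeta> $ j) = 1})" by (auto simp: torus_def)
  moreover have "closed (\<Inter>j. {\<zeta> :: complex ^ 'n. norm (\<zeta> $ j) = 1})"
    by (intro closed_INT ballI closed_Collect_eq continuous_intros)
  ultimately have "closed (torus :: (complex ^ 'n) set)" by simp
  moreover have "bounded (torus :: (complex ^ 'n) set)"
  proof (rule boundedI)
    fix \<zeta> :: "complex ^ 'n" assume "\<zeta> \<in> torus"
    then have "(\<Sum>j\<in>UNIV. norm (\<zeta> $ j)) = real CARD('n)" by (simp add: torus_def)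
    then show "norm \<zeta> \<le> real CARD('n)"
      unfolding norm_vec_def using L2_set_le_sum[of UNIV "\<lambda>j. norm (\<zeta> $ j)"] by simp
  qed
  ultimately show ?thesis by (simp add: compact_eq_bounded_closed)
qed

lemma open_polydisc: "open (polydisc :: (complex ^ 'n::finite) set)"
proof -
  have "polydisc = (\<Inter>j. {\<zeta> :: complex ^ 'n. norm (\<zeta> $ j) < 1})" by (auto simp: polydisc_def)
  moreover have "open (\<Inter>j. {\<zeta> :: complex ^ 'n. norm (\<zeta> $ j) < 1})"
    by (intro open_INT ballI open_Collect_less continuous_intros) auto
  ultimately show ?thesis by simp
qed

lemma measurable_haar_torus_eq: "haar_torus \<rightarrow>\<^sub>M N = restrict_space borel torus \<rightarrow>\<^sub>M N"
  by (rule measurable_cong_sets) simp_all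

lemma borel_measurable_torus:
  "f \<in> borel_measurable borel \<Longrightarrow> f \<in> borel_measurable haar_torus"
  unfolding measurable_haar_torus_eq by (rule measurable_restrict_space1)

lemma continuous_on_measurable_torus:
  fixes f :: "complex ^ 'n::finite \<Rightarrow> 'a::topological_space"
  assumes "continuous_on torus f"
  shows "f \<in> borel_measurable haar_torus"
  unfolding measurable_haar_torus_eq
  using assms by (rule borel_measurable_continuous_on_restrict)

lemma continuous_on_torus_bounded:
  fixes f :: "complex ^ 'n::finite \<Rightarrow> 'a::real_normed_vector"
  assumes "continuous_on torus f"
  obtains B where "B \<ge> 0" "\<And>\<zeta>. \<zeta> \<in> torus \<Longrightarrow> norm (f \<zeta>) \<le> B"
proof -
  have "bounded (f ` torus)"
    using assms by (intro compact_imp_bounded compact_continuous_image compact_torus)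
  then obtain B where "\<forall>x\<in>f ` torus. norm x \<le> B" unfolding bounded_iff by blast
  then show ?thesis by (intro that[of "max B 0"]) (auto intro: order_trans[OF _ max.cobounded1])
qed

lemma integrable_continuous_mult_torus:
  fixes k f :: "complex ^ 'n::finite \<Rightarrow> complex"
  assumes k: "continuous_on torus k" and f: "integrable haar_torus f"
  shows "integrable haar_torus (\<lambda>\<zeta>. k \<zeta> * f \<zeta>)"
proof -
  obtain B where B: "B \<ge> 0" "\<And>\<zeta>. \<zeta> \<in> torus \<Longrightarrow> norm (k \<zeta>) \<le> B"
    using continuous_on_torus_bounded[OF k] by blast
  show ?thesis
  proof (rule Bochner_Integration.integrable_bound)
    show "integrable haar_torus (\<lambda>\<zeta>. B * norm (f \<zeta>))" using f by auto
    show "(\<lambda>\<zeta>. k \<zeta> * f \<zeta>) \<in> borel_measurable haar_torus"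
      using continuous_on_measurable_torus[OF k] f by measurable
    show "AE \<zeta> in haar_torus. norm (k \<zeta> * f \<zeta>) \<le> norm (B * norm (f \<zeta>))"
      using B by (intro AE_I2) (auto simp: norm_mult intro!: mult_right_mono)
  qed
qed

lemma integrable_continuous_torus:
  fixes k :: "complex ^ 'n::finite \<Rightarrow> 'a::{banach,second_countable_topology}"
  assumes k: "continuous_on torus k"
  shows "integrable haar_torus k"
proof -
  interpret prob_space "haar_torus :: (complex ^ 'n) measure" by (rule prob_space_haar_torus)
  obtain B where B: "B \<ge> 0" "\<And>\<zeta>. \<zeta> \<in> torus \<Longrightarrow> norm (k \<zeta>) \<le> B"
    using continuous_on_torus_bounded[OF k] by blast
  then show ?thesis
    using k by (intro integrable_const_bound[of _ B] AE_I2 continuous_on_measurable_torus) auto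
qed

lemma haar_torus_prod:
  fixes f :: "'n::finite \<Rightarrow> complex \<Rightarrow> 'b::{real_normed_field,banach,second_countable_topology}"
  assumes f: "\<And>j. integrable haar_circle (f j)"
  shows "integrable haar_torus (\<lambda>\<zeta>. \<Prod>j\<in>UNIV. f j (\<zeta> $ j))"
    and "(LINT \<zeta>|haar_torus. (\<Prod>j\<in>UNIV. f j (\<zeta> $ j))) = (\<Prod>j\<in>UNIV. (LINT \<eta>|haar_circle. f j \<eta>))"
proof -
  interpret product_sigma_finite "\<lambda>_::'n. haar_circle"
    using prob_space_haar_circle by (simp add: product_sigma_finite_def prob_space_imp_sigma_finite)
  have nth: "(\<lambda>\<zeta> :: complex ^ 'n. \<zeta> $ j) \<in> restrict_space borel torus \<rightarrow>\<^sub>M haar_circle" for j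
    unfolding haar_circle_def measurable_distr_eq2
    by (intro measurable_restrict_space3) (auto simp: torus_def intro!: borel_measurable_continuous_onI continuous_intros)
  have m: "(\<lambda>\<zeta>. \<Prod>j\<in>UNIV. f j (\<zeta> $ j)) \<in> borel_measurable (restrict_space borel torus)"
    using f by (intro borel_measurable_prod measurable_compose[OF nth] borel_measurable_integrable)
  show "integrable haar_torus (\<lambda>\<zeta>. \<Prod>j\<in>UNIV. f j (\<zeta> $ j))"
    unfolding haar_torus_def using f
    by (subst integrable_distr_eq[OF measurable_vec_lambda_torus m]) (auto intro!: product_integrable_prod)
  show "(LINT \<zeta>|haar_torus. (\<Prod>j\<in>UNIV. f j (\<zeta> $ j))) = (\<Prod>j\<in>UNIV. (LINT \<eta>|haar_circle. f j \<eta>))"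
    unfolding haar_torus_def using f
    by (subst integral_distr[OF measurable_vec_lambda_torus m]) (auto intro!: product_integral_prod)
qed

section \<open>Differentiation under the integral sign\<close>

definition kernel_op :: "('a \<Rightarrow> complex ^ 'n \<Rightarrow> complex) \<Rightarrow> (complex ^ 'n \<Rightarrow> complex) \<Rightarrow> 'a \<Rightarrow> complex" where
  "kernel_op k f z = (LINT \<zeta>|haar_torus. k z \<zeta> * f \<zeta>)"

text \<open>
  Kernels that are \<open>C\<^sup>1\<close> in the first variable, with \<open>k' v\<close> the derivative in
  direction \<open>v\<close>, jointly continuous in both variables. The compactness of the torus then
  gives all the uniformity that differentiation under the integral needs.
\<close>

definition C1_kernel_on :: "'a::real_normed_vector set \<Rightarrow> ('a \<Rightarrow> complex ^ 'n \<Rightarrow> complex)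
    \<Rightarrow> ('a \<Rightarrow> 'a \<Rightarrow> complex ^ 'n \<Rightarrow> complex) \<Rightarrow> bool" where
  "C1_kernel_on S k k' \<longleftrightarrow>
     (\<forall>z\<in>S. \<forall>\<zeta>\<in>torus. ((\<lambda>z. k z \<zeta>) has_derivative (\<lambda>v. k' v z \<zeta>)) (at z)) \<and>
     continuous_on (S \<times> torus) (\<lambda>x. k (fst x) (snd x)) \<and>
     (\<forall>v. continuous_on (S \<times> torus) (\<lambda>x. k' v (fst x) (snd x)))"

lemma continuous_on_section:
  assumes "continuous_on (S \<times> T) (\<lambda>x. k (fst x) (snd x))" "z \<in> S"
  shows "continuous_on T (k z)"
proof -
  have "continuous_on T (Pair z)" "Pair z ` T \<subseteq> S \<times> T"
    using assms(2) by (auto intro!: continuous_intros)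
  from continuous_on_compose2[OF assms(1) this] show ?thesis by simp
qed

text \<open>
  By the compactness of the torus, \<open>k y \<zeta>\<close> tends to \<open>k z \<zeta>\<close> uniformly in
  \<open>\<zeta>\<close> as \<open>y\<close> tends to \<open>z\<close>; the integrable function \<open>f\<close> only enters through
  its \<open>L\<^sup>1\<close> norm.
\<close>

lemma continuous_on_kernel_op:
  fixes k :: "'a::real_normed_vector \<Rightarrow> complex ^ 'n::finite \<Rightarrow> complex"
  assumes k: "continuous_on (S \<times> torus) (\<lambda>x. k (fst x) (snd x))" and f: "integrable haar_torus f"
  shows "continuous_on S (kernel_op k f)"
  unfolding continuous_on_iff
proof (intro ballI allI impI)
  fix z and e :: real assume z: "z \<in> S" and e: "e > 0"
  define N where "N = (LINT \<zeta>|haar_torus. norm (f \<zeta>))"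
  have N: "N \<ge> 0" by (simp add: N_def)
  have "e / (N + 1) > 0" using N e by simp
  from continuous_on_prod_compactE[OF k compact_torus z this]
  obtain X where X: "z \<in> X" "open X" "\<And>y \<zeta>. y \<in> X \<inter> S \<Longrightarrow> \<zeta> \<in> torus \<Longrightarrow> dist (k y \<zeta>) (k z \<zeta>) \<le> e / (N + 1)"
    by (metis fst_conv snd_conv)
  obtain d where d: "d > 0" "ball z d \<subseteq> X" using X(1,2) open_contains_ball by blast
  have i: "integrable haar_torus (\<lambda>\<zeta>. k y \<zeta> * f \<zeta>)" if "y \<in> S" for y
    by (intro integrable_continuous_mult_torus f continuous_on_section[OF k that])
  have "dist (kernel_op k f y) (kernel_op k f z) < e" if y: "y \<in> S" "dist y z < d" for y
  proof -
    have yX: "y \<in> X \<inter> S" using d y by (auto simp: dist_commute)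
    have "norm (kernel_op k f y - kernel_op k f z) = norm (LINT \<zeta>|haar_torus. k y \<zeta> * f \<zeta> - k z \<zeta> * f \<zeta>)"
      using i y z by (simp add: kernel_op_def)
    also have "\<dots> \<le> (LINT \<zeta>|haar_torus. norm (k y \<zeta> * f \<zeta> - k z \<zeta> * f \<zeta>))"
      by (rule integral_norm_bound)
    also have "\<dots> \<le> (LINT \<zeta>|haar_torus. e / (N + 1) * norm (f \<zeta>))"
    proof (intro integral_mono integrable_norm Bochner_Integration.integrable_diff i y z)
      fix \<zeta> :: "complex ^ 'n" assume "\<zeta> \<in> space haar_torus"
      then show "norm (k y \<zeta> * f \<zeta> - k z \<zeta> * f \<zeta>) \<le> e / (N + 1) * norm (f \<zeta>)"
        using X(3)[OF yX, of \<zeta>] unfolding left_diff_distrib[symmetric] norm_mult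
        by (intro mult_right_mono) (auto simp: dist_norm)
    qed (use f in auto)
    also have "\<dots> = e * (N / (N + 1))" by (simp add: N_def)
    also have "\<dots> < e * 1" using e N by (intro mult_strict_left_mono) auto
    finally show ?thesis by (simp add: dist_norm)
  qed
  then show "\<exists>d>0. \<forall>x'\<in>S. dist x' z < d \<longrightarrow> dist (kernel_op k f x') (kernel_op k f z) < e"
    using d(1) by blast
qed

text \<open>
  The remainder of the first-order expansion of \<open>k\<close> at \<open>z\<close> is controlled by the mean value
  inequality: near \<open>z\<close> the derivatives at \<open>y\<close> and at \<open>z\<close> differ by little, uniformly over the
  torus. It suffices to arrange this for the finitely many basis directions.
\<close>

lemma has_derivative_kernel_op:
  fixes k :: "'a::euclidean_space \<Rightarrow> complex ^ 'n::finite \<Rightarrow> complex"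
  assumes S: "open S" and k: "C1_kernel_on S k k'" and f: "integrable haar_torus f" and z: "z \<in> S"
  shows "(kernel_op k f has_derivative (\<lambda>v. kernel_op (k' v) f z)) (at z)"
proof -
  have der: "\<And>z \<zeta>. z \<in> S \<Longrightarrow> \<zeta> \<in> torus \<Longrightarrow> ((\<lambda>z. k z \<zeta>) has_derivative (\<lambda>v. k' v z \<zeta>)) (at z)"
    and kc: "continuous_on (S \<times> torus) (\<lambda>x. k (fst x) (snd x))"
    and k'c: "\<And>v. continuous_on (S \<times> torus) (\<lambda>x. k' v (fst x) (snd x))"
    using k by (auto simp: C1_kernel_on_def)
  have lin: "linear (\<lambda>v. k' v y \<zeta>)" if "y \<in> S" "\<zeta> \<in> torus" for y \<zeta>
    using der[OF that] has_derivative_linear by blast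
  have i: "integrable haar_torus (\<lambda>\<zeta>. k y \<zeta> * f \<zeta>)" "integrable haar_torus (\<lambda>\<zeta>. k' v y \<zeta> * f \<zeta>)" if "y \<in> S" for y v
    by (intro integrable_continuous_mult_torus f continuous_on_section[OF kc that] continuous_on_section[OF k'c that])+
  have "linear (\<lambda>v. kernel_op (k' v) f z)"
  proof (rule linearI)
    fix v w
    have "kernel_op (k' (v + w)) f z = (LINT \<zeta>|haar_torus. k' v z \<zeta> * f \<zeta> + k' w z \<zeta> * f \<zeta>)"
      unfolding kernel_op_def using linear_add[OF lin[OF z]]
      by (intro Bochner_Integration.integral_cong) (auto simp: distrib_right)
    then show "kernel_op (k' (v + w)) f z = kernel_op (k' v) f z + kernel_op (k' w) f z"
      using i(2)[OF z] by (simp add: kernel_op_def)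
  next
    fix c v
    have "kernel_op (k' (c *\<^sub>R v)) f z = (LINT \<zeta>|haar_torus. c *\<^sub>R (k' v z \<zeta> * f \<zeta>))"
      unfolding kernel_op_def using linear_scale[OF lin[OF z]]
      by (intro Bochner_Integration.integral_cong) auto
    then show "kernel_op (k' (c *\<^sub>R v)) f z = c *\<^sub>R kernel_op (k' v) f z"
      by (simp add: kernel_op_def)
  qed
  then have bl: "bounded_linear (\<lambda>v. kernel_op (k' v) f z)" by (simp add: linear_conv_bounded_linear)
  define N where "N = (LINT \<zeta>|haar_torus. norm (f \<zeta>))"
  have N: "N \<ge> 0" by (simp add: N_def)
  show ?thesis
    unfolding has_derivative_at_alt
  proof (intro conjI bl allI impI)
    fix e :: real assume e: "e > 0"
    \<comment> \<open>adding 1 to the \<open>L\<^sup>1\<close> norm of \<open>f\<close> avoids a division by zero\<close>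
    define e' where "e' = e / (real DIM('a) * (N + 1))"
    have e': "e' > 0" "real DIM('a) * e' * N \<le> e"
    proof -
      show "e' > 0" using e N by (auto simp: e'_def intro!: divide_pos_pos mult_pos_pos)
      have "real DIM('a) * e' * N = e * (N / (N + 1))" by (simp add: e'_def)
      also have "\<dots> \<le> e * 1" using e N by (intro mult_left_mono) auto
      finally show "real DIM('a) * e' * N \<le> e" by simp
    qed
    have "\<exists>X. open X \<and> z \<in> X \<and> (\<forall>y\<in>X \<inter> S. \<forall>\<zeta>\<in>torus. dist (k' b y \<zeta>) (k' b z \<zeta>) \<le> e')" for b
      using continuous_on_prod_compactE[OF k'c[of b] compact_torus z e'(1)] by (metis fst_conv snd_conv)
    then obtain X where X: "\<And>b. open (X b)" "\<And>b. z \<in> X b"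
        "\<And>b y \<zeta>. y \<in> X b \<inter> S \<Longrightarrow> \<zeta> \<in> torus \<Longrightarrow> dist (k' b y \<zeta>) (k' b z \<zeta>) \<le> e'"
      by metis
    have "open ((\<Inter>b\<in>Basis. X b) \<inter> S)" "z \<in> (\<Inter>b\<in>Basis. X b) \<inter> S"
      using X S z by (auto intro!: open_Int open_INT)
    then obtain d where d: "d > 0" "ball z d \<subseteq> (\<Inter>b\<in>Basis. X b) \<inter> S" by (rule openE)
    have on: "onorm (\<lambda>v. k' v y \<zeta> - k' v z \<zeta>) \<le> real DIM('a) * e'" if y: "y \<in> ball z d" and \<zeta>: "\<zeta> \<in> torus" for y \<zeta>
    proof (rule onorm_le)
      fix v
      have yS: "y \<in> S" using y d by auto
      let ?D = "\<lambda>v. k' v y \<zeta> - k' v z \<zeta>"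
      have l: "linear ?D" by (intro linear_compose_sub lin yS z \<zeta>)
      have "norm (?D v) = norm (\<Sum>b\<in>Basis. (v \<bullet> b) *\<^sub>R ?D b)"
      proof -
        have "?D v = ?D (\<Sum>b\<in>Basis. (v \<bullet> b) *\<^sub>R b)" by (simp add: euclidean_representation)
        also have "\<dots> = (\<Sum>b\<in>Basis. ?D ((v \<bullet> b) *\<^sub>R b))" by (rule linear_sum[OF l])
        also have "\<dots> = (\<Sum>b\<in>Basis. (v \<bullet> b) *\<^sub>R ?D b)" using linear_scale[OF l] by (intro sum.cong) auto
        finally show ?thesis by simp
      qed
      also have "\<dots> \<le> (\<Sum>b\<in>(Basis :: 'a set). norm v * e')"
      proof (rule sum_norm_le)
        fix b :: 'a assume b: "b \<in> Basis"
        then have "y \<in> X b \<inter> S" using y d by auto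
        from X(3)[OF this \<zeta>] Basis_le_norm[OF b, of v]
        show "norm ((v \<bullet> b) *\<^sub>R ?D b) \<le> norm v * e'" by (auto simp: dist_norm intro!: mult_mono)
      qed
      also have "\<dots> = real DIM('a) * e' * norm v" by simp
      finally show "norm (?D v) \<le> real DIM('a) * e' * norm v" .
    qed
    show "\<exists>d>0. \<forall>y. norm (y - z) < d \<longrightarrow>
        norm (kernel_op k f y - kernel_op k f z - kernel_op (k' (y - z)) f z) \<le> e * norm (y - z)"
    proof (intro exI[of _ d] conjI d(1) allI impI)
      fix y assume "norm (y - z) < d"
      then have y: "y \<in> ball z d" by (simp add: dist_norm norm_minus_commute)
      have yS: "y \<in> S" using y d by auto
      let ?R = "\<lambda>\<zeta>. k y \<zeta> - k z \<zeta> - k' (y - z) z \<zeta>"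
      have R: "norm (?R \<zeta>) \<le> norm (y - z) * (real DIM('a) * e')" if \<zeta>: "\<zeta> \<in> torus" for \<zeta>
      proof (rule differentiable_bound_linearization[where S="ball z d" and f'="\<lambda>y v. k' v y \<zeta>"])
        fix t :: real assume "t \<in> {0..1}"
        then show "z + t *\<^sub>R (y - z) \<in> ball z d"
          using \<open>norm (y - z) < d\<close> mult_left_le_one_le[of "norm (y - z)" t] by (auto simp: dist_norm)
      next
        fix x assume x: "x \<in> ball z d"
        then have xS: "x \<in> S" using d by auto
        show "((\<lambda>z. k z \<zeta>) has_derivative (\<lambda>v. k' v x \<zeta>)) (at x within ball z d)"
          by (rule has_derivative_at_withinI[OF der[OF xS \<zeta>]])
        show "onorm ((\<lambda>v. k' v x \<zeta>) - (\<lambda>v. k' v z \<zeta>)) \<le> real DIM('a) * e'"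
          using on[OF x \<zeta>] by (simp add: fun_diff_def)
      next
        show "z \<in> ball z d" using d(1) by simp
      qed
      have "norm (kernel_op k f y - kernel_op k f z - kernel_op (k' (y - z)) f z)
          = norm (LINT \<zeta>|haar_torus. ?R \<zeta> * f \<zeta>)"
        using i[OF yS] i[OF z] by (simp add: kernel_op_def left_diff_distrib)
      also have "\<dots> \<le> (LINT \<zeta>|haar_torus. norm (?R \<zeta> * f \<zeta>))" by (rule integral_norm_bound)
      also have "\<dots> \<le> (LINT \<zeta>|haar_torus. norm (y - z) * (real DIM('a) * e') * norm (f \<zeta>))"
      proof (rule integral_mono)
        show "integrable haar_torus (\<lambda>\<zeta>. norm (?R \<zeta> * f \<zeta>))"
          using i[OF yS] i[OF z] by (simp add: left_diff_distrib)
        fix \<zeta> :: "complex ^ 'n" assume "\<zeta> \<in> space haar_torus"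
        then show "norm (?R \<zeta> * f \<zeta>) \<le> norm (y - z) * (real DIM('a) * e') * norm (f \<zeta>)"
          using R[of \<zeta>] unfolding norm_mult by (intro mult_right_mono) auto
      qed (use f in auto)
      also have "\<dots> = norm (y - z) * (real DIM('a) * e' * N)" by (simp add: N_def)
      also have "\<dots> \<le> norm (y - z) * e" using e'(2) by (intro mult_left_mono) auto
      finally show "norm (kernel_op k f y - kernel_op k f z - kernel_op (k' (y - z)) f z) \<le> e * norm (y - z)"
        by (simp add: mult.commute)
    qed
  qed
qed

text \<open>
  Stated for any \<open>u\<close> that agrees with the integral on \<open>S\<close>, so that the lemma applies
  again to the first derivatives, which are integrals only on \<open>S\<close>.
\<close>

lemma C1_on_kernel_op:
  fixes k :: "'a::euclidean_space \<Rightarrow> complex ^ 'n::finite \<Rightarrow> complex"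
  assumes S: "open S" and k: "C1_kernel_on S k k'" and f: "integrable haar_torus f"
    and u: "\<And>z. z \<in> S \<Longrightarrow> u z = kernel_op k f z"
  shows "\<And>z v. z \<in> S \<Longrightarrow> frechet_derivative u (at z) v = kernel_op (k' v) f z"
    and "C1_on S u"
proof -
  have d: "(u has_derivative (\<lambda>v. kernel_op (k' v) f z)) (at z)" if z: "z \<in> S" for z
    using has_derivative_transform_within_open[OF has_derivative_kernel_op[OF S k f z] S z] u by auto
  show fd: "frechet_derivative u (at z) v = kernel_op (k' v) f z" if "z \<in> S" for z v
    using frechet_derivative_at[OF d[OF that]] by metis
  have "continuous_on S (\<lambda>z. frechet_derivative u (at z) v)" for v
  proof -
    have "continuous_on S (kernel_op (k' v) f)"
      using k by (intro continuous_on_kernel_op f) (auto simp: C1_kernel_on_def)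
    then show ?thesis using fd by (subst continuous_on_cong[OF refl fd]) auto
  qed
  then show "C1_on S u" using d by (auto simp: C1_on_def differentiable_def)
qed

lemma C2_on_kernel_op:
  fixes k :: "'a::euclidean_space \<Rightarrow> complex ^ 'n::finite \<Rightarrow> complex"
  assumes S: "open S" and k: "C1_kernel_on S k k'" and k': "\<And>v. C1_kernel_on S (k' v) (k'' v)"
    and f: "integrable haar_torus f"
  shows "C2_on S (kernel_op k f)"
  unfolding C2_on_def
  using C1_on_kernel_op(2)[OF S k f refl] C1_on_kernel_op(2)[OF S k' f C1_on_kernel_op(1)[OF S k f refl]]
  by auto


section \<open>The kernel solves the differential equations\<close>

lemma C1_kernel_on_mult:
  assumes "C1_kernel_on S k k'" "C1_kernel_on S h h'"
  shows "C1_kernel_on S (\<lambda>z \<zeta>. k z \<zeta> * h z \<zeta>) (\<lambda>v z \<zeta>. k' v z \<zeta> * h z \<zeta> + k z \<zeta> * h' v z \<zeta>)"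
  using assms unfolding C1_kernel_on_def
  by (auto intro!: continuous_intros derivative_eq_intros simp: add.commute)

lemma C1_kernel_on_add:
  assumes "C1_kernel_on S k k'" "C1_kernel_on S h h'"
  shows "C1_kernel_on S (\<lambda>z \<zeta>. k z \<zeta> + h z \<zeta>) (\<lambda>v z \<zeta>. k' v z \<zeta> + h' v z \<zeta>)"
  using assms unfolding C1_kernel_on_def
  by (auto intro!: continuous_intros derivative_eq_intros)

lemma C1_kernel_on_const: "C1_kernel_on S (\<lambda>z \<zeta>. c) (\<lambda>v z \<zeta>. 0)"
  by (simp add: C1_kernel_on_def)

lemma C1_kernel_on_sum:
  assumes "finite J" "\<And>j. j \<in> J \<Longrightarrow> C1_kernel_on S (k j) (k' j)"
  shows "C1_kernel_on S (\<lambda>z \<zeta>. \<Sum>j\<in>J. k j z \<zeta>) (\<lambda>v z \<zeta>. \<Sum>j\<in>J. k' j v z \<zeta>)"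
  using assms by (induction J rule: finite_induct) (auto intro!: C1_kernel_on_const C1_kernel_on_add)

text \<open>
  Logarithmic derivatives of the factors add up to that of the product. Writing all derivatives
  of the kernel as kernel times logarithmic derivative keeps the second derivatives manageable.
\<close>

lemma C1_kernel_on_log_prod:
  assumes "finite J" "\<And>j. j \<in> J \<Longrightarrow> C1_kernel_on S (k j) (\<lambda>v z \<zeta>. k j z \<zeta> * l j v z \<zeta>)"
  shows "C1_kernel_on S (\<lambda>z \<zeta>. \<Prod>j\<in>J. k j z \<zeta>) (\<lambda>v z \<zeta>. (\<Prod>j\<in>J. k j z \<zeta>) * (\<Sum>j\<in>J. l j v z \<zeta>))"
  using assms
proof (induction J rule: finite_induct)
  case empty
  show ?case using C1_kernel_on_const[of S 1] by simp
next
  case (insert i J)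
  from insert have "C1_kernel_on S (\<lambda>z \<zeta>. k i z \<zeta> * (\<Prod>j\<in>J. k j z \<zeta>))
     (\<lambda>v z \<zeta>. (k i z \<zeta> * l i v z \<zeta>) * (\<Prod>j\<in>J. k j z \<zeta>) + k i z \<zeta> * ((\<Prod>j\<in>J. k j z \<zeta>) * (\<Sum>j\<in>J. l j v z \<zeta>)))"
    by (intro C1_kernel_on_mult) auto
  then show ?case using insert(1,2) by (simp add: algebra_simps)
qed

lemma C1_kernel_on_coordinate:
  fixes g g1 g2 :: "complex \<Rightarrow> complex \<Rightarrow> complex" and j :: "'n::finite"
  assumes der: "\<And>w \<eta>. norm w < 1 \<Longrightarrow> norm \<eta> = 1 \<Longrightarrow>
      ((\<lambda>w. g w \<eta>) has_derivative (\<lambda>v. g1 w \<eta> * v + g2 w \<eta> * cnj v)) (at w)"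
    and g: "continuous_on (ball 0 1 \<times> sphere 0 1) (\<lambda>x. g (fst x) (snd x))"
    and g1: "continuous_on (ball 0 1 \<times> sphere 0 1) (\<lambda>x. g1 (fst x) (snd x))"
    and g2: "continuous_on (ball 0 1 \<times> sphere 0 1) (\<lambda>x. g2 (fst x) (snd x))"
  shows "C1_kernel_on polydisc (\<lambda>z (\<zeta> :: complex ^ 'n). g (z $ j) (\<zeta> $ j))
     (\<lambda>v z \<zeta>. g1 (z $ j) (\<zeta> $ j) * v $ j + g2 (z $ j) (\<zeta> $ j) * cnj (v $ j))"
proof -
  have c: "continuous_on (polydisc \<times> torus) (\<lambda>x :: (complex ^ 'n) \<times> (complex ^ 'n). h (fst x $ j) (snd x $ j))"
    if "continuous_on (ball 0 1 \<times> sphere 0 1) (\<lambda>x. h (fst x) (snd x))" for h :: "complex \<Rightarrow> complex \<Rightarrow> complex"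
  proof -
    have "continuous_on (polydisc \<times> torus) (\<lambda>x :: (complex ^ 'n) \<times> (complex ^ 'n). (fst x $ j, snd x $ j))"
      by (intro continuous_intros)
    moreover have "(\<lambda>x :: (complex ^ 'n) \<times> (complex ^ 'n). (fst x $ j, snd x $ j)) ` (polydisc \<times> torus) \<subseteq> ball 0 1 \<times> sphere 0 1"
      by (auto simp: polydisc_def torus_def)
    ultimately show ?thesis using continuous_on_compose2[OF that] by fastforce
  qed
  have "((\<lambda>z. g (z $ j) (\<zeta> $ j)) has_derivative
      (\<lambda>v. g1 (z $ j) (\<zeta> $ j) * v $ j + g2 (z $ j) (\<zeta> $ j) * cnj (v $ j))) (at z)"
    if "z \<in> polydisc" "\<zeta> \<in> torus" for z \<zeta> :: "complex ^ 'n"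
  proof -
    have n: "norm (z $ j) < 1" "norm (\<zeta> $ j) = 1" using that by (auto simp: polydisc_def torus_def)
    show ?thesis
      by (rule has_derivative_compose[OF bounded_linear.has_derivative[OF bounded_linear_vec_nth has_derivative_ident] der[OF n]])
  qed
  then show ?thesis
    unfolding C1_kernel_on_def by (auto intro!: continuous_intros c g g1 g2)
qed

text \<open>
  The Wirtinger derivatives of the logarithm of \<open>circle_kernel a b w \<eta>\<close> with respect to
  \<open>w\<close> and \<open>cnj w\<close>. Here \<open>1 - w * cnj w\<close> stands for \<open>1 - |w|\<^sup>2\<close>, in a form
  that is visibly real-differentiable.
\<close>

definition dlog_z :: "complex \<Rightarrow> complex \<Rightarrow> complex \<Rightarrow> complex \<Rightarrow> complex" where
  "dlog_z a b w \<eta> = (a + 1) * cnj \<eta> / (1 - w * cnj \<eta>) - (a + b + 1) * cnj w / (1 - w * cnj w)"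

definition dlog_zbar :: "complex \<Rightarrow> complex \<Rightarrow> complex \<Rightarrow> complex \<Rightarrow> complex" where
  "dlog_zbar a b w \<eta> = (b + 1) * \<eta> / (1 - cnj w * \<eta>) - (a + b + 1) * w / (1 - w * cnj w)"

lemma kernel_denominators_nonzero:
  assumes w: "norm (w::complex) < 1" and \<eta>: "norm \<eta> = 1"
  shows "1 - w * cnj \<eta> \<noteq> 0" "1 - cnj w * \<eta> \<noteq> 0" "1 - w * cnj w \<noteq> 0"
    and "1 - w * cnj \<eta> \<notin> \<real>\<^sub>\<le>\<^sub>0" "1 - cnj w * \<eta> \<notin> \<real>\<^sub>\<le>\<^sub>0" "1 - w * cnj w \<notin> \<real>\<^sub>\<le>\<^sub>0"
proof -
  have "norm (w * cnj \<eta>) < 1" "norm (cnj w * \<eta>) < 1" "norm (w * cnj w) < 1"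
    using w \<eta> mult_strict_mono[of "norm w" 1 "norm w" 1] by (auto simp: norm_mult)
  then show "1 - w * cnj \<eta> \<noteq> 0" "1 - cnj w * \<eta> \<noteq> 0" "1 - w * cnj w \<noteq> 0"
      "1 - w * cnj \<eta> \<notin> \<real>\<^sub>\<le>\<^sub>0" "1 - cnj w * \<eta> \<notin> \<real>\<^sub>\<le>\<^sub>0" "1 - w * cnj w \<notin> \<real>\<^sub>\<le>\<^sub>0"
    by (blast dest: one_minus_not_nonpos)+
qed

lemma has_derivative_dlog_z:
  assumes "norm w < 1" "norm \<eta> = 1"
  shows "((\<lambda>w. dlog_z a b w \<eta>) has_derivative
    (\<lambda>v. ((a + 1) * (cnj \<eta>)\<^sup>2 / (1 - w * cnj \<eta>)\<^sup>2 - (a + b + 1) * (cnj w)\<^sup>2 / (1 - w * cnj w)\<^sup>2) * v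
      + (- (a + b + 1) / (1 - w * cnj w)\<^sup>2) * cnj v)) (at w)"
  unfolding dlog_z_def
  using kernel_denominators_nonzero[OF assms]
  by (auto intro!: derivative_eq_intros simp: fun_eq_iff) (simp add: divide_simps power2_eq_square, algebra)

lemma has_derivative_dlog_zbar:
  assumes "norm w < 1" "norm \<eta> = 1"
  shows "((\<lambda>w. dlog_zbar a b w \<eta>) has_derivative
    (\<lambda>v. (- (a + b + 1) / (1 - w * cnj w)\<^sup>2) * v
      + ((b + 1) * \<eta>\<^sup>2 / (1 - cnj w * \<eta>)\<^sup>2 - (a + b + 1) * w\<^sup>2 / (1 - w * cnj w)\<^sup>2) * cnj v)) (at w)"
  unfolding dlog_zbar_def
  using kernel_denominators_nonzero[OF assms]
  by (auto intro!: derivative_eq_intros simp: fun_eq_iff) (simp add: divide_simps power2_eq_square, algebra)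

lemma has_derivative_powr_log:
  fixes f :: "'a::real_normed_vector \<Rightarrow> complex"
  assumes "(f has_derivative f') (at z)" "f z \<notin> \<real>\<^sub>\<le>\<^sub>0"
  shows "((\<lambda>z. f z powr s) has_derivative (\<lambda>v. f z powr s * (s * f' v / f z))) (at z)"
  using has_derivative_compose[OF assms(1) has_field_derivative_powr[OF assms(2), of s, unfolded has_field_derivative_def]] assms(2)
  by (auto simp: powr_diff mult_ac)

lemma has_derivative_mult_log:
  fixes F G :: "'a::real_normed_vector \<Rightarrow> complex"
  assumes "(F has_derivative (\<lambda>v. F z * f v)) (at z)" "(G has_derivative (\<lambda>v. G z * g v)) (at z)"
  shows "((\<lambda>z. F z * G z) has_derivative (\<lambda>v. F z * G z * (f v + g v))) (at z)"
  by (rule has_derivative_eq_rhs[OF has_derivative_mult[OF assms]]) (simp add: algebra_simps)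

text \<open>
  A product of complex powers of three functions of \<open>w\<close>, to which the rules for
  logarithmic derivatives apply.
\<close>

lemma circle_kernel_prod_form:
  "circle_kernel a b w \<eta> = c_const a b * (((1 - w * cnj w) powr (a + b + 1)) *
     ((1 - w * cnj \<eta>) powr (-(a + 1)) * (1 - cnj w * \<eta>) powr (-(b + 1))))"
proof -
  have "of_real (1 - (norm w)\<^sup>2) = 1 - w * cnj w" by (simp only: of_real_diff complex_norm_square of_real_1)
  then show ?thesis
    by (simp only: circle_kernel_def divide_inverse inverse_mult_distrib powr_minus mult.assoc)
qed

lemma has_derivative_circle_kernel:
  assumes "norm w < 1" "norm \<eta> = 1"
  shows "((\<lambda>w. circle_kernel a b w \<eta>) has_derivative
    (\<lambda>v. (circle_kernel a b w \<eta> * dlog_z a b w \<eta>) * v + (circle_kernel a b w \<eta> * dlog_zbar a b w \<eta>) * cnj v)) (at w)"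
proof -
  note nz = kernel_denominators_nonzero[OF assms]
  let ?q = "1 - w * cnj w" and ?U = "1 - w * cnj \<eta>" and ?V = "1 - cnj w * \<eta>"
  have q: "((\<lambda>w. 1 - w * cnj w) has_derivative (\<lambda>v. - (w * cnj v + v * cnj w))) (at w)"
    by (auto intro!: derivative_eq_intros)
  have U: "((\<lambda>w. 1 - w * cnj \<eta>) has_derivative (\<lambda>v. - (v * cnj \<eta>))) (at w)"
    by (auto intro!: derivative_eq_intros)
  have V: "((\<lambda>w. 1 - cnj w * \<eta>) has_derivative (\<lambda>v. - (cnj v * \<eta>))) (at w)"
    by (auto intro!: derivative_eq_intros)
  have D: "((\<lambda>w. circle_kernel a b w \<eta>) has_derivative (\<lambda>v. circle_kernel a b w \<eta> *
     ((a + b + 1) * (- (w * cnj v + v * cnj w)) / ?q + (- (a + 1) * (- (v * cnj \<eta>)) / ?U + - (b + 1) * (- (cnj v * \<eta>)) / ?V)))) (at w)"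
    unfolding circle_kernel_prod_form mult.assoc[of "c_const a b"]
    by (intro has_derivative_mult_right has_derivative_mult_log has_derivative_powr_log q U V nz)
  have eq: "(a + b + 1) * (- (w * cnj v + v * cnj w)) / ?q + (- (a + 1) * (- (v * cnj \<eta>)) / ?U + - (b + 1) * (- (cnj v * \<eta>)) / ?V)
     = dlog_z a b w \<eta> * v + dlog_zbar a b w \<eta> * cnj v" for v
    using nz(1-3) by (simp add: dlog_z_def dlog_zbar_def add_divide_distrib diff_divide_distrib algebra_simps)
  from D show ?thesis unfolding eq by (simp only: distrib_left mult.assoc)
qed

lemma continuous_on_kernel_parts:
  shows "continuous_on (ball 0 1 \<times> sphere 0 1) (\<lambda>x::complex \<times> complex. 1 / (1 - fst x * cnj (snd x)) :: complex)"
    and "continuous_on (ball 0 1 \<times> sphere 0 1) (\<lambda>x::complex \<times> complex. 1 / (1 - cnj (fst x) * snd x) :: complex)"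
    and "continuous_on (ball 0 1 \<times> sphere 0 1) (\<lambda>x::complex \<times> complex. 1 / (1 - fst x * cnj (fst x)) :: complex)"
    and "continuous_on (ball 0 1 \<times> sphere 0 1) (\<lambda>x::complex \<times> complex. (1 - fst x * cnj (snd x)) powr s :: complex)"
    and "continuous_on (ball 0 1 \<times> sphere 0 1) (\<lambda>x::complex \<times> complex. (1 - cnj (fst x) * snd x) powr s :: complex)"
    and "continuous_on (ball 0 1 \<times> sphere 0 1) (\<lambda>x::complex \<times> complex. (1 - fst x * cnj (fst x)) powr s :: complex)"
proof -
  have c: "continuous_on A (\<lambda>x. f x powr s)" if "continuous_on A f" "\<And>x. x \<in> A \<Longrightarrow> f x \<notin> \<real>\<^sub>\<le>\<^sub>0" 
    for A and f :: "complex \<times> complex \<Rightarrow> complex"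
  proof (intro continuous_on_powr_complex continuous_on_const that(1))
    show "A \<subseteq> {z. 0 \<le> Re (f z) \<or> Im (f z) \<noteq> 0}"
      using that(2) by (force simp: complex_nonpos_Reals_iff)
    show "0 < Re s" if "z \<in> A" "f z = 0" for z
      using \<open>\<And>x. x \<in> A \<Longrightarrow> f x \<notin> \<real>\<^sub>\<le>\<^sub>0\<close>[OF that(1)] that(2) by simp
  qed
  have nz: "norm (fst x) < 1" "norm (snd x) = 1" if "x \<in> ball 0 1 \<times> sphere 0 1" for x :: "complex \<times> complex"
    using that by auto
  note nz = kernel_denominators_nonzero[OF nz]
  show "continuous_on (ball 0 1 \<times> sphere 0 1) (\<lambda>x::complex \<times> complex. 1 / (1 - fst x * cnj (snd x)) :: complex)"
    "continuous_on (ball 0 1 \<times> sphere 0 1) (\<lambda>x::complex \<times> complex. 1 / (1 - cnj (fst x) * snd x) :: complex)"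
    "continuous_on (ball 0 1 \<times> sphere 0 1) (\<lambda>x::complex \<times> complex. 1 / (1 - fst x * cnj (fst x)) :: complex)"
    "continuous_on (ball 0 1 \<times> sphere 0 1) (\<lambda>x::complex \<times> complex. (1 - fst x * cnj (snd x)) powr s :: complex)"
    "continuous_on (ball 0 1 \<times> sphere 0 1) (\<lambda>x::complex \<times> complex. (1 - cnj (fst x) * snd x) powr s :: complex)"
    "continuous_on (ball 0 1 \<times> sphere 0 1) (\<lambda>x::complex \<times> complex. (1 - fst x * cnj (fst x)) powr s :: complex)"
    by ((intro continuous_on_divide c ballI nz continuous_on_const continuous_on_diff continuous_on_mult
      continuous_on_cnj continuous_on_fst continuous_on_snd continuous_on_id; assumption)+)
qed


lemma continuous_on_circle_kernel:
  "continuous_on (ball 0 1 \<times> sphere 0 1) (\<lambda>x. circle_kernel a b (fst x) (snd x))"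
  unfolding circle_kernel_prod_form
  by (intro continuous_on_mult continuous_on_const continuous_on_kernel_parts)

text \<open>
  Division as multiplication with a reciprocal of known continuity: this avoids proving again, for
  each fraction, that the denominator has no zeros.
\<close>

lemma continuous_on_divide':
  fixes f g :: "'a::topological_space \<Rightarrow> complex"
  assumes "continuous_on A (\<lambda>x. 1 / g x)" "continuous_on A f"
  shows "continuous_on A (\<lambda>x. f x / g x)" "continuous_on A (\<lambda>x. f x / (g x)\<^sup>2)"
proof -
  have "continuous_on A (\<lambda>x. f x * (1 / g x))" "continuous_on A (\<lambda>x. f x * (1 / g x)\<^sup>2)"
    by (intro continuous_on_mult continuous_on_power assms)+
  then show "continuous_on A (\<lambda>x. f x / g x)" "continuous_on A (\<lambda>x. f x / (g x)\<^sup>2)"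
    by (simp_all add: power_divide)
qed

lemmas continuous_on_kernel_fractions =
  continuous_on_divide'[OF continuous_on_kernel_parts(1)]
  continuous_on_divide'[OF continuous_on_kernel_parts(2)]
  continuous_on_divide'[OF continuous_on_kernel_parts(3)]
  continuous_on_add continuous_on_diff continuous_on_mult continuous_on_power continuous_on_const
  continuous_on_cnj continuous_on_fst continuous_on_snd continuous_on_id

lemma continuous_on_dlog:
  "continuous_on (ball 0 1 \<times> sphere 0 1) (\<lambda>x. dlog_z a b (fst x) (snd x))"
  "continuous_on (ball 0 1 \<times> sphere 0 1) (\<lambda>x. dlog_zbar a b (fst x) (snd x))"
  unfolding dlog_z_def dlog_zbar_def
  by (intro continuous_on_kernel_fractions)+

lemma C1_kernel_on_circle_kernel:
  "C1_kernel_on polydisc (\<lambda>z (\<zeta> :: complex ^ 'n::finite). circle_kernel a b (z $ j) (\<zeta> $ j))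
     (\<lambda>v z \<zeta>. circle_kernel a b (z $ j) (\<zeta> $ j) *
        (dlog_z a b (z $ j) (\<zeta> $ j) * v $ j + dlog_zbar a b (z $ j) (\<zeta> $ j) * cnj (v $ j)))"
  unfolding distrib_left mult.assoc[symmetric]
  by (rule C1_kernel_on_coordinate, erule (1) has_derivative_circle_kernel)
    (intro continuous_on_mult continuous_on_circle_kernel continuous_on_dlog)+

text \<open>
  The logarithmic derivative of the Poisson kernel of the polydisc in the real direction
  \<open>v\<close>.
\<close>

definition dlog :: "complex ^ 'n::finite \<Rightarrow> complex ^ 'n \<Rightarrow> complex ^ 'n \<Rightarrow> complex ^ 'n \<Rightarrow> complex ^ 'n \<Rightarrow> complex" where
  "dlog \<alpha> \<beta> v z \<zeta> = (\<Sum>j\<in>UNIV. dlog_z (\<alpha> $ j) (\<beta> $ j) (z $ j) (\<zeta> $ j) * v $ j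
      + dlog_zbar (\<alpha> $ j) (\<beta> $ j) (z $ j) (\<zeta> $ j) * cnj (v $ j))"

lemma poisson_kernel_eq_prod:
  "poisson_kernel \<alpha> \<beta> z \<zeta> = (\<Prod>j\<in>UNIV. circle_kernel (\<alpha> $ j) (\<beta> $ j) (z $ j) (\<zeta> $ j))"
  by (simp add: poisson_kernel_def circle_kernel_def)

lemma C1_kernel_on_poisson_kernel:
  "C1_kernel_on polydisc (poisson_kernel \<alpha> \<beta>) (\<lambda>v z \<zeta>. poisson_kernel \<alpha> \<beta> z \<zeta> * dlog \<alpha> \<beta> v z \<zeta>)"
  unfolding poisson_kernel_eq_prod[abs_def] dlog_def
  by (rule C1_kernel_on_log_prod[OF finite C1_kernel_on_circle_kernel])

text \<open>
  The derivative of \<open>dlog_zbar a b w \<eta>\<close> with respect to \<open>w\<close>, hence the mixed second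
  derivative of the logarithm of the kernel: only the factor \<open>(1 - |w|\<^sup>2) powr (a + b + 1)\<close>
  contributes, as the other two are holomorphic or antiholomorphic.
\<close>

definition mixed_dlog :: "complex \<Rightarrow> complex \<Rightarrow> complex \<Rightarrow> complex" where
  "mixed_dlog a b w = - (a + b + 1) / (1 - w * cnj w)\<^sup>2"

lemma ex_C1_kernel_dlog_z:
  "\<exists>h'. C1_kernel_on polydisc (\<lambda>z (\<zeta> :: complex ^ 'n::finite). dlog_z a b (z $ j) (\<zeta> $ j)) h'"
  by (rule exI, rule C1_kernel_on_coordinate, erule (1) has_derivative_dlog_z, rule continuous_on_dlog)
    (intro continuous_on_kernel_fractions)+

lemma C1_kernel_dlog_zbar:
  "C1_kernel_on polydisc (\<lambda>z (\<zeta> :: complex ^ 'n::finite). dlog_zbar a b (z $ j) (\<zeta> $ j))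
    (\<lambda>v z \<zeta>. mixed_dlog a b (z $ j) * v $ j
      + ((b + 1) * (\<zeta> $ j)\<^sup>2 / (1 - cnj (z $ j) * \<zeta> $ j)\<^sup>2
         - (a + b + 1) * (z $ j)\<^sup>2 / (1 - z $ j * cnj (z $ j))\<^sup>2) * cnj (v $ j))"
  unfolding mixed_dlog_def
  by (rule C1_kernel_on_coordinate, erule (1) has_derivative_dlog_zbar, rule continuous_on_dlog)
    (intro continuous_on_kernel_fractions)+

lemma ex_C1_kernel_dlog:
  fixes \<alpha> \<beta> :: "complex ^ 'n::finite"
  shows "\<exists>h'. C1_kernel_on polydisc (dlog \<alpha> \<beta> v) h'"
proof -
  have "\<exists>h. C1_kernel_on polydisc (\<lambda>z (\<zeta> :: complex ^ 'n). dlog_z (\<alpha> $ j) (\<beta> $ j) (z $ j) (\<zeta> $ j) * v $ j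
      + dlog_zbar (\<alpha> $ j) (\<beta> $ j) (z $ j) (\<zeta> $ j) * cnj (v $ j)) h" for j
  proof -
    obtain h where h: "C1_kernel_on polydisc (\<lambda>z (\<zeta> :: complex ^ 'n). dlog_z (\<alpha> $ j) (\<beta> $ j) (z $ j) (\<zeta> $ j)) h"
      using ex_C1_kernel_dlog_z by blast
    show ?thesis
      by (rule exI, rule C1_kernel_on_add[OF C1_kernel_on_mult[OF h C1_kernel_on_const[of polydisc "v $ j"]]
        C1_kernel_on_mult[OF C1_kernel_dlog_zbar[of "\<alpha> $ j" "\<beta> $ j" j] C1_kernel_on_const[of polydisc "cnj (v $ j)"]]])
  qed
  then have "\<forall>j. \<exists>h. C1_kernel_on polydisc (\<lambda>z (\<zeta> :: complex ^ 'n). dlog_z (\<alpha> $ j) (\<beta> $ j) (z $ j) (\<zeta> $ j) * v $ j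
      + dlog_zbar (\<alpha> $ j) (\<beta> $ j) (z $ j) (\<zeta> $ j) * cnj (v $ j)) h" ..
  from choice[OF this] obtain H where "\<And>j. C1_kernel_on polydisc (\<lambda>z (\<zeta> :: complex ^ 'n). dlog_z (\<alpha> $ j) (\<beta> $ j) (z $ j) (\<zeta> $ j) * v $ j
      + dlog_zbar (\<alpha> $ j) (\<beta> $ j) (z $ j) (\<zeta> $ j) * cnj (v $ j)) (H j)" by blast
  note H = C1_kernel_on_sum[OF finite this]
  show ?thesis
    unfolding dlog_def[abs_def] by (rule exI, rule H)
qed

lemma C1_kernel_on_section:
  "C1_kernel_on S k k' \<Longrightarrow> z \<in> S \<Longrightarrow> continuous_on torus (k z)"
  unfolding C1_kernel_on_def by (rule continuous_on_section) auto

lemma wirtinger_kernel_op: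
  fixes k :: "complex ^ 'n::finite \<Rightarrow> complex ^ 'n \<Rightarrow> complex"
  assumes k: "C1_kernel_on polydisc k k'" and f: "integrable haar_torus f"
    and u: "\<And>z. z \<in> polydisc \<Longrightarrow> u z = kernel_op k f z" and z: "z \<in> polydisc"
  shows "d_z j u z = kernel_op (\<lambda>z \<zeta>. (k' (axis j 1) z \<zeta> - \<i> * k' (axis j \<i>) z \<zeta>) / 2) f z"
    and "d_zbar j u z = kernel_op (\<lambda>z \<zeta>. (k' (axis j 1) z \<zeta> + \<i> * k' (axis j \<i>) z \<zeta>) / 2) f z"
proof -
  have i: "integrable haar_torus (\<lambda>\<zeta>. k' v z \<zeta> * f \<zeta>)" for v
    using k z by (intro integrable_continuous_mult_torus f continuous_on_section[where k="k' v"]) (auto simp: C1_kernel_on_def)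
  have fd: "frechet_derivative u (at z) v = kernel_op (k' v) f z" for v
    using C1_on_kernel_op(1)[OF open_polydisc k f _ z] u by blast
  show "d_z j u z = kernel_op (\<lambda>z \<zeta>. (k' (axis j 1) z \<zeta> - \<i> * k' (axis j \<i>) z \<zeta>) / 2) f z"
    "d_zbar j u z = kernel_op (\<lambda>z \<zeta>. (k' (axis j 1) z \<zeta> + \<i> * k' (axis j \<i>) z \<zeta>) / 2) f z"
    unfolding d_z_def d_zbar_def fd
    using i by (simp_all add: kernel_op_def diff_divide_distrib add_divide_distrib left_diff_distrib distrib_right mult.assoc)
qed

lemma dlog_axis:
  "dlog \<alpha> \<beta> (axis j x) z \<zeta> = dlog_z (\<alpha> $ j) (\<beta> $ j) (z $ j) (\<zeta> $ j) * x
      + dlog_zbar (\<alpha> $ j) (\<beta> $ j) (z $ j) (\<zeta> $ j) * cnj x"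
proof -
  have "dlog \<alpha> \<beta> (axis j x) z \<zeta> = (\<Sum>i\<in>UNIV. if i = j then dlog_z (\<alpha> $ j) (\<beta> $ j) (z $ j) (\<zeta> $ j) * x
      + dlog_zbar (\<alpha> $ j) (\<beta> $ j) (z $ j) (\<zeta> $ j) * cnj x else 0)"
    unfolding dlog_def by (intro sum.cong) (auto simp: axis_def)
  then show ?thesis by simp
qed

text \<open>
  The differential equation for the kernel after division by the kernel. Since
  \<open>\<eta> * cnj \<eta> = 1\<close>, everything can be expressed through \<open>U = 1 - w * cnj \<eta>\<close> and
  \<open>V = 1 - cnj w * \<eta>\<close>, with \<open>1 - |w|\<^sup>2 = U + V - U * V\<close>; what remains is an identity of
  rational functions in \<open>U\<close> and \<open>V\<close>.
\<close>

lemma kernel_harmonicity_identity: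
  fixes a b w \<eta> :: complex
  assumes w: "norm w < 1" and \<eta>: "norm \<eta> = 1"
  shows "(1 - w * cnj w) * (dlog_z a b w \<eta> * dlog_zbar a b w \<eta> + mixed_dlog a b w)
    + a * w * dlog_z a b w \<eta> + b * cnj w * dlog_zbar a b w \<eta> - a * b = 0"
proof -
  define U where "U = 1 - w * cnj \<eta>"
  define V where "V = 1 - cnj w * \<eta>"
  have e: "\<eta> * cnj \<eta> = 1" using \<eta> by (simp only: complex_norm_square[symmetric]) simp
  have w1: "w = (1 - U) * \<eta>" using e by (simp add: U_def algebra_simps)
  have w2: "cnj w = (1 - V) * cnj \<eta>" using e by (simp add: V_def algebra_simps)
  have q: "1 - w * cnj w = U + V - U * V"
  proof -
    have "w * cnj w = (1 - U) * (1 - V) * (\<eta> * cnj \<eta>)" using w1 w2 by (metis mult.assoc mult.commute)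
    then show ?thesis using e by (simp add: algebra_simps)
  qed
  have nz: "U \<noteq> 0" "V \<noteq> 0" "U + V - U * V \<noteq> 0"
    using kernel_denominators_nonzero(1-3)[OF assms] q by (auto simp: U_def V_def)
  define A where "A = (a + 1) / U - (a + b + 1) * (1 - V) / (U + V - U * V)"
  define B where "B = (b + 1) / V - (a + b + 1) * (1 - U) / (U + V - U * V)"
  have A: "dlog_z a b w \<eta> = cnj \<eta> * A"
    unfolding dlog_z_def q U_def[symmetric] A_def by (subst w2) (simp add: algebra_simps)
  have B: "dlog_zbar a b w \<eta> = \<eta> * B"
    unfolding dlog_zbar_def q V_def[symmetric] B_def by (subst w1) (simp add: algebra_simps)
  have "dlog_z a b w \<eta> * dlog_zbar a b w \<eta> = A * B * (\<eta> * cnj \<eta>)" unfolding A B by (simp only: mult_ac)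
  then have AB: "dlog_z a b w \<eta> * dlog_zbar a b w \<eta> = A * B" using e by simp
  have "w * dlog_z a b w \<eta> = (1 - U) * A * (\<eta> * cnj \<eta>)" unfolding A by (subst w1) (simp only: mult_ac)
  then have wA: "w * dlog_z a b w \<eta> = (1 - U) * A" using e by simp
  have "cnj w * dlog_zbar a b w \<eta> = (1 - V) * B * (\<eta> * cnj \<eta>)" unfolding B by (subst w2) (simp only: mult_ac)
  then have wB: "cnj w * dlog_zbar a b w \<eta> = (1 - V) * B" using e by simp
  have "(U + V - U * V) * (A * B + - (a + b + 1) / (U + V - U * V)\<^sup>2)
    + a * ((1 - U) * A) + b * ((1 - V) * B) - a * b = 0"
    unfolding A_def B_def using nz by (simp add: divide_simps power2_eq_square) algebra
  then show ?thesis
    unfolding mixed_dlog_def q AB wA[symmetric] wB[symmetric] by (simp only: mult.assoc)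
qed

text \<open>
  All derivatives pass under the integral, where the combination prescribed by \<open>L_op\<close> vanishes
  pointwise by the preceding identity.
\<close>

lemma poisson_integral_in_sh:
  fixes \<alpha> \<beta> :: "complex ^ 'n::finite"
  assumes f: "integrable haar_torus f"
  shows "poisson_integral \<alpha> \<beta> f \<in> sh \<alpha> \<beta>"
proof -
  let ?k = "poisson_kernel \<alpha> \<beta>"
  have u: "poisson_integral \<alpha> \<beta> f = kernel_op ?k f" by (simp add: fun_eq_iff poisson_integral_def kernel_op_def)
  note k = C1_kernel_on_poisson_kernel[of \<alpha> \<beta>]
  obtain dl where dl: "\<And>v. C1_kernel_on polydisc (dlog \<alpha> \<beta> v) (dl v)" using ex_C1_kernel_dlog by metis
  have "C2_on polydisc (kernel_op ?k f)"
    by (rule C2_on_kernel_op[OF open_polydisc k C1_kernel_on_mult[OF k dl] f])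
  moreover have "L_op \<alpha> \<beta> j (kernel_op ?k f) z = 0" if z: "z \<in> polydisc" for j z
  proof -
    let ?a = "\<alpha> $ j" and ?b = "\<beta> $ j"
    let ?A = "\<lambda>z \<zeta> :: complex ^ 'n. dlog_z ?a ?b (z $ j) (\<zeta> $ j)" and ?B = "\<lambda>z \<zeta> :: complex ^ 'n. dlog_zbar ?a ?b (z $ j) (\<zeta> $ j)"
    have dz: "d_z j (kernel_op ?k f) z = kernel_op (\<lambda>z \<zeta>. ?k z \<zeta> * ?A z \<zeta>) f z"
      unfolding wirtinger_kernel_op(1)[OF k f refl z] dlog_axis
      by (rule arg_cong[where f="\<lambda>k. kernel_op k f z"]) (simp add: fun_eq_iff algebra_simps)
    have dzb: "d_zbar j (kernel_op ?k f) z = kernel_op (\<lambda>z \<zeta>. ?k z \<zeta> * ?B z \<zeta>) f z" if "z \<in> polydisc" for z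
      unfolding wirtinger_kernel_op(2)[OF k f refl that] dlog_axis
      by (rule arg_cong[where f="\<lambda>k. kernel_op k f z"]) (simp add: fun_eq_iff algebra_simps)
    have kB: "C1_kernel_on polydisc (\<lambda>z \<zeta>. ?k z \<zeta> * ?B z \<zeta>) (\<lambda>v z \<zeta>. ?k z \<zeta> * dlog \<alpha> \<beta> v z \<zeta> * ?B z \<zeta> + ?k z \<zeta> *
       (mixed_dlog ?a ?b (z $ j) * v $ j
      + ((?b + 1) * (\<zeta> $ j)\<^sup>2 / (1 - cnj (z $ j) * \<zeta> $ j)\<^sup>2
         - (?a + ?b + 1) * (z $ j)\<^sup>2 / (1 - z $ j * cnj (z $ j))\<^sup>2) * cnj (v $ j)))"
      by (rule C1_kernel_on_mult[OF k C1_kernel_dlog_zbar])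
    have dzzb: "d_z j (d_zbar j (kernel_op ?k f)) z = kernel_op (\<lambda>z \<zeta>. ?k z \<zeta> * (?A z \<zeta> * ?B z \<zeta> + mixed_dlog ?a ?b (z $ j))) f z"
      by (rule trans[OF wirtinger_kernel_op(1)[OF kB f _ z]], erule dzb, unfold dlog_axis,
          rule arg_cong[where f="\<lambda>k. kernel_op k f z"]) (simp add: fun_eq_iff algebra_simps)
    have c: "continuous_on torus (?k z)" "continuous_on torus (?A z)" "continuous_on torus (?B z)"
    proof -
      obtain h where h: "C1_kernel_on polydisc ?A h" using ex_C1_kernel_dlog_z by blast
      show "continuous_on torus (?k z)" "continuous_on torus (?A z)" "continuous_on torus (?B z)"
        by (rule C1_kernel_on_section[OF k z] C1_kernel_on_section[OF h z] C1_kernel_on_section[OF C1_kernel_dlog_zbar z])+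
    qed
    have i: "integrable haar_torus (\<lambda>\<zeta>. ?k z \<zeta> * (?A z \<zeta> * ?B z \<zeta> + mixed_dlog ?a ?b (z $ j)) * f \<zeta>)"
      "integrable haar_torus (\<lambda>\<zeta>. ?k z \<zeta> * ?A z \<zeta> * f \<zeta>)" "integrable haar_torus (\<lambda>\<zeta>. ?k z \<zeta> * ?B z \<zeta> * f \<zeta>)"
      "integrable haar_torus (\<lambda>\<zeta>. ?k z \<zeta> * f \<zeta>)"
      by (intro integrable_continuous_mult_torus f continuous_on_mult continuous_on_add continuous_on_const c)+
    let ?q = "of_real (1 - (norm (z $ j))\<^sup>2) :: complex"
    have "L_op \<alpha> \<beta> j (kernel_op ?k f) z = (LINT \<zeta>|haar_torus. ?q * (?k z \<zeta> * (?A z \<zeta> * ?B z \<zeta> + mixed_dlog ?a ?b (z $ j)) * f \<zeta>)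
       + ?a * z $ j * (?k z \<zeta> * ?A z \<zeta> * f \<zeta>) + ?b * cnj (z $ j) * (?k z \<zeta> * ?B z \<zeta> * f \<zeta>) - ?a * ?b * (?k z \<zeta> * f \<zeta>))"
      unfolding L_op_def dzzb dz dzb[OF z] kernel_op_def
      by (simp only: Bochner_Integration.integral_add Bochner_Integration.integral_diff Bochner_Integration.integrable_add
        integrable_mult_right i integral_mult_right_zero)
    also have "\<dots> = (LINT \<zeta>|(haar_torus :: (complex ^ 'n) measure). 0)"
    proof (rule Bochner_Integration.integral_cong[OF refl])
      fix \<zeta> :: "complex ^ 'n" assume "\<zeta> \<in> space haar_torus"
      then have n: "norm (z $ j) < 1" "norm (\<zeta> $ j) = 1" using z by (auto simp: polydisc_def torus_def)
      have q: "?q = 1 - z $ j * cnj (z $ j)" by (simp only: of_real_diff complex_norm_square of_real_1)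
      have "?q * (?k z \<zeta> * (?A z \<zeta> * ?B z \<zeta> + mixed_dlog ?a ?b (z $ j)) * f \<zeta>)
       + ?a * z $ j * (?k z \<zeta> * ?A z \<zeta> * f \<zeta>) + ?b * cnj (z $ j) * (?k z \<zeta> * ?B z \<zeta> * f \<zeta>) - ?a * ?b * (?k z \<zeta> * f \<zeta>)
       = (?k z \<zeta> * f \<zeta>) * ((1 - z $ j * cnj (z $ j)) * (?A z \<zeta> * ?B z \<zeta> + mixed_dlog ?a ?b (z $ j))
          + ?a * z $ j * ?A z \<zeta> + ?b * cnj (z $ j) * ?B z \<zeta> - ?a * ?b)"
        unfolding q by (simp only: distrib_left right_diff_distrib mult_ac)
      also have "\<dots> = 0" unfolding kernel_harmonicity_identity[OF n] by simp
      finally show "?q * (?k z \<zeta> * (?A z \<zeta> * ?B z \<zeta> + mixed_dlog ?a ?b (z $ j)) * f \<zeta>)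
       + ?a * z $ j * (?k z \<zeta> * ?A z \<zeta> * f \<zeta>) + ?b * cnj (z $ j) * (?k z \<zeta> * ?B z \<zeta> * f \<zeta>) - ?a * ?b * (?k z \<zeta> * f \<zeta>) = 0" .
    qed
    finally show ?thesis by simp
  qed
  ultimately show ?thesis unfolding u sh_def by simp
qed


section \<open>The majorant on the torus\<close>

abbreviation radial :: "real ^ 'n \<Rightarrow> complex ^ 'n \<Rightarrow> complex ^ 'n" where
  "radial r \<zeta> \<equiv> (\<chi> j. of_real (r $ j) * \<zeta> $ j)"

lemma radial_in_polydisc: "r \<in> radii \<Longrightarrow> \<zeta> \<in> torus \<Longrightarrow> radial r \<zeta> \<in> polydisc"
  by (auto simp: radii_def torus_def polydisc_def norm_mult)

definition torus_majorant :: "complex ^ 'n::finite \<Rightarrow> complex ^ 'n \<Rightarrow> complex ^ 'n \<Rightarrow> complex ^ 'n \<Rightarrow> real" where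
  "torus_majorant \<alpha> \<beta> z \<zeta> = (\<Prod>j\<in>UNIV. kernel_const (\<alpha> $ j) (\<beta> $ j) *
     majorant_kernel (Re (\<alpha> $ j) + Re (\<beta> $ j)) (z $ j) (\<zeta> $ j))"

lemma kernel_const_nonneg: "0 \<le> kernel_const a b"
  by (simp add: kernel_const_def)

lemma torus_majorant_nonneg: "0 \<le> torus_majorant \<alpha> \<beta> z \<zeta>"
  unfolding torus_majorant_def
  by (intro prod_nonneg ballI mult_nonneg_nonneg kernel_const_nonneg majorant_kernel_nonneg)

lemma norm_poisson_kernel_le:
  assumes "z \<in> polydisc" "\<zeta> \<in> torus"
  shows "norm (poisson_kernel \<alpha> \<beta> z \<zeta>) \<le> torus_majorant \<alpha> \<beta> z \<zeta>"
  unfolding poisson_kernel_eq_prod torus_majorant_def prod_norm[symmetric]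
  using assms by (intro prod_mono conjI norm_ge_zero norm_circle_kernel_le) (auto simp: polydisc_def torus_def)

text \<open>
  Because of this symmetry, integrating the majorant over the first variable gives the same bound
  as integrating it over the second one; the Schur test needs both.
\<close>

lemma torus_majorant_commute:
  assumes "\<zeta> \<in> torus" "\<eta> \<in> torus"
  shows "torus_majorant \<alpha> \<beta> (radial r \<zeta>) \<eta> = torus_majorant \<alpha> \<beta> (radial r \<eta>) \<zeta>"
proof -
  have "norm (1 - of_real x * y * cnj w) = norm (1 - of_real x * w * cnj y)" for x y w
    by (subst complex_mod_cnj[symmetric]) (simp add: mult_ac)
  then show ?thesis
    using assms unfolding torus_majorant_def majorant_kernel_def by (simp add: norm_mult torus_def)
qed

lemma borel_measurable_cnj [measurable]: "cnj \<in> borel_measurable borel"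
  by (intro borel_measurable_continuous_onI continuous_intros)

lemma measurable_torus_majorant:
  "(\<lambda>x. torus_majorant \<alpha> \<beta> (radial r (fst x)) (snd x)) \<in> borel_measurable
     ((haar_torus :: (complex ^ 'n::finite) measure) \<Otimes>\<^sub>M haar_torus)"
proof -
  have nth: "(\<lambda>\<zeta> :: complex ^ 'n. \<zeta> $ j) \<in> borel_measurable haar_torus" for j
    by (intro borel_measurable_torus borel_measurable_continuous_onI continuous_intros)
  have [measurable]: "(\<lambda>x. fst x $ j) \<in> borel_measurable ((haar_torus :: (complex ^ 'n) measure) \<Otimes>\<^sub>M (haar_torus :: (complex ^ 'n) measure))"
    "(\<lambda>x. snd x $ j) \<in> borel_measurable ((haar_torus :: (complex ^ 'n) measure) \<Otimes>\<^sub>M (haar_torus :: (complex ^ 'n) measure))" for j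
    using measurable_compose[OF measurable_fst nth] measurable_compose[OF measurable_snd nth] by auto
  show ?thesis
    unfolding torus_majorant_def majorant_kernel_def vec_lambda_beta by measurable
qed

lemma K_const_eq_prod:
  "K_const \<alpha> \<beta> = (\<Prod>j\<in>UNIV. kernel_const (\<alpha> $ j) (\<beta> $ j) * majorant_mass (Re (\<alpha> $ j) + Re (\<beta> $ j)))"
  unfolding K_const_def sum_distrib_left exp_sum[OF finite] prod.distrib[symmetric]
  by (intro prod.cong) (simp_all add: kernel_const_def majorant_mass_def c_const_def)

lemma majorant_mass_pos:
  assumes s: "s > -1"
  shows "0 < majorant_mass s"
proof -
  have "0 < s / 2 + 1" "0 < s + 1" using s by auto
  then show ?thesis
    unfolding majorant_mass_def by (intro divide_pos_pos Gamma_real_pos zero_less_power)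
qed

text \<open>
  The last two assumptions say that neither \<open>\<alpha> $ j\<close> nor \<open>\<beta> $ j\<close> is a negative integer,
  in the form in which the poles of \<open>Gamma\<close> are described.
\<close>

locale poisson_parameters =
  fixes \<alpha> \<beta> :: "complex ^ 'n::finite"
  assumes Re_sum: "\<And>j. Re (\<alpha> $ j) + Re (\<beta> $ j) > -1"
    and \<alpha>_pole: "\<And>j. \<alpha> $ j + 1 \<notin> \<int>\<^sub>\<le>\<^sub>0"
    and \<beta>_pole: "\<And>j. \<beta> $ j + 1 \<notin> \<int>\<^sub>\<le>\<^sub>0"
begin

abbreviation "Q \<equiv> torus_majorant \<alpha> \<beta>"
abbreviation "K \<equiv> K_const \<alpha> \<beta>"
abbreviation "mass j \<equiv> majorant_mass (Re (\<alpha> $ j) + Re (\<beta> $ j))"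
abbreviation "\<kappa> j \<equiv> kernel_const (\<alpha> $ j) (\<beta> $ j)"

lemma mass_pos: "0 < mass j"
  by (rule majorant_mass_pos[OF Re_sum])

lemma kernel_const_pos: "0 < \<kappa> j"
proof -
  have "\<alpha> $ j + \<beta> $ j + 1 \<notin> \<int>\<^sub>\<le>\<^sub>0"
    using Re_sum[of j] by (auto elim!: nonpos_Ints_cases' dest!: arg_cong[where f=Re])
  then show ?thesis using \<alpha>_pole[of j] \<beta>_pole[of j]
    by (auto simp: kernel_const_def c_const_def Gamma_eq_zero_iff)
qed

lemma K_pos: "0 < K"
  unfolding K_const_eq_prod using kernel_const_pos mass_pos by (intro prod_pos) auto

text \<open>
  The majorant is a product over the coordinates, and so is Haar measure.
\<close>

lemma
  assumes z: "z \<in> polydisc"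
  shows continuous_on_Q: "continuous_on torus (Q z)"
    and integrable_Q: "integrable haar_torus (Q z)"
    and integral_Q_le: "(LINT \<eta>|haar_torus. Q z \<eta>) \<le> K"
proof -
  have zj: "norm (z $ j) < 1" for j using z by (simp add: polydisc_def)
  let ?f = "\<lambda>j \<eta>. \<kappa> j * majorant_kernel (Re (\<alpha> $ j) + Re (\<beta> $ j)) (z $ j) \<eta>"
  have "continuous_on torus (\<lambda>\<eta> :: complex ^ 'n. ?f j (\<eta> $ j))" for j
    by (intro continuous_on_mult continuous_on_const continuous_on_compose2[OF continuous_on_majorant_kernel[OF zj]] continuous_intros)
      (auto simp: torus_def)
  then show "continuous_on torus (Q z)" unfolding torus_majorant_def by (intro continuous_on_prod) auto
  have i: "integrable haar_circle (?f j)" for j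
    using integrable_majorant_kernel[OF zj] by auto
  show "integrable haar_torus (Q z)"
    unfolding torus_majorant_def[abs_def] by (rule haar_torus_prod(1)[OF i])
  have "(LINT \<eta>|haar_torus. Q z \<eta>) = (\<Prod>j\<in>UNIV. (LINT \<eta>|haar_circle. ?f j \<eta>))"
    unfolding torus_majorant_def by (rule haar_torus_prod(2)[OF i])
  also have "\<dots> \<le> (\<Prod>j\<in>UNIV. \<kappa> j * mass j)"
    by (intro prod_mono conjI Bochner_Integration.integral_nonneg mult_nonneg_nonneg kernel_const_nonneg majorant_kernel_nonneg)
      (simp add: mult_left_mono kernel_const_nonneg integral_majorant_kernel_le[OF zj Re_sum])
  finally show "(LINT \<eta>|haar_torus. Q z \<eta>) \<le> K" by (simp add: K_const_eq_prod)
qed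

lemma integrable_Q_mult:
  assumes z: "z \<in> polydisc" and f: "integrable haar_torus (f :: complex ^ 'n \<Rightarrow> real)"
  shows "integrable haar_torus (\<lambda>\<eta>. Q z \<eta> * f \<eta>)"
proof -
  obtain B where B: "B \<ge> 0" "\<And>\<zeta>. \<zeta> \<in> torus \<Longrightarrow> norm (Q z \<zeta>) \<le> B"
    using continuous_on_torus_bounded[OF continuous_on_Q[OF z]] by blast
  show ?thesis
  proof (rule Bochner_Integration.integrable_bound)
    show "integrable haar_torus (\<lambda>\<zeta>. B * norm (f \<zeta>))" using f by auto
    show "(\<lambda>\<zeta>. Q z \<zeta> * f \<zeta>) \<in> borel_measurable haar_torus"
      using continuous_on_measurable_torus[OF continuous_on_Q[OF z]] f by measurable
    show "AE \<zeta> in haar_torus. norm (Q z \<zeta> * f \<zeta>) \<le> norm (B * norm (f \<zeta>))"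
      using B by (intro AE_I2) (auto simp: abs_mult intro!: mult_right_mono)
  qed
qed

lemma integrable_poisson_kernel:
  assumes z: "z \<in> polydisc" and f: "integrable haar_torus f"
  shows "integrable haar_torus (\<lambda>\<eta>. poisson_kernel \<alpha> \<beta> z \<eta> * f \<eta>)"
  by (intro integrable_continuous_mult_torus C1_kernel_on_section[OF C1_kernel_on_poisson_kernel z] f)

lemma norm_poisson_integral_le:
  assumes z: "z \<in> polydisc" and f: "integrable haar_torus f"
  shows "norm (poisson_integral \<alpha> \<beta> f z) \<le> (LINT \<eta>|haar_torus. Q z \<eta> * norm (f \<eta>))"
  unfolding poisson_integral_def
  using norm_poisson_kernel_le[OF z]
  by (intro order_trans[OF integral_norm_bound] integral_mono integrable_norm integrable_poisson_kernel
      integrable_Q_mult z f) (auto simp: norm_mult intro!: mult_right_mono)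

lemma integral_poisson_kernel:
  assumes z: "z \<in> polydisc"
  shows "(LINT \<eta>|haar_torus. poisson_kernel \<alpha> \<beta> z \<eta>) = (\<Prod>j\<in>UNIV. kernel_mean (\<alpha> $ j) (\<beta> $ j) ((norm (z $ j))\<^sup>2))"
proof -
  have zj: "norm (z $ j) < 1" for j using z by (simp add: polydisc_def)
  have "integrable haar_circle (circle_kernel a b w)" if "norm w < 1" for a b w
  proof (intro continuous_on_integrable_circle)
    have "w \<in> ball 0 1" using that by simp
    from continuous_on_section[OF continuous_on_circle_kernel this]
    show "continuous_on (sphere 0 1) (circle_kernel a b w)" .
  qed
  then have "(LINT \<eta>|haar_torus. (\<Prod>j\<in>UNIV. circle_kernel (\<alpha> $ j) (\<beta> $ j) (z $ j) (\<eta> $ j))) =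
     (\<Prod>j\<in>UNIV. (LINT \<eta>|haar_circle. circle_kernel (\<alpha> $ j) (\<beta> $ j) (z $ j) \<eta>))"
    by (intro haar_torus_prod(2)) (use zj in auto)
  then show ?thesis unfolding poisson_kernel_eq_prod by (simp add: integral_circle_kernel[OF zj])
qed

text \<open>
  The norm of a vector is at most the sum of the moduli of its coordinates. For the \<open>i\<close>-th one,
  the integral splits into a product whose \<open>i\<close>-th factor is the concentration integral of the circle and
  whose other factors are bounded by their masses.
\<close>

lemma integral_Q_dist_le:
  assumes \<zeta>: "\<zeta> \<in> torus" and r: "r \<in> radii" and \<delta>: "\<delta> > 0"
  shows "(LINT \<eta>|haar_torus. Q (radial r \<zeta>) \<eta> * norm (\<eta> - \<zeta>)) \<le>
    (\<Sum>i\<in>UNIV. K / mass i * (\<delta> * mass i + 2 * (1 - (r $ i)\<^sup>2) powr (Re (\<alpha> $ i) + Re (\<beta> $ i) + 1)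
        / (\<delta> / 2) powr (Re (\<alpha> $ i) + Re (\<beta> $ i) + 2)))"
proof -
  have z: "radial r \<zeta> \<in> polydisc" using r \<zeta> by (rule radial_in_polydisc)
  have zj: "norm (of_real (r $ j) * \<zeta> $ j) < 1" for j using z by (simp add: polydisc_def)
  let ?s = "\<lambda>j. Re (\<alpha> $ j) + Re (\<beta> $ j)"
  let ?m = "\<lambda>j \<eta>. \<kappa> j * majorant_kernel (?s j) (of_real (r $ j) * \<zeta> $ j) \<eta>"
  let ?E = "\<lambda>i. \<delta> * mass i + 2 * (1 - (r $ i)\<^sup>2) powr (?s i + 1) / (\<delta> / 2) powr (?s i + 2)"
  let ?f = "\<lambda>i j \<eta>. ?m j \<eta> * (if j = i then norm (\<eta> - \<zeta> $ i) else 1)"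
  have fi: "integrable haar_circle (?f i j)" for i j
    by (intro continuous_on_integrable_circle continuous_on_mult continuous_on_const continuous_on_majorant_kernel zj)
      (cases "j = i"; auto intro!: continuous_intros)
  have prod: "(\<Prod>j\<in>UNIV. ?f i j (\<eta> $ j)) = Q (radial r \<zeta>) \<eta> * norm (\<eta> $ i - \<zeta> $ i)" for i \<eta>
  proof -
    have "(\<Prod>j\<in>UNIV. ?f i j (\<eta> $ j)) = (\<Prod>j\<in>UNIV. ?m j (\<eta> $ j)) * (\<Prod>j\<in>UNIV. if j = i then norm (\<eta> $ j - \<zeta> $ i) else 1)"
      by (rule prod.distrib)
    then show ?thesis by (simp add: torus_majorant_def)
  qed
  have coord: "integrable haar_torus (\<lambda>\<eta>. Q (radial r \<zeta>) \<eta> * norm (\<eta> $ i - \<zeta> $ i)) \<and>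
      (LINT \<eta>|haar_torus. Q (radial r \<zeta>) \<eta> * norm (\<eta> $ i - \<zeta> $ i)) \<le> K / mass i * ?E i" for i
  proof
    show "integrable haar_torus (\<lambda>\<eta>. Q (radial r \<zeta>) \<eta> * norm (\<eta> $ i - \<zeta> $ i))"
      unfolding prod[symmetric] by (rule haar_torus_prod(1)[OF fi])
    have "(LINT \<eta>|haar_torus. Q (radial r \<zeta>) \<eta> * norm (\<eta> $ i - \<zeta> $ i)) = (\<Prod>j\<in>UNIV. (LINT \<eta>|haar_circle. ?f i j \<eta>))"
      unfolding prod[symmetric] by (rule haar_torus_prod(2)[OF fi])
    also have "\<dots> \<le> (\<Prod>j\<in>UNIV. \<kappa> j * (if j = i then ?E i else mass j))"
    proof (intro prod_mono conjI Bochner_Integration.integral_nonneg)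
      fix j
      show "(LINT \<eta>|haar_circle. ?f i j \<eta>) \<le> \<kappa> j * (if j = i then ?E i else mass j)"
        using integral_majorant_kernel_dist_le[of "\<zeta> $ j" "r $ j" "?s j" \<delta>] \<zeta> r Re_sum[of j] \<delta>
          integral_majorant_kernel_le[OF zj Re_sum[of j]]
        by (auto simp: torus_def radii_def mult.assoc intro!: mult_left_mono kernel_const_nonneg)
    qed (auto intro!: mult_nonneg_nonneg kernel_const_nonneg majorant_kernel_nonneg)
    also have "\<dots> = (\<Prod>j\<in>UNIV. \<kappa> j * mass j) * (\<Prod>j\<in>UNIV. if j = i then ?E i / mass i else 1)"
      unfolding prod.distrib[symmetric] using mass_pos[of i] by (intro prod.cong) auto
    also have "\<dots> = K / mass i * ?E i" by (simp add: K_const_eq_prod)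
    finally show "(LINT \<eta>|haar_torus. Q (radial r \<zeta>) \<eta> * norm (\<eta> $ i - \<zeta> $ i)) \<le> K / mass i * ?E i" .
  qed
  have "(LINT \<eta>|haar_torus. Q (radial r \<zeta>) \<eta> * norm (\<eta> - \<zeta>)) \<le>
      (LINT \<eta>|haar_torus. (\<Sum>i\<in>UNIV. Q (radial r \<zeta>) \<eta> * norm (\<eta> $ i - \<zeta> $ i)))"
  proof (rule integral_mono)
    show "integrable haar_torus (\<lambda>\<eta>. Q (radial r \<zeta>) \<eta> * norm (\<eta> - \<zeta>))"
      by (intro integrable_Q_mult z integrable_continuous_torus continuous_intros)
    show "integrable haar_torus (\<lambda>\<eta>. \<Sum>i\<in>UNIV. Q (radial r \<zeta>) \<eta> * norm (\<eta> $ i - \<zeta> $ i))"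
      using coord by (intro Bochner_Integration.integrable_sum) auto
    fix \<eta> :: "complex ^ 'n"
    have "norm (\<eta> - \<zeta>) \<le> (\<Sum>i\<in>UNIV. norm (\<eta> $ i - \<zeta> $ i))"
      unfolding norm_vec_def using L2_set_le_sum[of UNIV "\<lambda>i. norm ((\<eta> - \<zeta>) $ i)"] by simp
    then show "Q (radial r \<zeta>) \<eta> * norm (\<eta> - \<zeta>) \<le> (\<Sum>i\<in>UNIV. Q (radial r \<zeta>) \<eta> * norm (\<eta> $ i - \<zeta> $ i))"
      unfolding sum_distrib_left[symmetric] by (intro mult_left_mono torus_majorant_nonneg)
  qed
  also have "\<dots> = (\<Sum>i\<in>UNIV. (LINT \<eta>|haar_torus. Q (radial r \<zeta>) \<eta> * norm (\<eta> $ i - \<zeta> $ i)))"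
    using coord by (intro Bochner_Integration.integral_sum) auto
  also have "\<dots> \<le> (\<Sum>i\<in>UNIV. K / mass i * ?E i)" using coord by (intro sum_mono) auto
  finally show ?thesis .
qed

abbreviation "F1 \<equiv> at (\<chi> j. (1::real)) within (radii :: (real ^ 'n) set)"

lemma eventually_in_radii: "eventually (\<lambda>r. r \<in> radii) F1"
  by (auto simp: eventually_at_filter)

lemma radius_tendsto: "((\<lambda>r. r $ j) \<longlongrightarrow> 1) F1"
proof -
  have "((\<lambda>r. r $ j) \<longlongrightarrow> (\<chi> j. (1::real)) $ j) F1" by (intro tendsto_vec_nth tendsto_ident_at)
  then show ?thesis by simp
qed

lemma square_radius_at_left: "filterlim (\<lambda>r. (r $ j)\<^sup>2) (at_left 1) F1"
proof -
  have "((\<lambda>r. (r $ j)\<^sup>2) \<longlongrightarrow> 1\<^sup>2) F1" by (intro tendsto_power radius_tendsto)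
  moreover have "eventually (\<lambda>r. (r $ j)\<^sup>2 \<in> {..<1} \<and> (r $ j)\<^sup>2 \<noteq> 1) F1"
    using eventually_in_radii
  proof eventually_elim
    case (elim r)
    then have "\<bar>r $ j\<bar> < 1" by (simp add: radii_def)
    then have "(r $ j)\<^sup>2 < 1" by (simp only: abs_square_less_1)
    then show ?case by simp
  qed
  ultimately show ?thesis by (auto simp: filterlim_at)
qed

lemma kernel_mean_prod_tendsto:
  "((\<lambda>r. \<Prod>j\<in>UNIV. kernel_mean (\<alpha> $ j) (\<beta> $ j) ((r $ j)\<^sup>2)) \<longlongrightarrow> 1) F1"
proof -
  have "((\<lambda>r. \<Prod>j\<in>UNIV. kernel_mean (\<alpha> $ j) (\<beta> $ j) ((r $ j)\<^sup>2)) \<longlongrightarrow> (\<Prod>j\<in>(UNIV :: 'n set). 1)) F1"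
    by (intro tendsto_prod filterlim_compose[OF kernel_mean_tendsto_1[OF Re_sum \<alpha>_pole \<beta>_pole] square_radius_at_left])
  then show ?thesis by simp
qed

lemma Q_concentrates:
  assumes e: "e > 0"
  shows "eventually (\<lambda>r. \<forall>\<zeta>\<in>torus. (LINT \<eta>|haar_torus. Q (radial r \<zeta>) \<eta> * norm (\<eta> - \<zeta>)) \<le> e) F1"
proof -
  \<comment> \<open>the part proportional to \<open>\<delta>\<close> of the bound for the integral adds up to \<open>e / 2\<close>\<close>
  define \<delta> where "\<delta> = e / (2 * (real CARD('n) * K))"
  have \<delta>: "\<delta> > 0" using e K_pos by (simp add: \<delta>_def)
  let ?s = "\<lambda>j. Re (\<alpha> $ j) + Re (\<beta> $ j)"
  let ?G = "\<lambda>r. \<Sum>i\<in>UNIV. K / mass i * (\<delta> * mass i + 2 * (1 - (r $ i)\<^sup>2) powr (?s i + 1) / (\<delta> / 2) powr (?s i + 2))"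
  have lim: "((\<lambda>r. (1 - (r $ i)\<^sup>2) powr (?s i + 1)) \<longlongrightarrow> (1 - 1\<^sup>2) powr (?s i + 1)) F1" for i
  proof (intro tendsto_powr2 tendsto_intros radius_tendsto)
    show "eventually (\<lambda>r. 0 \<le> 1 - (r $ i)\<^sup>2) F1"
      using eventually_in_radii by eventually_elim (auto simp: radii_def power_le_one less_imp_le)
    show "0 < ?s i + 1" using Re_sum[of i] by simp
  qed
  have "(?G \<longlongrightarrow> (\<Sum>i\<in>UNIV. K / mass i * (\<delta> * mass i + 2 * (1 - 1\<^sup>2) powr (?s i + 1) / (\<delta> / 2) powr (?s i + 2)))) F1"
    using \<delta> by (intro tendsto_sum tendsto_mult tendsto_add tendsto_divide tendsto_const lim) auto
  also have "(\<Sum>i\<in>UNIV. K / mass i * (\<delta> * mass i + 2 * (1 - 1\<^sup>2) powr (?s i + 1) / (\<delta> / 2) powr (?s i + 2))) = e / 2"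
  proof -
    have "K / mass i * (\<delta> * mass i + 2 * (1 - 1\<^sup>2) powr (?s i + 1) / (\<delta> / 2) powr (?s i + 2)) = K * \<delta>" for i
      using mass_pos[of i] by simp
    then show ?thesis using K_pos by (simp add: \<delta>_def)
  qed
  finally have G: "(?G \<longlongrightarrow> e / 2) F1" .
  have "eventually (\<lambda>r. ?G r < e) F1" using e by (intro order_tendstoD(2)[OF G]) simp
  with eventually_in_radii show ?thesis
    by eventually_elim (use integral_Q_dist_le[OF _ _ \<delta>] in \<open>force intro: order_trans less_imp_le\<close>)
qed

end


section \<open>The bound on the Lebesgue norms\<close>

text \<open>
  The graph of the convex function \<open>\<lambda>x. x powr q\<close> lies above its tangent at \<open>t\<close>; this is
  Young's inequality.
\<close>

lemma powr_tangent_le: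
  fixes x t q :: real
  assumes q: "1 \<le> q" and x: "0 \<le> x" and t: "0 \<le> t"
  shows "q * t powr (q - 1) * x \<le> x powr q + (q - 1) * t powr q"
proof (cases "q = 1")
  case True
  then show ?thesis using x by simp
next
  case False
  then have q1: "q > 1" using q by simp
  \<comment> \<open>the exponent conjugate to \<open>q\<close>\<close>
  define q' where "q' = q / (q - 1)"
  have q': "q' > 1" "1 / q + 1 / q' = 1" using q1 by (auto simp: q'_def field_simps)
  have "x * t powr (q - 1) \<le> x powr q / q + (t powr (q - 1)) powr q' / q'"
    using Youngs_inequality[OF q1 q'] x by simp
  also have "(t powr (q - 1)) powr q' = t powr q" using q1 by (simp add: powr_powr q'_def)
  finally have "q * (x * t powr (q - 1)) \<le> q * (x powr q / q + t powr q / q')"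
    using q by (intro mult_left_mono) auto
  also have "\<dots> = x powr q + (q - 1) * t powr q" using q1 by (simp add: q'_def field_simps)
  finally show ?thesis by (simp add: mult_ac)
qed

text \<open>
  Jensen's inequality for a weight of total mass at most \<open>K\<close>: integrate the tangent inequality
  at the point \<open>t\<close> that would be the mean if the mass were exactly \<open>K\<close>.
\<close>

lemma weighted_Jensen_powr:
  fixes w f :: "'a \<Rightarrow> real"
  assumes q: "1 \<le> q" and K: "K > 0" "(LINT x|M. w x) \<le> K"
    and nonneg: "\<And>x. 0 \<le> w x" "\<And>x. 0 \<le> f x"
    and int: "integrable M w" "integrable M (\<lambda>x. w x * f x)" "integrable M (\<lambda>x. w x * f x powr q)"
  shows "(LINT x|M. w x * f x) powr q \<le> K powr (q - 1) * (LINT x|M. w x * f x powr q)"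
proof -
  define t where "t = (LINT x|M. w x * f x) / K"
  have t: "t \<ge> 0" using K nonneg by (simp add: t_def)
  have "(LINT x|M. q * t powr (q - 1) * (w x * f x)) \<le> (LINT x|M. w x * f x powr q + (q - 1) * t powr q * w x)"
  proof (rule integral_mono)
    fix x
    show "q * t powr (q - 1) * (w x * f x) \<le> w x * f x powr q + (q - 1) * t powr q * w x"
      using mult_left_mono[OF powr_tangent_le[OF q nonneg(2)[of x] t] nonneg(1)[of x]] by (simp add: algebra_simps)
  qed (use int in auto)
  then have "q * t powr (q - 1) * (K * t) \<le> (LINT x|M. w x * f x powr q) + (q - 1) * t powr q * (LINT x|M. w x)"
    using int K by (simp add: t_def)
  also have "\<dots> \<le> (LINT x|M. w x * f x powr q) + (q - 1) * t powr q * K"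
    using K q by (intro add_left_mono mult_left_mono) auto
  finally have "q * (t powr (q - 1) * t) * K - (q - 1) * t powr q * K \<le> (LINT x|M. w x * f x powr q)"
    by (simp add: mult_ac)
  moreover have "t powr (q - 1) * t = t powr q"
    using t by (cases "t = 0") (auto simp: powr_diff)
  ultimately have *: "t powr q * K \<le> (LINT x|M. w x * f x powr q)"
    by (simp add: algebra_simps)
  have "(LINT x|M. w x * f x) powr q = K powr (q - 1) * (t powr q * K)"
    using K nonneg by (simp add: t_def powr_divide powr_diff)
  also have "\<dots> \<le> K powr (q - 1) * (LINT x|M. w x * f x powr q)"
    by (intro mult_left_mono *) auto
  finally show ?thesis .
qed

text \<open>
  The \<open>q\<close>-th power of the \<open>L\<^sup>q\<close> norm. For convergence to 0 and for closure under sums the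
  root is immaterial, so that the arguments below avoid it.
\<close>

definition power_integral :: "real \<Rightarrow> (complex ^ 'n::finite \<Rightarrow> complex) \<Rightarrow> ennreal" where
  "power_integral q f = (\<integral>\<^sup>+ \<zeta>. ennreal (norm (f \<zeta>) powr q) \<partial>haar_torus)"

lemma power_integral_cong:
  "(\<And>\<zeta>. \<zeta> \<in> torus \<Longrightarrow> f \<zeta> = g \<zeta>) \<Longrightarrow> power_integral q f = power_integral q g"
  unfolding power_integral_def by (intro nn_integral_cong) auto

lemma power_integral_cmult:
  assumes [measurable]: "f \<in> borel_measurable haar_torus"
  shows "power_integral q (\<lambda>\<zeta>. c * f \<zeta>) = ennreal (norm c powr q) * power_integral q f"
  unfolding power_integral_def
  by (subst nn_integral_cmult[symmetric]) (simp_all add: norm_mult powr_mult ennreal_mult')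

lemma power_integral_le_const:
  fixes f :: "complex ^ 'n::finite \<Rightarrow> complex"
  assumes "0 \<le> q" "\<And>\<zeta>. \<zeta> \<in> torus \<Longrightarrow> norm (f \<zeta>) \<le> B"
  shows "power_integral q f \<le> ennreal (B powr q)"
proof -
  interpret prob_space "haar_torus :: (complex ^ 'n) measure" by (rule prob_space_haar_torus)
  have "power_integral q f \<le> (\<integral>\<^sup>+ \<zeta>. ennreal (B powr q) \<partial>(haar_torus :: (complex ^ 'n) measure))"
    unfolding power_integral_def using assms by (intro nn_integral_mono ennreal_leI powr_mono2) auto
  then show ?thesis using emeasure_space_1 by simp
qed

lemma power_integral_add:
  assumes q: "0 \<le> q" and [measurable]: "f \<in> borel_measurable haar_torus" "g \<in> borel_measurable haar_torus"
  shows "power_integral q (\<lambda>\<zeta>. f \<zeta> + g \<zeta>) \<le> ennreal (2 powr q) * (power_integral q f + power_integral q g)"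
proof -
  have *: "norm (x + y) powr q \<le> 2 powr q * (norm x powr q + norm y powr q)" for x y :: complex
  proof -
    have "norm (x + y) \<le> 2 * max (norm x) (norm y)" using norm_triangle_ineq[of x y] by (auto simp: max_def)
    then have "norm (x + y) powr q \<le> (2 * max (norm x) (norm y)) powr q" using q by (intro powr_mono2) auto
    also have "\<dots> = 2 powr q * max (norm x) (norm y) powr q" by (simp add: powr_mult)
    also have "\<dots> \<le> 2 powr q * (norm x powr q + norm y powr q)" by (intro mult_left_mono) (auto simp: max_def)
    finally show ?thesis .
  qed
  have "power_integral q (\<lambda>\<zeta>. f \<zeta> + g \<zeta>) \<le> (\<integral>\<^sup>+ \<zeta>. ennreal (2 powr q) * (ennreal (norm (f \<zeta>) powr q) + ennreal (norm (g \<zeta>) powr q)) \<partial>haar_torus)"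
    unfolding power_integral_def
    using * by (intro nn_integral_mono) (simp add: ennreal_leI flip: ennreal_plus ennreal_mult')
  also have "\<dots> = ennreal (2 powr q) * (power_integral q f + power_integral q g)"
    unfolding power_integral_def by (subst nn_integral_cmult) (simp_all add: nn_integral_add)
  finally show ?thesis .
qed

lemma tendsto_0_ennrealI:
  assumes "\<And>e::real. e > 0 \<Longrightarrow> eventually (\<lambda>x. f x \<le> ennreal e) F"
  shows "(f \<longlongrightarrow> (0::ennreal)) F"
proof (rule order_tendstoI)
  fix a :: ennreal assume a: "0 < a"
  then obtain e :: real where e: "e > 0" "ennreal e < a"
  proof (cases a)
    case (real x)
    then show ?thesis using a that[of "x / 2"] by (auto simp: ennreal_less_iff)
  next
    case top
    then show ?thesis using that[of 1] by simp
  qed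
  from assms[OF e(1)] show "eventually (\<lambda>x. f x < a) F"
    by eventually_elim (use e in \<open>auto intro: le_less_trans\<close>)
qed simp

lemma ennreal_small_multiple:
  assumes "(C::ennreal) < \<infinity>" "e > (0::real)"
  obtains d :: real where "d > 0" "C * ennreal d \<le> ennreal e"
proof (cases C)
  case (real c)
  have "C * ennreal (e / (c + 1)) = ennreal (e * (c / (c + 1)))"
    using real assms by (simp add: ennreal_mult'[symmetric])
  also have "\<dots> \<le> ennreal (e * 1)" using real assms by (intro ennreal_leI mult_left_mono) auto
  finally show ?thesis using that[of "e / (c + 1)"] real assms by auto
qed (use assms in auto)

lemma power_integral_finite_integrable:
  fixes f :: "complex ^ 'n::finite \<Rightarrow> complex"
  assumes [measurable]: "f \<in> borel_measurable haar_torus" and fin: "power_integral q f < \<infinity>"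
  shows "integrable haar_torus (\<lambda>\<zeta>. norm (f \<zeta>) powr q)" "1 \<le> q \<Longrightarrow> integrable haar_torus f"
proof -
  interpret prob_space "haar_torus :: (complex ^ 'n) measure" by (rule prob_space_haar_torus)
  show i: "integrable haar_torus (\<lambda>\<zeta>. norm (f \<zeta>) powr q)"
    using fin by (intro integrableI_nonneg) (auto simp: power_integral_def)
  show "integrable haar_torus f" if q: "1 \<le> q"
  proof (rule Bochner_Integration.integrable_bound)
    show "integrable haar_torus (\<lambda>\<zeta>. 1 + norm (f \<zeta>) powr q)" using i by simp
    show "AE \<zeta> in haar_torus. norm (f \<zeta>) \<le> norm (1 + norm (f \<zeta>) powr q)"
    proof (rule AE_I2)
      fix \<zeta> :: "complex ^ 'n"
      have "norm (f \<zeta>) \<le> 1 + norm (f \<zeta>) powr q"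
      proof (cases "norm (f \<zeta>) \<le> 1")
        case True
        then show ?thesis by (simp add: add_increasing2)
      next
        case False
        then have "norm (f \<zeta>) powr 1 \<le> norm (f \<zeta>) powr q" using q by (intro powr_mono) auto
        then show ?thesis by simp
      qed
      then show "norm (f \<zeta>) \<le> norm (1 + norm (f \<zeta>) powr q)" by simp
    qed
  qed simp
qed

context poisson_parameters begin

abbreviation "T \<equiv> poisson_integral \<alpha> \<beta>"

text \<open>
  The Schur test. Jensen's inequality bounds the \<open>q\<close>-th power of the Poisson integral by
  \<open>K powr (q - 1)\<close> times the integral of \<open>|f| powr q\<close> against the majorant. Integrating over
  the torus and exchanging the integrals, the symmetry of the majorant yields one more factor
  \<open>K\<close>.
\<close>

lemma power_integral_poisson_le:
  assumes q: "1 \<le> q" and m [measurable]: "f \<in> borel_measurable haar_torus"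
    and fin: "power_integral q f < \<infinity>" and r: "r \<in> radii"
  shows "power_integral q (dilate (T f) r) \<le> ennreal (K powr q) * power_integral q f"
proof -
  let ?H = "haar_torus :: (complex ^ 'n) measure"
  interpret prob_space ?H by (rule prob_space_haar_torus)
  interpret P: pair_sigma_finite ?H ?H by unfold_locales
  note fi = power_integral_finite_integrable[OF m fin]
  have [measurable]: "(\<lambda>x. Q (radial r (fst x)) (snd x)) \<in> borel_measurable (?H \<Otimes>\<^sub>M ?H)"
    by (rule measurable_torus_majorant)
  let ?g = "\<lambda>\<zeta> \<eta>. ennreal (Q (radial r \<zeta>) \<eta> * norm (f \<eta>) powr q)"
  have g: "(\<lambda>x. ?g (fst x) (snd x)) \<in> borel_measurable (?H \<Otimes>\<^sub>M ?H)" by measurable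
  have pw: "ennreal (norm (dilate (T f) r \<zeta>) powr q) \<le> ennreal (K powr (q - 1)) * (\<integral>\<^sup>+ \<eta>. ?g \<zeta> \<eta> \<partial>?H)"
    if \<zeta>: "\<zeta> \<in> torus" for \<zeta>
  proof -
    note z = radial_in_polydisc[OF r \<zeta>]
    have iq: "integrable ?H (\<lambda>\<eta>. Q (radial r \<zeta>) \<eta> * norm (f \<eta>) powr q)" by (rule integrable_Q_mult[OF z fi(1)])
    have "norm (dilate (T f) r \<zeta>) powr q \<le> (LINT \<eta>|?H. Q (radial r \<zeta>) \<eta> * norm (f \<eta>)) powr q"
      unfolding dilate_def using q fi(2) by (intro powr_mono2 norm_poisson_integral_le z) auto
    also have "\<dots> \<le> K powr (q - 1) * (LINT \<eta>|?H. Q (radial r \<zeta>) \<eta> * norm (f \<eta>) powr q)"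
      by (intro weighted_Jensen_powr q K_pos integral_Q_le integrable_Q iq integrable_Q_mult integrable_norm fi z
          torus_majorant_nonneg norm_ge_zero)
    finally have "ennreal (norm (dilate (T f) r \<zeta>) powr q) \<le> ennreal (K powr (q - 1) * (LINT \<eta>|?H. Q (radial r \<zeta>) \<eta> * norm (f \<eta>) powr q))"
      by (rule ennreal_leI)
    also have "\<dots> = ennreal (K powr (q - 1)) * (\<integral>\<^sup>+ \<eta>. ?g \<zeta> \<eta> \<partial>?H)"
      using iq by (subst nn_integral_eq_integral) (auto simp: ennreal_mult' intro!: mult_nonneg_nonneg torus_majorant_nonneg)
    finally show ?thesis .
  qed
  have inner: "(\<integral>\<^sup>+ \<zeta>. ?g \<zeta> \<eta> \<partial>?H) \<le> ennreal K * ennreal (norm (f \<eta>) powr q)" if \<eta>: "\<eta> \<in> torus" for \<eta>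
  proof -
    note z = radial_in_polydisc[OF r \<eta>]
    have [measurable]: "Q (radial r \<eta>) \<in> borel_measurable ?H" using integrable_Q[OF z] by auto
    have "(\<integral>\<^sup>+ \<zeta>. ?g \<zeta> \<eta> \<partial>?H) = (\<integral>\<^sup>+ \<zeta>. ennreal (norm (f \<eta>) powr q) * ennreal (Q (radial r \<eta>) \<zeta>) \<partial>?H)"
    proof (intro nn_integral_cong)
      fix \<zeta> :: "complex ^ 'n" assume "\<zeta> \<in> space ?H"
      then have "Q (radial r \<zeta>) \<eta> = Q (radial r \<eta>) \<zeta>" by (intro torus_majorant_commute \<eta>) simp
      then show "?g \<zeta> \<eta> = ennreal (norm (f \<eta>) powr q) * ennreal (Q (radial r \<eta>) \<zeta>)"
        by (simp only: mult.commute[of "Q (radial r \<eta>) \<zeta>"] ennreal_mult'[OF powr_ge_zero])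
    qed
    also have "\<dots> = ennreal (norm (f \<eta>) powr q) * (\<integral>\<^sup>+ \<zeta>. ennreal (Q (radial r \<eta>) \<zeta>) \<partial>?H)"
      by (rule nn_integral_cmult) simp
    also have "(\<integral>\<^sup>+ \<zeta>. ennreal (Q (radial r \<eta>) \<zeta>) \<partial>?H) = ennreal (LINT \<zeta>|?H. Q (radial r \<eta>) \<zeta>)"
      by (intro nn_integral_eq_integral integrable_Q z AE_I2 torus_majorant_nonneg)
    finally have "(\<integral>\<^sup>+ \<zeta>. ?g \<zeta> \<eta> \<partial>?H) = ennreal (LINT \<zeta>|?H. Q (radial r \<eta>) \<zeta>) * ennreal (norm (f \<eta>) powr q)"
      by (simp only: mult.commute)
    also have "\<dots> \<le> ennreal K * ennreal (norm (f \<eta>) powr q)"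
      by (intro mult_right_mono ennreal_leI integral_Q_le z) simp
    finally show ?thesis .
  qed
  have "power_integral q (dilate (T f) r) \<le> (\<integral>\<^sup>+ \<zeta>. ennreal (K powr (q - 1)) * (\<integral>\<^sup>+ \<eta>. ?g \<zeta> \<eta> \<partial>?H) \<partial>?H)"
    unfolding power_integral_def using pw by (intro nn_integral_mono) auto
  also have "\<dots> = ennreal (K powr (q - 1)) * (\<integral>\<^sup>+ \<zeta>. (\<integral>\<^sup>+ \<eta>. ?g \<zeta> \<eta> \<partial>?H) \<partial>?H)"
    by (rule nn_integral_cmult) measurable
  also have "(\<integral>\<^sup>+ \<zeta>. (\<integral>\<^sup>+ \<eta>. ?g \<zeta> \<eta> \<partial>?H) \<partial>?H) = (\<integral>\<^sup>+ \<eta>. (\<integral>\<^sup>+ \<zeta>. ?g \<zeta> \<eta> \<partial>?H) \<partial>?H)"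
    using P.Fubini[of "\<lambda>x. ?g (fst x) (snd x)"] g by simp
  also have "\<dots> \<le> (\<integral>\<^sup>+ \<eta>. ennreal K * ennreal (norm (f \<eta>) powr q) \<partial>?H)"
    using inner by (intro nn_integral_mono) auto
  also have "\<dots> = ennreal K * power_integral q f" unfolding power_integral_def by (rule nn_integral_cmult) simp
  finally have "power_integral q (dilate (T f) r) \<le> ennreal (K powr (q - 1)) * (ennreal K * power_integral q f)"
    by (simp add: mult_left_mono)
  also have "\<dots> = ennreal (K powr (q - 1) * K) * power_integral q f" by (simp add: ennreal_mult' mult.assoc)
  also have "K powr (q - 1) * K = K powr q" using K_pos by (simp add: powr_diff)
  finally show ?thesis .
qed

lemma poisson_integral_bounded:
  assumes m [measurable]: "f \<in> borel_measurable haar_torus" and E: "AE \<zeta> in haar_torus. norm (f \<zeta>) \<le> E" "0 \<le> E"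
    and z: "z \<in> polydisc"
  shows "norm (T f z) \<le> K * E"
proof -
  interpret prob_space "haar_torus :: (complex ^ 'n) measure" by (rule prob_space_haar_torus)
  have fi: "integrable haar_torus f" using E by (intro integrable_const_bound[of _ E]) auto
  have "norm (T f z) \<le> (LINT \<eta>|haar_torus. Q z \<eta> * norm (f \<eta>))" by (rule norm_poisson_integral_le[OF z fi])
  also have "\<dots> \<le> (LINT \<eta>|haar_torus. Q z \<eta> * E)"
    using E by (intro integral_mono_AE integrable_Q_mult z integrable_norm fi) (auto intro!: mult_left_mono torus_majorant_nonneg)
  also have "\<dots> = (LINT \<eta>|haar_torus. Q z \<eta>) * E" by simp
  also have "\<dots> \<le> K * E" by (intro mult_right_mono integral_Q_le z E)
  finally show ?thesis .
qed

lemma measurable_dilate: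
  assumes f: "integrable haar_torus f" and r: "r \<in> radii"
  shows "dilate (T f) r \<in> borel_measurable haar_torus"
proof (rule continuous_on_measurable_torus)
  have "continuous_on polydisc (kernel_op (poisson_kernel \<alpha> \<beta>) f)"
    using C1_kernel_on_poisson_kernel[of \<alpha> \<beta>] by (intro continuous_on_kernel_op f) (auto simp: C1_kernel_on_def)
  moreover have "kernel_op (poisson_kernel \<alpha> \<beta>) f = T f" by (simp add: fun_eq_iff kernel_op_def poisson_integral_def)
  moreover have "continuous_on torus (radial r)"
    unfolding continuous_on_def by (intro ballI vec_tendstoI) (auto intro!: tendsto_intros)
  moreover have "radial r ` torus \<subseteq> polydisc"
    using radial_in_polydisc[OF r] by (rule image_subsetI)
  ultimately have "continuous_on torus (\<lambda>\<zeta>. T f (radial r \<zeta>))"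
    by (simp only: continuous_on_compose2[of polydisc "T f"])
  then show "continuous_on torus (dilate (T f) r)" by (simp add: dilate_def[abs_def])
qed

section \<open>Radial convergence in the Lebesgue norms\<close>

definition converges_in_power :: "real \<Rightarrow> (complex ^ 'n \<Rightarrow> complex) \<Rightarrow> bool" where
  "converges_in_power q f \<longleftrightarrow> f \<in> borel_measurable haar_torus \<and> power_integral q f < \<infinity> \<and>
     ((\<lambda>r. power_integral q (\<lambda>\<zeta>. dilate (T f) r \<zeta> - f \<zeta>)) \<longlongrightarrow> 0) F1"

lemma dilate_add:
  assumes "integrable haar_torus f" "integrable haar_torus g" "r \<in> radii" "\<zeta> \<in> torus"
  shows "dilate (T (\<lambda>\<zeta>. f \<zeta> + g \<zeta>)) r \<zeta> = dilate (T f) r \<zeta> + dilate (T g) r \<zeta>"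
  using integrable_poisson_kernel[OF radial_in_polydisc] assms
  by (simp add: dilate_def poisson_integral_def distrib_left)

lemma dilate_cmult: "dilate (T (\<lambda>\<zeta>. c * f \<zeta>)) r \<zeta> = c * dilate (T f) r \<zeta>"
  by (simp add: dilate_def poisson_integral_def mult.left_commute)

lemma poisson_integral_cong:
  assumes "\<And>\<zeta>. \<zeta> \<in> torus \<Longrightarrow> f \<zeta> = g \<zeta>"
  shows "T f = T g"
  unfolding fun_eq_iff poisson_integral_def using assms by (auto intro!: Bochner_Integration.integral_cong)

lemma converges_in_power_cong:
  assumes "converges_in_power q f" "\<And>\<zeta>. \<zeta> \<in> torus \<Longrightarrow> f \<zeta> = g \<zeta>"
  shows "converges_in_power q g"
proof -
  have "power_integral q (\<lambda>\<zeta>. dilate (T f) r \<zeta> - f \<zeta>) = power_integral q (\<lambda>\<zeta>. dilate (T g) r \<zeta> - g \<zeta>)" for r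
    using assms(2) poisson_integral_cong[OF assms(2)] by (intro power_integral_cong) auto
  moreover have "g \<in> borel_measurable haar_torus \<longleftrightarrow> f \<in> borel_measurable haar_torus"
    using assms(2) by (intro measurable_cong) auto
  moreover have "power_integral q g = power_integral q f" using assms(2) by (intro power_integral_cong) auto
  ultimately show ?thesis using assms(1) by (simp add: converges_in_power_def)
qed

lemma converges_in_power_cmult:
  assumes q: "1 \<le> q" and f: "converges_in_power q f"
  shows "converges_in_power q (\<lambda>\<zeta>. c * f \<zeta>)"
proof -
  have m [measurable]: "f \<in> borel_measurable haar_torus" and fin: "power_integral q f < \<infinity>"
    and lim: "((\<lambda>r. power_integral q (\<lambda>\<zeta>. dilate (T f) r \<zeta> - f \<zeta>)) \<longlongrightarrow> 0) F1"
    using f by (auto simp: converges_in_power_def)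
  have fi: "integrable haar_torus f" by (rule power_integral_finite_integrable(2)[OF m fin q])
  have "eventually (\<lambda>r. ennreal (norm c powr q) * power_integral q (\<lambda>\<zeta>. dilate (T f) r \<zeta> - f \<zeta>)
      = power_integral q (\<lambda>\<zeta>. dilate (T (\<lambda>\<zeta>. c * f \<zeta>)) r \<zeta> - c * f \<zeta>)) F1"
    using eventually_in_radii
  proof eventually_elim
    case (elim r)
    then have "(\<lambda>\<zeta>. dilate (T f) r \<zeta> - f \<zeta>) \<in> borel_measurable haar_torus"
      using measurable_dilate[OF fi] m by (intro borel_measurable_diff) auto
    from power_integral_cmult[OF this, of q c] show ?case by (simp add: dilate_cmult right_diff_distrib)
  qed
  moreover have "((\<lambda>r. ennreal (norm c powr q) * power_integral q (\<lambda>\<zeta>. dilate (T f) r \<zeta> - f \<zeta>)) \<longlongrightarrow> ennreal (norm c powr q) * 0) F1"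
    by (intro ennreal_tendsto_cmult lim) simp
  ultimately have "((\<lambda>r. power_integral q (\<lambda>\<zeta>. dilate (T (\<lambda>\<zeta>. c * f \<zeta>)) r \<zeta> - c * f \<zeta>)) \<longlongrightarrow> 0) F1"
    by (simp add: tendsto_cong)
  moreover have "power_integral q (\<lambda>\<zeta>. c * f \<zeta>) < \<infinity>"
    using fin by (simp add: power_integral_cmult ennreal_mult_less_top)
  ultimately show ?thesis by (simp add: converges_in_power_def)
qed

text \<open>
  Functions with the convergence property form a closed set: in
  \<open>T f - f = T (f - g) + (T g - g) + (g - f)\<close> the first and the last term are small by the uniform
  bound on \<open>T\<close> and by the choice of \<open>g\<close>, and the middle one tends to 0.
\<close>

lemma converges_in_power_approx:
  assumes q: "1 \<le> q" and m [measurable]: "f \<in> borel_measurable haar_torus" and fin: "power_integral q f < \<infinity>"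
    and approx: "\<And>e::real. e > 0 \<Longrightarrow> \<exists>g. converges_in_power q g \<and> power_integral q (\<lambda>\<zeta>. f \<zeta> - g \<zeta>) \<le> ennreal e"
  shows "converges_in_power q f"
  unfolding converges_in_power_def
proof (intro conjI m fin tendsto_0_ennrealI)
  fix e :: real assume e: "e > 0"
  let ?D = "ennreal (2 powr q)"
  \<comment> \<open>collects the constants of two applications of the quasi-triangle inequality\<close>
  define C where "C = ?D * (ennreal (K powr q) + ?D * (1 + 1))"
  have "C = ennreal (2 powr q * (K powr q + 2 powr q * 2))"
    by (simp add: C_def ennreal_mult' ennreal_plus)
  then have "C < \<infinity>" by simp
  from ennreal_small_multiple[OF this e] obtain d :: real where d: "d > 0" "C * ennreal d \<le> ennreal e" .
  obtain g where g: "converges_in_power q g" "power_integral q (\<lambda>\<zeta>. f \<zeta> - g \<zeta>) \<le> ennreal d" using approx[OF d(1)] by blast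
  have gm [measurable]: "g \<in> borel_measurable haar_torus" and gfin: "power_integral q g < \<infinity>"
    and lim: "((\<lambda>r. power_integral q (\<lambda>\<zeta>. dilate (T g) r \<zeta> - g \<zeta>)) \<longlongrightarrow> 0) F1"
    using g by (auto simp: converges_in_power_def)
  have hm [measurable]: "(\<lambda>\<zeta>. f \<zeta> - g \<zeta>) \<in> borel_measurable haar_torus" by measurable
  have hfin: "power_integral q (\<lambda>\<zeta>. f \<zeta> - g \<zeta>) < \<infinity>" using g(2) by (auto intro: le_less_trans)
  have gi: "integrable haar_torus g" and hi: "integrable haar_torus (\<lambda>\<zeta>. f \<zeta> - g \<zeta>)"
    by (rule power_integral_finite_integrable(2)[OF _ _ q]; fact)+
  have "eventually (\<lambda>r. power_integral q (\<lambda>\<zeta>. dilate (T g) r \<zeta> - g \<zeta>) < ennreal d) F1"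
    using lim d(1) by (intro order_tendstoD(2)) auto
  with eventually_in_radii
  show "eventually (\<lambda>r. power_integral q (\<lambda>\<zeta>. dilate (T f) r \<zeta> - f \<zeta>) \<le> ennreal e) F1"
  proof eventually_elim
    case (elim r)
    note [measurable] = measurable_dilate[OF gi elim(1)] measurable_dilate[OF hi elim(1)]
    have "power_integral q (\<lambda>\<zeta>. dilate (T f) r \<zeta> - f \<zeta>) =
        power_integral q (\<lambda>\<zeta>. dilate (T (\<lambda>\<zeta>. f \<zeta> - g \<zeta>)) r \<zeta> + ((dilate (T g) r \<zeta> - g \<zeta>) + (-1) * (f \<zeta> - g \<zeta>)))"
      using dilate_add[OF hi gi elim(1)] by (intro power_integral_cong) simp
    also have "\<dots> \<le> ?D * (power_integral q (dilate (T (\<lambda>\<zeta>. f \<zeta> - g \<zeta>)) r) +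
         power_integral q (\<lambda>\<zeta>. (dilate (T g) r \<zeta> - g \<zeta>) + (-1) * (f \<zeta> - g \<zeta>)))"
      using q by (intro power_integral_add) auto
    also have "\<dots> \<le> ?D * (ennreal (K powr q) * ennreal d + ?D * (ennreal d + ennreal d))"
    proof (intro mult_left_mono add_mono)
      show "power_integral q (dilate (T (\<lambda>\<zeta>. f \<zeta> - g \<zeta>)) r) \<le> ennreal (K powr q) * ennreal d"
        by (rule order_trans[OF power_integral_poisson_le[OF q hm hfin elim(1)] mult_left_mono[OF g(2)]]) simp
      have "power_integral q (\<lambda>\<zeta>. (dilate (T g) r \<zeta> - g \<zeta>) + (-1) * (f \<zeta> - g \<zeta>)) \<le>
        ?D * (power_integral q (\<lambda>\<zeta>. dilate (T g) r \<zeta> - g \<zeta>) + power_integral q (\<lambda>\<zeta>. (-1) * (f \<zeta> - g \<zeta>)))"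
        using q by (intro power_integral_add) auto
      also have "power_integral q (\<lambda>\<zeta>. (-1) * (f \<zeta> - g \<zeta>)) = power_integral q (\<lambda>\<zeta>. f \<zeta> - g \<zeta>)"
        by (subst power_integral_cmult[OF hm]) simp
      also have "?D * (power_integral q (\<lambda>\<zeta>. dilate (T g) r \<zeta> - g \<zeta>) + \<dots>) \<le> ?D * (ennreal d + ennreal d)"
        using elim(2) g(2) by (intro mult_left_mono add_mono) auto
      finally show "power_integral q (\<lambda>\<zeta>. (dilate (T g) r \<zeta> - g \<zeta>) + (-1) * (f \<zeta> - g \<zeta>)) \<le> ?D * (ennreal d + ennreal d)" .
    qed auto
    also have "\<dots> = C * ennreal d"
      by (simp only: C_def distrib_left distrib_right mult_1_left mult_1_right mult.assoc)
    also have "\<dots> \<le> ennreal e" by (rule d)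
    finally show ?case .
  qed
qed

lemma converges_in_power_add:
  assumes q: "1 \<le> q" and f: "converges_in_power q f" and g: "converges_in_power q g"
  shows "converges_in_power q (\<lambda>\<zeta>. f \<zeta> + g \<zeta>)"
proof -
  have fm [measurable]: "f \<in> borel_measurable haar_torus" and ff: "power_integral q f < \<infinity>"
    and fl: "((\<lambda>r. power_integral q (\<lambda>\<zeta>. dilate (T f) r \<zeta> - f \<zeta>)) \<longlongrightarrow> 0) F1"
    using f by (auto simp: converges_in_power_def)
  have gm [measurable]: "g \<in> borel_measurable haar_torus" and gf: "power_integral q g < \<infinity>"
    and gl: "((\<lambda>r. power_integral q (\<lambda>\<zeta>. dilate (T g) r \<zeta> - g \<zeta>)) \<longlongrightarrow> 0) F1"
    using g by (auto simp: converges_in_power_def)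
  have fi: "integrable haar_torus f" and gi: "integrable haar_torus g"
    by (rule power_integral_finite_integrable(2)[OF _ _ q]; fact)+
  let ?B = "\<lambda>r. ennreal (2 powr q) * (power_integral q (\<lambda>\<zeta>. dilate (T f) r \<zeta> - f \<zeta>) + power_integral q (\<lambda>\<zeta>. dilate (T g) r \<zeta> - g \<zeta>))"
  have B: "(?B \<longlongrightarrow> ennreal (2 powr q) * (0 + 0)) F1"
    by (intro ennreal_tendsto_cmult tendsto_add fl gl) simp
  have "((\<lambda>r. power_integral q (\<lambda>\<zeta>. dilate (T (\<lambda>\<zeta>. f \<zeta> + g \<zeta>)) r \<zeta> - (f \<zeta> + g \<zeta>))) \<longlongrightarrow> 0) F1"
  proof (rule tendsto_sandwich[OF _ _ tendsto_const])
    show "(?B \<longlongrightarrow> 0) F1" using B by simp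
    show "eventually (\<lambda>r. power_integral q (\<lambda>\<zeta>. dilate (T (\<lambda>\<zeta>. f \<zeta> + g \<zeta>)) r \<zeta> - (f \<zeta> + g \<zeta>)) \<le> ?B r) F1"
      using eventually_in_radii
    proof eventually_elim
      case (elim r)
      note [measurable] = measurable_dilate[OF fi elim] measurable_dilate[OF gi elim]
      have "power_integral q (\<lambda>\<zeta>. dilate (T (\<lambda>\<zeta>. f \<zeta> + g \<zeta>)) r \<zeta> - (f \<zeta> + g \<zeta>)) =
         power_integral q (\<lambda>\<zeta>. (dilate (T f) r \<zeta> - f \<zeta>) + (dilate (T g) r \<zeta> - g \<zeta>))"
        using dilate_add[OF fi gi elim] by (intro power_integral_cong) simp
      also have "\<dots> \<le> ?B r" using q by (intro power_integral_add) auto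
      finally show ?case .
    qed
  qed simp
  moreover have "power_integral q (\<lambda>\<zeta>. f \<zeta> + g \<zeta>) < \<infinity>"
    using q ff gf by (intro le_less_trans[OF power_integral_add]) (auto simp: ennreal_mult_less_top)
  ultimately show ?thesis by (simp add: converges_in_power_def)
qed

text \<open>
  Here the convergence is even uniform. Writing \<open>T f - f\<close> as the integral of the kernel against
  \<open>f \<eta> - f \<zeta>\<close> plus \<open>f \<zeta>\<close> times the deviation of the kernel mean from 1, the first
  part is small by concentration of the majorant and the second by the limit of the kernel mean.
\<close>

lemma converges_in_power_lipschitz:
  assumes q: "1 \<le> q" and L: "0 \<le> L" "\<And>\<zeta> \<eta>. norm (f \<zeta> - f \<eta>) \<le> L * norm (\<zeta> - \<eta>)"
  shows "converges_in_power q f"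
proof -
  have "continuous_on UNIV f"
    using L by (intro lipschitz_on_continuous_on[of L] lipschitz_onI) (auto simp: dist_norm)
  then have c: "continuous_on torus f" by (rule continuous_on_subset) simp
  obtain B where B: "B \<ge> 0" "\<And>\<zeta>. \<zeta> \<in> torus \<Longrightarrow> norm (f \<zeta>) \<le> B" using continuous_on_torus_bounded[OF c] by blast
  note fi = integrable_continuous_torus[OF c]
  let ?\<Phi> = "\<lambda>r. \<Prod>j\<in>UNIV. kernel_mean (\<alpha> $ j) (\<beta> $ j) ((r $ j)\<^sup>2)"
  have "((\<lambda>r. power_integral q (\<lambda>\<zeta>. dilate (T f) r \<zeta> - f \<zeta>)) \<longlongrightarrow> 0) F1"
  proof (rule tendsto_0_ennrealI)
    fix e :: real assume e: "e > 0"
    \<comment> \<open>a uniform bound by \<open>d \<le> 1\<close> gives the bound \<open>d powr q \<le> d\<close> for the power integral\<close>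
    define d where "d = min e 1"
    have d: "d > 0" "d \<le> 1" "d \<le> e" using e by (auto simp: d_def)
    have 1: "d / (2 * (L + 1)) > 0" "d / (2 * (B + 1)) > 0" using d L B by auto
    from tendstoD[OF kernel_mean_prod_tendsto 1(2)] Q_concentrates[OF 1(1)] eventually_in_radii
    show "eventually (\<lambda>r. power_integral q (\<lambda>\<zeta>. dilate (T f) r \<zeta> - f \<zeta>) \<le> ennreal e) F1"
    proof eventually_elim
      case (elim r)
      have "norm (dilate (T f) r \<zeta> - f \<zeta>) \<le> d" if \<zeta>: "\<zeta> \<in> torus" for \<zeta>
      proof -
        note z = radial_in_polydisc[OF elim(3) \<zeta>]
        let ?P = "poisson_kernel \<alpha> \<beta> (radial r \<zeta>)"
        have nz: "(norm (radial r \<zeta> $ j))\<^sup>2 = (r $ j)\<^sup>2" for j using \<zeta> by (simp add: norm_mult torus_def power2_eq_square)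
        have Pi: "integrable haar_torus (\<lambda>\<eta>. ?P \<eta> * h \<eta>)" if "integrable haar_torus h" for h
          by (rule integrable_poisson_kernel[OF z that])
        have mean: "(LINT \<eta>|haar_torus. ?P \<eta> * f \<zeta>) = ?\<Phi> r * f \<zeta>"
          using integral_poisson_kernel[OF z] unfolding nz by simp
        have split: "dilate (T f) r \<zeta> - f \<zeta> = (LINT \<eta>|haar_torus. ?P \<eta> * (f \<eta> - f \<zeta>)) + (?\<Phi> r - 1) * f \<zeta>"
        proof -
          have "(LINT \<eta>|haar_torus. ?P \<eta> * (f \<eta> - f \<zeta>)) = (LINT \<eta>|haar_torus. ?P \<eta> * f \<eta>) - (LINT \<eta>|haar_torus. ?P \<eta> * f \<zeta>)"
            unfolding right_diff_distrib
            by (rule Bochner_Integration.integral_diff[OF Pi[OF fi] Pi[OF integrable_continuous_torus[OF continuous_on_const]]])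
          then show ?thesis unfolding mean by (simp add: dilate_def poisson_integral_def left_diff_distrib)
        qed
        have "norm (LINT \<eta>|haar_torus. ?P \<eta> * (f \<eta> - f \<zeta>)) \<le> (LINT \<eta>|haar_torus. L * (Q (radial r \<zeta>) \<eta> * norm (\<eta> - \<zeta>)))"
        proof (intro order_trans[OF integral_norm_bound] integral_mono)
          show "integrable haar_torus (\<lambda>\<eta>. norm (?P \<eta> * (f \<eta> - f \<zeta>)))"
            by (intro integrable_norm Pi integrable_continuous_torus continuous_intros c)
          show "integrable haar_torus (\<lambda>\<eta>. L * (Q (radial r \<zeta>) \<eta> * norm (\<eta> - \<zeta>)))"
            by (intro integrable_mult_right integrable_Q_mult z integrable_continuous_torus continuous_intros)
          fix \<eta> :: "complex ^ 'n" assume "\<eta> \<in> space haar_torus"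
          then have "norm (?P \<eta>) * norm (f \<eta> - f \<zeta>) \<le> Q (radial r \<zeta>) \<eta> * (L * norm (\<eta> - \<zeta>))"
            by (intro mult_mono norm_poisson_kernel_le z L torus_majorant_nonneg) auto
          then show "norm (?P \<eta> * (f \<eta> - f \<zeta>)) \<le> L * (Q (radial r \<zeta>) \<eta> * norm (\<eta> - \<zeta>))"
            by (simp add: norm_mult mult_ac)
        qed
        also have "\<dots> = L * (LINT \<eta>|haar_torus. Q (radial r \<zeta>) \<eta> * norm (\<eta> - \<zeta>))" by simp
        also have "\<dots> \<le> L * (d / (2 * (L + 1)))" using elim(2) \<zeta> L by (intro mult_left_mono) auto
        also have "\<dots> = d / 2 * (L / (L + 1))" by simp
        also have "\<dots> \<le> d / 2 * 1" using L d by (intro mult_left_mono) auto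
        finally have I1: "norm (LINT \<eta>|haar_torus. ?P \<eta> * (f \<eta> - f \<zeta>)) \<le> d / 2" by simp
        have "norm ((?\<Phi> r - 1) * f \<zeta>) \<le> d / (2 * (B + 1)) * B"
          unfolding norm_mult using elim(1) B \<zeta> 1(2) by (intro mult_mono) (auto simp: dist_norm)
        also have "\<dots> = d / 2 * (B / (B + 1))" by simp
        also have "\<dots> \<le> d / 2 * 1" using B d by (intro mult_left_mono) auto
        finally have "norm ((?\<Phi> r - 1) * f \<zeta>) \<le> d / 2" by simp
        from norm_triangle_le[OF add_mono[OF I1 this]] show ?thesis unfolding split by simp
      qed
      then have "power_integral q (\<lambda>\<zeta>. dilate (T f) r \<zeta> - f \<zeta>) \<le> ennreal (d powr q)"
        using q by (intro power_integral_le_const) auto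
      also have "d powr q \<le> d powr 1" using d q by (intro powr_mono') auto
      then have "ennreal (d powr q) \<le> ennreal e" using d by (intro ennreal_leI) auto
      finally show ?case .
    qed
  qed
  moreover have "power_integral q f < \<infinity>"
    using q B by (intro le_less_trans[OF power_integral_le_const[of q f B]]) auto
  ultimately show ?thesis using continuous_on_measurable_torus[OF c] by (simp add: converges_in_power_def)
qed

lemma converges_in_power_dominated:
  assumes q: "1 \<le> q" and m [measurable]: "f \<in> borel_measurable haar_torus" and fin: "power_integral q f < \<infinity>"
    and g: "\<And>n. converges_in_power q (g n)" and lim: "\<And>\<zeta>. \<zeta> \<in> torus \<Longrightarrow> (\<lambda>n. g n \<zeta>) \<longlonglongrightarrow> f \<zeta>"
    and h: "h \<in> borel_measurable haar_torus" "power_integral q h < \<infinity>"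
      "\<And>n \<zeta>. \<zeta> \<in> torus \<Longrightarrow> norm (f \<zeta> - g n \<zeta>) \<le> norm (h \<zeta>)"
  shows "converges_in_power q f"
proof (rule converges_in_power_approx[OF q m fin])
  fix e :: real assume e: "e > 0"
  have [measurable]: "g n \<in> borel_measurable haar_torus" for n using g by (auto simp: converges_in_power_def)
  note [measurable] = h(1)
  have "(\<lambda>n. (\<integral>\<^sup>+ \<zeta>. ennreal (norm (f \<zeta> - g n \<zeta>) powr q) \<partial>haar_torus)) \<longlonglongrightarrow> (\<integral>\<^sup>+ \<zeta>. 0 \<partial>(haar_torus :: (complex ^ 'n) measure))"
  proof (rule nn_integral_dominated_convergence[where w="\<lambda>\<zeta>. ennreal (norm (h \<zeta>) powr q)"])
    show "AE \<zeta> in haar_torus. ennreal (norm (f \<zeta> - g n \<zeta>) powr q) \<le> ennreal (norm (h \<zeta>) powr q)" for n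
      using h(3) q by (intro AE_I2 ennreal_leI powr_mono2) auto
    show "(\<integral>\<^sup>+ \<zeta>. ennreal (norm (h \<zeta>) powr q) \<partial>haar_torus) < \<infinity>" using h(2) by (simp add: power_integral_def)
    show "AE \<zeta> in haar_torus. (\<lambda>n. ennreal (norm (f \<zeta> - g n \<zeta>) powr q)) \<longlonglongrightarrow> 0"
    proof (rule AE_I2)
      fix \<zeta> :: "complex ^ 'n" assume "\<zeta> \<in> space haar_torus"
      then have "(\<lambda>n. norm (f \<zeta> - g n \<zeta>)) \<longlonglongrightarrow> norm (f \<zeta> - f \<zeta>)" using lim by (intro tendsto_intros) auto
      then have "(\<lambda>n. norm (f \<zeta> - g n \<zeta>) powr q) \<longlonglongrightarrow> 0 powr q"
        using q by (intro tendsto_powr2) auto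
      then show "(\<lambda>n. ennreal (norm (f \<zeta> - g n \<zeta>) powr q)) \<longlonglongrightarrow> 0"
        using tendsto_ennrealI by fastforce
    qed
  qed measurable
  then have "(\<lambda>n. power_integral q (\<lambda>\<zeta>. f \<zeta> - g n \<zeta>)) \<longlonglongrightarrow> 0" by (simp add: power_integral_def)
  from order_tendstoD(2)[OF this, of "ennreal e"] e
  obtain n where "power_integral q (\<lambda>\<zeta>. f \<zeta> - g n \<zeta>) < ennreal e" by (auto simp: eventually_sequentially)
  then show "\<exists>g. converges_in_power q g \<and> power_integral q (\<lambda>\<zeta>. f \<zeta> - g \<zeta>) \<le> ennreal e" using g less_imp_le by blast
qed

end


context poisson_parameters begin

text \<open>
  The indicator of a closed set is the limit of the Lipschitz functions
  \<open>\<lambda>\<zeta>. max 0 (1 - n * infdist \<zeta> F)\<close>.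
\<close>

lemma converges_in_power_closed:
  assumes q: "1 \<le> q" and F: "closed F"
  shows "converges_in_power q (indicator F)"
proof (cases "F = {}")
  case True
  then show ?thesis by (intro converges_in_power_lipschitz[OF q, of 0]) auto
next
  case False
  define g where "g = (\<lambda>n \<zeta>. complex_of_real (max 0 (1 - real n * infdist \<zeta> F)))"
  have bounds: "0 \<le> max 0 (1 - real n * infdist \<zeta> F)" "max 0 (1 - real n * infdist \<zeta> F) \<le> 1" for n \<zeta>
    using infdist_nonneg[of \<zeta> F] by (auto simp: max_def)
  show ?thesis
  proof (rule converges_in_power_dominated[OF q, where g=g and h="\<lambda>_. 1"])
    have "indicator F \<in> borel_measurable borel"
      using F by (intro borel_measurable_indicator) auto
    then show "indicator F \<in> borel_measurable haar_torus"
      by (rule borel_measurable_torus)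
    have "power_integral q (indicator F) \<le> ennreal (1 powr q)"
      using q by (intro power_integral_le_const) (auto simp: indicator_def)
    then show "power_integral q (indicator F) < \<infinity>" by (rule le_less_trans) simp
    have "power_integral q (\<lambda>_ :: complex ^ 'n. 1) \<le> ennreal (1 powr q)"
      using q by (intro power_integral_le_const) auto
    then show "power_integral q (\<lambda>_ :: complex ^ 'n. 1) < \<infinity>" by (rule le_less_trans) simp
    show "converges_in_power q (g n)" for n
    proof (rule converges_in_power_lipschitz[OF q])
      fix \<zeta> \<eta> :: "complex ^ 'n"
      have "\<bar>max 0 (1 - real n * infdist \<zeta> F) - max 0 (1 - real n * infdist \<eta> F)\<bar> \<le> \<bar>real n * (infdist \<eta> F - infdist \<zeta> F)\<bar>"
        unfolding right_diff_distrib by linarith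
      also have "\<dots> = real n * \<bar>infdist \<eta> F - infdist \<zeta> F\<bar>" by (simp add: abs_mult)
      also have "\<dots> \<le> real n * norm (\<zeta> - \<eta>)"
        using infdist_triangle_abs[of \<eta> F \<zeta>] by (intro mult_left_mono) (auto simp: dist_norm norm_minus_commute)
      finally show "norm (g n \<zeta> - g n \<eta>) \<le> real n * norm (\<zeta> - \<eta>)"
        unfolding g_def of_real_diff[symmetric] norm_of_real .
    qed simp
    show "(\<lambda>n. g n \<zeta>) \<longlonglongrightarrow> indicator F \<zeta>" for \<zeta>
    proof (cases "\<zeta> \<in> F")
      case True
      then show ?thesis by (simp add: g_def)
    next
      case False
      then have pos: "infdist \<zeta> F > 0"
        using in_closed_iff_infdist_zero[OF F \<open>F \<noteq> {}\<close>, of \<zeta>] infdist_nonneg[of \<zeta> F] by linarith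
      then obtain N :: nat where N: "1 < real N * infdist \<zeta> F" using reals_Archimedean3 by blast
      have "eventually (\<lambda>n. g n \<zeta> = 0) sequentially"
        using eventually_ge_at_top[of N]
      proof eventually_elim
        case (elim n)
        have "real N * infdist \<zeta> F \<le> real n * infdist \<zeta> F" using elim pos by (intro mult_right_mono) auto
        then show ?case using N by (simp add: g_def)
      qed
      then show ?thesis using False by (simp add: tendsto_eventually)
    qed
    show "norm (indicator F \<zeta> - g n \<zeta>) \<le> norm (1 :: complex)" for n \<zeta>
    proof -
      have "indicator F \<zeta> - g n \<zeta> = complex_of_real (indicator F \<zeta> - max 0 (1 - real n * infdist \<zeta> F))"
        by (simp add: g_def indicator_def)
      moreover have "\<bar>indicator F \<zeta> - max 0 (1 - real n * infdist \<zeta> F)\<bar> \<le> 1"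
        using bounds[where n=n and \<zeta>=\<zeta>] by (auto simp: indicator_def)
      ultimately show ?thesis by (simp only: norm_of_real norm_one)
    qed
  qed simp
qed

text \<open>
  The closed sets are stable under intersection and generate the Borel sets, and the convergence
  property is inherited by complements and by countable disjoint unions.
\<close>

lemma converges_in_power_borel:
  assumes q: "1 \<le> q" and A: "A \<in> sets borel"
  shows "converges_in_power q (indicator A)"
proof -
  have "sets borel = sigma_sets UNIV (Collect closed :: (complex ^ 'n) set set)"
    by (subst borel_eq_closed) (simp add: sets_measure_of)
  then have A': "A \<in> sigma_sets UNIV (Collect closed)" using A by simp
  have stable: "Int_stable (Collect closed :: (complex ^ 'n) set set)" by (auto simp: Int_stable_def)
  have "Collect closed \<subseteq> Pow (UNIV :: (complex ^ 'n) set)" by simp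
  from stable this A' show ?thesis
  proof (induction rule: sigma_sets_induct_disjoint)
    case (compl A)
    have "converges_in_power q (indicator UNIV)" using q by (intro converges_in_power_closed) auto
    from converges_in_power_add[OF q this converges_in_power_cmult[OF q compl(2), of "-1"]]
    show ?case by (rule converges_in_power_cong) (auto simp: indicator_def)
  next
    case (union A)
    show ?case
    proof (rule converges_in_power_dominated[OF q, where g="\<lambda>n \<zeta>. \<Sum>i<n. indicator (A i) \<zeta>" and h="\<lambda>_. 1"])
      show m: "indicator (\<Union>i. A i) \<in> borel_measurable haar_torus"
      proof (intro borel_measurable_torus borel_measurable_indicator)
        have "(\<Union>i. A i) \<in> sigma_sets UNIV (Collect closed)" using union(2) by (intro sigma_sets.Union) auto
        then show "(\<Union>i. A i) \<in> sets borel" by (simp add: borel_eq_closed sets_measure_of)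
      qed
      have "power_integral q (indicator (\<Union>i. A i)) \<le> ennreal (1 powr q)"
        using q by (intro power_integral_le_const) (auto simp: indicator_def)
      then show "power_integral q (indicator (\<Union>i. A i)) < \<infinity>" by (rule le_less_trans) simp
      have "power_integral q (\<lambda>_ :: complex ^ 'n. 1) \<le> ennreal (1 powr q)"
        using q by (intro power_integral_le_const) auto
      then show "power_integral q (\<lambda>_ :: complex ^ 'n. 1) < \<infinity>" by (rule le_less_trans) simp
      show "converges_in_power q (\<lambda>\<zeta>. \<Sum>i<n. indicator (A i) \<zeta>)" for n
      proof (induction n)
        case 0
        show ?case using q by (intro converges_in_power_lipschitz[of q 0]) auto
      next
        case (Suc n)
        then show ?case using converges_in_power_add[OF q Suc union(3)[of n]] by simp
      qed
      have eq: "(\<Sum>i<n. indicator (A i) \<zeta>) = (indicator (\<Union>i<n. A i) \<zeta> :: complex)" for n \<zeta>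
        using union(1) by (subst indicator_UN_disjoint) (auto simp: disjoint_family_on_def)
      show "(\<lambda>n. \<Sum>i<n. indicator (A i) \<zeta>) \<longlonglongrightarrow> (indicator (\<Union>i. A i) \<zeta> :: complex)" for \<zeta>
        unfolding eq by (rule LIMSEQ_indicator_UN)
      show "norm (indicator (\<Union>i. A i) \<zeta> - (\<Sum>i<n. indicator (A i) \<zeta>) :: complex) \<le> norm (1::complex)" for n \<zeta>
        unfolding eq by (auto simp: indicator_def)
    qed simp
  next
    case (basic A)
    then show ?case by (intro converges_in_power_closed[OF q]) simp
  next
    case empty
    show ?case by (rule converges_in_power_closed[OF q closed_empty])
  qed
qed

lemma converges_in_power_simple:
  assumes q: "1 \<le> q" and f: "simple_function haar_torus (f :: complex ^ 'n \<Rightarrow> complex)"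
  shows "converges_in_power q f"
proof -
  have ind: "converges_in_power q (\<lambda>\<zeta>. y * indicator (f -` {y} \<inter> torus) \<zeta>)" for y
  proof -
    have "f -` {y} \<inter> torus \<in> sets haar_torus" using simple_functionD(2)[OF f, of "{y}"] by simp
    then obtain B where "B \<in> sets borel" "f -` {y} \<inter> torus = torus \<inter> B" by (auto simp: sets_restrict_space)
    then have "converges_in_power q (indicator B)" "\<And>\<zeta>. \<zeta> \<in> torus \<Longrightarrow> indicator B \<zeta> = (indicator (f -` {y} \<inter> torus) \<zeta> :: complex)"
      by (auto intro: converges_in_power_borel[OF q] simp: indicator_def)
    from converges_in_power_cmult[OF q converges_in_power_cong[OF this]] show ?thesis .
  qed
  have "finite Y \<Longrightarrow> converges_in_power q (\<lambda>\<zeta>. \<Sum>y\<in>Y. y * indicator (f -` {y} \<inter> torus) \<zeta>)" for Y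
  proof (induction Y rule: finite_induct)
    case empty
    show ?case using q by (intro converges_in_power_lipschitz[of q 0]) auto
  next
    case (insert y Y)
    from converges_in_power_add[OF q ind[of y] insert(3)] show ?case
      by (simp only: sum.insert[OF insert(1,2)])
  qed
  from this[OF simple_functionD(1)[OF f]] show ?thesis
  proof (rule converges_in_power_cong)
    fix \<zeta> :: "complex ^ 'n" assume "\<zeta> \<in> torus"
    then have "\<zeta> \<in> space haar_torus" by simp
    have "(\<Sum>y\<in>f ` space haar_torus. y * indicator (f -` {y} \<inter> torus) \<zeta>) =
        (\<Sum>y\<in>f ` space haar_torus. indicator (f -` {y} \<inter> space haar_torus) \<zeta> *\<^sub>R y)"
      by (intro sum.cong refl) (simp add: indicator_def)
    also have "\<dots> = f \<zeta>"
      by (rule simple_function_indicator_representation_banach[OF f \<open>\<zeta> \<in> space haar_torus\<close>, symmetric])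
    finally show "(\<Sum>y\<in>f ` space haar_torus. y * indicator (f -` {y} \<inter> torus) \<zeta>) = f \<zeta>" .
  qed
qed

text \<open>
  The approximating simple functions are dominated by \<open>2 * |f|\<close>, so that their distance to
  \<open>f\<close> is dominated by \<open>3 * |f|\<close>.
\<close>

lemma converges_in_power_Lp:
  assumes q: "1 \<le> q" and m [measurable]: "f \<in> borel_measurable haar_torus" and fin: "power_integral q f < \<infinity>"
  shows "converges_in_power q f"
proof -
  obtain F where "\<forall>i. simple_function haar_torus (F i)" "\<forall>\<zeta>\<in>space haar_torus. (\<lambda>i. F i \<zeta>) \<longlonglongrightarrow> f \<zeta>"
      "\<forall>i. \<forall>\<zeta>\<in>space haar_torus. dist (F i \<zeta>) 0 \<le> 2 * dist (f \<zeta>) 0"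
    using borel_measurable_implies_sequence_metric[OF m, of 0] by blast
  then have F: "\<And>i. simple_function haar_torus (F i)" "\<And>\<zeta>. \<zeta> \<in> torus \<Longrightarrow> (\<lambda>i. F i \<zeta>) \<longlonglongrightarrow> f \<zeta>"
      "\<And>i \<zeta>. \<zeta> \<in> torus \<Longrightarrow> dist (F i \<zeta>) 0 \<le> 2 * dist (f \<zeta>) 0"
    by simp_all
  show ?thesis
  proof (rule converges_in_power_dominated[OF q m fin, where g=F and h="\<lambda>\<zeta>. 3 * f \<zeta>"])
    show "converges_in_power q (F n)" for n by (rule converges_in_power_simple[OF q F(1)])
    show "power_integral q (\<lambda>\<zeta>. 3 * f \<zeta>) < \<infinity>"
      using fin by (simp add: power_integral_cmult[OF m] ennreal_mult_less_top)
    show "norm (f \<zeta> - F n \<zeta>) \<le> norm (3 * f \<zeta>)" if "\<zeta> \<in> torus" for n \<zeta>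
      using F(3)[OF that, of n] norm_triangle_ineq4[of "f \<zeta>" "F n \<zeta>"] by (simp add: norm_mult)
  qed (use F in auto)
qed

end

section \<open>The boundary behaviour of Poisson integrals\<close>

lemma Lp_norm_finite_exponent:
  assumes "p < \<infinity>"
  shows "Lp_norm haar_torus p f = (if power_integral (enn2real p) f = \<infinity> then \<infinity>
    else ennreal (enn2real (power_integral (enn2real p) f) powr (1 / enn2real p)))"
proof -
  have "p \<noteq> \<infinity>" using assms by simp
  then show ?thesis by (simp only: Lp_norm_def power_integral_def Let_def if_False)
qed

theorem theorem3p14:
  fixes \<alpha> \<beta> :: "complex ^ 'n::finite"
    and p :: ennreal
    and \<psi> :: "complex ^ 'n \<Rightarrow> complex"
  assumes "\<And>j. Re (\<alpha> $ j) + Re (\<beta> $ j) > -1"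
    and "\<And>j. \<alpha> $ j \<notin> {- of_nat k | k. 1 \<le> k}"
    and "\<And>j. \<beta> $ j \<notin> {- of_nat k | k. 1 \<le> k}"
    and "1 \<le> p"
    and "\<psi> \<in> Lp_space haar_torus p"
  shows "poisson_integral \<alpha> \<beta> \<psi> \<in> sh_p \<alpha> \<beta> p \<and>
    sh_norm p (poisson_integral \<alpha> \<beta> \<psi>) \<le> ennreal (K_const \<alpha> \<beta>) * Lp_norm haar_torus p \<psi> \<and>
    (p < \<infinity> \<longrightarrow>
      ((\<lambda>r. Lp_norm haar_torus p (\<lambda>\<zeta>. dilate (poisson_integral \<alpha> \<beta> \<psi>) r \<zeta> - \<psi> \<zeta>)) \<longlongrightarrow> 0)
        (at (\<chi> j. 1) within radii))"
proof -
  have pole: "a + 1 \<notin> \<int>\<^sub>\<le>\<^sub>0" if "a \<notin> {- of_nat k | k. 1 \<le> k}" for a :: complex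
  proof
    assume "a + 1 \<in> \<int>\<^sub>\<le>\<^sub>0"
    then obtain n where "a + 1 = - of_nat n" by (auto elim: nonpos_Ints_cases')
    then have "a = - of_nat (Suc n)" by (simp add: algebra_simps eq_neg_iff_add_eq_0)
    then have "a \<in> {- of_nat k | k. 1 \<le> k}" by (intro CollectI exI[of _ "Suc n"]) simp
    with that show False by contradiction
  qed
  interpret poisson_parameters \<alpha> \<beta>
    using assms(1) pole[OF assms(2)] pole[OF assms(3)] by unfold_locales auto
  interpret prob_space "haar_torus :: (complex ^ 'n) measure" by (rule prob_space_haar_torus)
  have m [measurable]: "\<psi> \<in> borel_measurable haar_torus" and fin: "Lp_norm haar_torus p \<psi> < \<infinity>"
    using assms(5) by (auto simp: Lp_space_def)
  show ?thesis
  proof (cases "p = \<infinity>")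
    case True
    define E where "E = enn2real (Lp_norm haar_torus p \<psi>)"
    have E: "Lp_norm haar_torus p \<psi> = ennreal E" "0 \<le> E" using fin by (auto simp: E_def)
    \<comment> \<open>for the exponent \<open>\<infinity>\<close> the norm \<open>E\<close> is an essential bound of the function\<close>
    have AE: "AE \<zeta> in haar_torus. norm (\<psi> \<zeta>) \<le> E"
      using esssup_AE[of "\<lambda>\<zeta>. ennreal (norm (\<psi> \<zeta>))" haar_torus] E True by (simp add: Lp_norm_def)
    have int: "integrable haar_torus \<psi>" using AE by (intro integrable_const_bound[of _ E]) auto
    have "sh_norm p (T \<psi>) \<le> ennreal K * Lp_norm haar_torus p \<psi>"
      unfolding sh_norm_def E(1) using True poisson_integral_bounded[OF m AE E(2)] K_pos E(2)
      by (auto intro!: SUP_least ennreal_leI simp: ennreal_mult'[symmetric])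
    moreover have "ennreal K * Lp_norm haar_torus p \<psi> < \<infinity>" using fin by (simp add: ennreal_mult_less_top)
    ultimately show ?thesis
      using poisson_integral_in_sh[OF int, of \<alpha> \<beta>] True by (auto simp: sh_p_def intro: le_less_trans)
  next
    case False
    then have p: "p < \<infinity>" by (simp add: less_top)
    define q where "q = enn2real p"
    have q: "1 \<le> q"
      using assms(4) p enn2real_mono[of 1 p] by (simp add: q_def)
    have I: "power_integral q \<psi> < \<infinity>" using fin Lp_norm_finite_exponent[OF p, of \<psi>] by (auto simp: q_def less_top split: if_splits)
    have int: "integrable haar_torus \<psi>" by (rule power_integral_finite_integrable(2)[OF m I q])
    have Lp: "Lp_norm haar_torus p f = ennreal (enn2real (power_integral q f) powr (1 / q))" if "power_integral q f < \<infinity>" for f :: "complex ^ 'n \<Rightarrow> complex"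
      using that Lp_norm_finite_exponent[OF p, of f] by (auto simp: q_def)
    have bound: "Lp_norm haar_torus p (dilate (T \<psi>) r) \<le> ennreal K * Lp_norm haar_torus p \<psi>" if r: "r \<in> radii" for r
    proof -
      note le = power_integral_poisson_le[OF q m I r]
      have Kfin: "ennreal (K powr q) * power_integral q \<psi> < \<infinity>" using I by (simp add: ennreal_mult_less_top)
      have "enn2real (power_integral q (dilate (T \<psi>) r)) \<le> enn2real (ennreal (K powr q) * power_integral q \<psi>)"
        using le Kfin by (intro enn2real_mono) auto
      also have "\<dots> = K powr q * enn2real (power_integral q \<psi>)" by (simp add: enn2real_mult)
      finally have "enn2real (power_integral q (dilate (T \<psi>) r)) powr (1 / q) \<le> (K powr q * enn2real (power_integral q \<psi>)) powr (1 / q)"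
        using q by (intro powr_mono2) auto
      also have "\<dots> = K * enn2real (power_integral q \<psi>) powr (1 / q)"
        using q K_pos by (simp add: powr_mult powr_powr)
      finally show ?thesis
        using Lp[OF I] Lp[OF le_less_trans[OF le Kfin]] K_pos by (simp add: ennreal_mult'[symmetric] ennreal_leI)
    qed
    then have sh_le: "sh_norm p (T \<psi>) \<le> ennreal K * Lp_norm haar_torus p \<psi>"
      using False by (auto simp: sh_norm_def intro!: SUP_least)
    moreover have "ennreal K * Lp_norm haar_torus p \<psi> < \<infinity>" using fin by (simp add: ennreal_mult_less_top)
    ultimately have "T \<psi> \<in> sh_p \<alpha> \<beta> p"
      using poisson_integral_in_sh[OF int, of \<alpha> \<beta>] by (auto simp: sh_p_def intro: le_less_trans)
    moreover have "((\<lambda>r. Lp_norm haar_torus p (\<lambda>\<zeta>. dilate (T \<psi>) r \<zeta> - \<psi> \<zeta>)) \<longlongrightarrow> 0) F1"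
    proof -
      have lim: "((\<lambda>r. power_integral q (\<lambda>\<zeta>. dilate (T \<psi>) r \<zeta> - \<psi> \<zeta>)) \<longlongrightarrow> 0) F1"
        using converges_in_power_Lp[OF q m I] by (simp add: converges_in_power_def)
      have "((\<lambda>r. enn2real (power_integral q (\<lambda>\<zeta>. dilate (T \<psi>) r \<zeta> - \<psi> \<zeta>))) \<longlongrightarrow> 0) F1"
        using lim by (intro tendsto_enn2real) simp_all
      then have "((\<lambda>r. enn2real (power_integral q (\<lambda>\<zeta>. dilate (T \<psi>) r \<zeta> - \<psi> \<zeta>)) powr (1 / q)) \<longlongrightarrow> 0 powr (1 / q)) F1"
        using q by (intro tendsto_powr2) auto
      then have "((\<lambda>r. ennreal (enn2real (power_integral q (\<lambda>\<zeta>. dilate (T \<psi>) r \<zeta> - \<psi> \<zeta>)) powr (1 / q))) \<longlongrightarrow> ennreal (0 powr (1 / q))) F1"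
        by (rule tendsto_ennrealI)
      moreover have "eventually (\<lambda>r. power_integral q (\<lambda>\<zeta>. dilate (T \<psi>) r \<zeta> - \<psi> \<zeta>) < \<infinity>) F1"
        using lim by (rule order_tendstoD) simp
      then have "eventually (\<lambda>r. ennreal (enn2real (power_integral q (\<lambda>\<zeta>. dilate (T \<psi>) r \<zeta> - \<psi> \<zeta>)) powr (1 / q))
          = Lp_norm haar_torus p (\<lambda>\<zeta>. dilate (T \<psi>) r \<zeta> - \<psi> \<zeta>)) F1"
        by eventually_elim (simp add: Lp)
      ultimately show ?thesis by (auto intro: Lim_transform_eventually)
    qed
    ultimately show ?thesis using sh_le by blast
  qed
qed

end
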